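(* There is a constant $d_0>0$ such that the following holds. For $d\ge d_0$ and $n\ge 4$ even, the Glauber dynamics (Metropolis) chain ${\mathcal M}_3$ on the set ${\mathcal C}_3$ of proper $3$-colorings of the discrete torus ${\mathbb Z}^d_n$ has mixing time $$\tau_{{\mathcal M}_3}\ge \exp\left\{\frac{n^{d-1}}{d^4\log^2 n}\right\}.$$
   Context: The discrete torus ${\mathbb Z}^d_n$ (with $n$ even) has vertex set $[n]^d$, two vertices being adjacent if they differ in exactly one coordinate and by $1$ (mod $n$) there. A proper $3$-coloring is a map $V\to\{0,1,2\}$ with adjacent vertices colored differently. The Metropolis chain ${\mathcal M}_3$ on ${\mathcal C}_3$: from a coloring $\chi$, choose a vertex $v$ uniformly from $V$ and a color $j$ uniformly from $\{0,1,2\}$, recolor $v$ with $j$ if the result is a proper coloring, otherwise stay at $\chi$; i.e. $P(\chi_1,\chi_2)=1/(3|V|)$ if $\chi_1,\chi_2$ differ at exactly one vertex, $0$ if they differ at more than one vertex, and the remaining mass on $\chi_1=\chi_2$. Its stationary distribution $\pi$ is uniform on ${\mathcal C}_3$. For an ergodic chain with transition probabilities $P$ and stationary distribution $\pi$ on $\Omega$, the mixing time is $\tau=\min\{t_0:\max_{x\in\Omega}\frac12\sum_{y}|P^t(x,y)-\pi(y)|\le 1/e\ \ \forall t>t_0\}$. *)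

theory Defs
  imports "HOL-Probability.Probability"
begin

section \<open>The discrete torus and its proper colorings\<close>

text \<open>Functions are taken extensional (via \<open>\<rightarrow>\<^sub>E\<close>), so that vertices and colorings are determined
  by their values on the index set and the vertex set respectively.\<close>

definition torus :: "nat \<Rightarrow> nat \<Rightarrow> (nat \<Rightarrow> nat) set" where
  "torus n d = {..<d} \<rightarrow>\<^sub>E {..<n}"

definition torus_adj :: "nat \<Rightarrow> nat \<Rightarrow> (nat \<Rightarrow> nat) \<Rightarrow> (nat \<Rightarrow> nat) \<Rightarrow> bool" where
  "torus_adj n d x y \<longleftrightarrow>
     (\<exists>i<d. (\<forall>j<d. j \<noteq> i \<longrightarrow> x j = y j) \<and> x i \<noteq> y i \<and>
            (y i mod n = (x i + 1) mod n \<or> x i mod n = (y i + 1) mod n))"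

definition proper_colorings :: "'v set \<Rightarrow> ('v \<Rightarrow> 'v \<Rightarrow> bool) \<Rightarrow> nat \<Rightarrow> ('v \<Rightarrow> nat) set" where
  "proper_colorings V adj q =
     {\<sigma> \<in> V \<rightarrow>\<^sub>E {..<q}. \<forall>x\<in>V. \<forall>y\<in>V. adj x y \<longrightarrow> \<sigma> x \<noteq> \<sigma> y}"

section \<open>The Metropolis chain\<close>

definition metropolis ::
    "'v set \<Rightarrow> ('v \<Rightarrow> 'v \<Rightarrow> bool) \<Rightarrow> nat \<Rightarrow> ('v \<Rightarrow> nat) \<Rightarrow> ('v \<Rightarrow> nat) pmf" where
  "metropolis V adj q \<sigma> =
     do {
       v \<leftarrow> pmf_of_set V;
       j \<leftarrow> pmf_of_set {..<q};
       return_pmf (if \<sigma>(v := j) \<in> proper_colorings V adj q then \<sigma>(v := j) else \<sigma>)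
     }"

section \<open>Mixing time of a Markov chain with finite state space\<close>

primrec steps :: "('s \<Rightarrow> 's pmf) \<Rightarrow> nat \<Rightarrow> 's \<Rightarrow> 's pmf" where
  "steps K 0 x = return_pmf x"
| "steps K (Suc t) x = bind_pmf (steps K t x) K"

text \<open>The minimum is taken in the extended naturals, so that a chain that never gets and stays
  close to \<open>\<pi>\<close> (for instance a reducible one) has mixing time \<open>\<infinity>\<close>.\<close>

definition mixing_time :: "'s set \<Rightarrow> ('s \<Rightarrow> 's pmf) \<Rightarrow> 's pmf \<Rightarrow> enat" where
  "mixing_time \<Omega> K \<pi> =
     Inf (enat ` {t\<^sub>0. \<forall>t>t\<^sub>0.
       (MAX x\<in>\<Omega>. 1 / 2 * (\<Sum>y\<in>\<Omega>. \<bar>pmf (steps K t x) y - pmf \<pi> y\<bar>)) \<le> 1 / exp 1})"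

section \<open>Consistency with the explicit transition probabilities\<close>

lemma finite_proper_colorings: "finite V \<Longrightarrow> finite (proper_colorings V adj q)"
  unfolding proper_colorings_def
  by (rule finite_subset[of _ "V \<rightarrow>\<^sub>E {..<q}"]) (auto simp: finite_PiE)

lemma finite_torus: "finite (torus n d)"
  unfolding torus_def by (auto intro!: finite_PiE)

lemma pmf_metropolis:
  assumes V: "finite V" "V \<noteq> {}" and q: "q > 0"
  shows "pmf (metropolis V adj q \<sigma>) \<sigma>' =
     (\<Sum>v\<in>V. \<Sum>j<q. of_bool
        ((if \<sigma>(v := j) \<in> proper_colorings V adj q then \<sigma>(v := j) else \<sigma>) = \<sigma>')) / (q * card V)"
proof -
  have ne: "{..<q} \<noteq> {}" using q by auto
  have ret: "pmf (return_pmf z) \<sigma>' = of_bool (z = \<sigma>')" for z :: "'a \<Rightarrow> nat"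
    by (auto simp: indicator_def)
  show ?thesis
    unfolding metropolis_def
    by (simp only: pmf_bind ret integral_pmf_of_set[OF V(2,1)] integral_pmf_of_set[OF ne finite_lessThan]
        sum_divide_distrib[symmetric] card_lessThan divide_divide_eq_left of_nat_mult)
qed

lemma pmf_metropolis_one:
  assumes V: "finite V"
    and col: "\<sigma> \<in> proper_colorings V adj q" "\<sigma>' \<in> proper_colorings V adj q"
    and diff: "{v \<in> V. \<sigma> v \<noteq> \<sigma>' v} = {u}"
  shows "pmf (metropolis V adj q \<sigma>) \<sigma>' = 1 / (q * card V)"
proof -
  have u: "u \<in> V" "\<sigma> u \<noteq> \<sigma>' u" using diff by auto
  have eq: "\<sigma> v = \<sigma>' v" if "v \<noteq> u" for v
    using that diff col by (cases "v \<in> V") (auto simp: proper_colorings_def PiE_def extensional_def)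
  have upd: "\<sigma>' = \<sigma>(u := \<sigma>' u)" using eq by auto
  have lt: "\<sigma>' u < q" using u col by (auto simp: proper_colorings_def PiE_def Pi_def)
  have iff: "(if \<sigma>(v := j) \<in> proper_colorings V adj q then \<sigma>(v := j) else \<sigma>) = \<sigma>'
      \<longleftrightarrow> v = u \<and> j = \<sigma>' u" for v j
  proof
    assume L: "(if \<sigma>(v := j) \<in> proper_colorings V adj q then \<sigma>(v := j) else \<sigma>) = \<sigma>'"
    then have "\<sigma>' = \<sigma>(v := j)" using u(2) by (auto split: if_splits)
    then show "v = u \<and> j = \<sigma>' u" using u(2) by (cases "v = u") auto
  next
    assume "v = u \<and> j = \<sigma>' u"
    then show "(if \<sigma>(v := j) \<in> proper_colorings V adj q then \<sigma>(v := j) else \<sigma>) = \<sigma>'"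
      using upd[symmetric] col(2) by simp
  qed
  have "(\<Sum>v\<in>V. \<Sum>j<q. of_bool (v = u \<and> j = \<sigma>' u)) =
        (\<Sum>v\<in>V. if v = u then (\<Sum>j<q. if j = \<sigma>' u then 1 else (0::real)) else 0)"
    by (intro sum.cong) auto
  also have "\<dots> = 1" using u V lt by simp
  finally show ?thesis
    using V u(1) lt by (subst pmf_metropolis) (auto simp only: iff)
qed

lemma pmf_metropolis_many:
  assumes V: "finite V" and diff: "u \<in> V" "v \<in> V" "u \<noteq> v" "\<sigma> u \<noteq> \<sigma>' u" "\<sigma> v \<noteq> \<sigma>' v" and q: "q > 0"
  shows "pmf (metropolis V adj q \<sigma>) \<sigma>' = 0"
proof -
  have "(if \<sigma>(w := j) \<in> proper_colorings V adj q then \<sigma>(w := j) else \<sigma>) \<noteq> \<sigma>'" for w j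
  proof (cases "w = u")
    case True
    then show ?thesis using diff(3,5) by (metis fun_upd_other)
  next
    case False
    then show ?thesis using diff(4) by (metis fun_upd_other)
  qed
  then show ?thesis
    using V diff(1) q by (subst pmf_metropolis) auto
qed

lemma pmf_metropolis_commute:
  assumes V: "finite V" and q: "q > 0"
    and col: "\<sigma> \<in> proper_colorings V adj q" "\<sigma>' \<in> proper_colorings V adj q"
  shows "pmf (metropolis V adj q \<sigma>) \<sigma>' = pmf (metropolis V adj q \<sigma>') \<sigma>"
proof -
  let ?D = "{v \<in> V. \<sigma> v \<noteq> \<sigma>' v}"
  consider "?D = {}" | u where "?D = {u}" | u v where "u \<in> ?D" "v \<in> ?D" "u \<noteq> v"
    by blast
  then show ?thesis
  proof cases
    case 1
    then have "\<sigma> = \<sigma>'"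
      using col by (intro PiE_ext[of \<sigma> V "\<lambda>_. {..<q}" \<sigma>']) (auto simp: proper_colorings_def)
    then show ?thesis by simp
  next
    case (2 u)
    have "{v \<in> V. \<sigma>' v \<noteq> \<sigma> v} = {v \<in> V. \<sigma> v \<noteq> \<sigma>' v}" by auto
    then have 3: "{v \<in> V. \<sigma>' v \<noteq> \<sigma> v} = {u}" using 2 by simp
    show ?thesis
      by (simp only: pmf_metropolis_one[OF V col 2] pmf_metropolis_one[OF V col(2,1) 3])
  next
    case (3 u v)
    then have uv: "u \<in> V" "v \<in> V" "\<sigma> u \<noteq> \<sigma>' u" "\<sigma> v \<noteq> \<sigma>' v" by auto
    show ?thesis
      by (simp only: pmf_metropolis_many[of V u v \<sigma> \<sigma>', OF V uv(1,2) 3(3) uv(3,4) q]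
          pmf_metropolis_many[of V u v \<sigma>' \<sigma>, OF V uv(1,2) 3(3) uv(3,4)[symmetric] q])
  qed
qed

lemma set_pmf_metropolis:
  assumes "finite V" "V \<noteq> {}" "q > 0" "\<sigma> \<in> proper_colorings V adj q"
  shows "set_pmf (metropolis V adj q \<sigma>) \<subseteq> proper_colorings V adj q"
proof -
  have "{..<q} \<noteq> {}" using assms by auto
  then show ?thesis
    using assms by (auto simp: metropolis_def split: if_splits)
qed

lemma uniform_stationary_metropolis:
  fixes V :: "'v set" and adj q
  defines "\<pi> \<equiv> pmf_of_set (proper_colorings V adj q)"
  assumes V: "finite V" "V \<noteq> {}" and q: "q > 0" and ne: "proper_colorings V adj q \<noteq> {}"
  shows "bind_pmf \<pi> (metropolis V adj q) = \<pi>"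
proof (rule pmf_eqI)
  fix y :: "'v \<Rightarrow> nat"
  let ?C = "proper_colorings V adj q"
  have fin: "finite ?C" using V(1) by (rule finite_proper_colorings)
  have eq: "pmf (bind_pmf \<pi> (metropolis V adj q)) y =
      (\<Sum>x\<in>?C. pmf (metropolis V adj q x) y) / card ?C"
    unfolding \<pi>_def using fin ne by (simp add: pmf_bind integral_pmf_of_set)
  show "pmf (bind_pmf \<pi> (metropolis V adj q)) y = pmf \<pi> y"
  proof (cases "y \<in> ?C")
    case True
    have "(\<Sum>x\<in>?C. pmf (metropolis V adj q x) y) = (\<Sum>x\<in>?C. pmf (metropolis V adj q y) x)"
      using V q True by (intro sum.cong refl pmf_metropolis_commute)
    also have "\<dots> = 1"
      by (rule sum_pmf_eq_1[OF fin set_pmf_metropolis[OF V q True]])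
    finally show ?thesis using eq fin ne True by (simp add: \<pi>_def)
  next
    case False
    have "pmf (metropolis V adj q x) y = 0" if "x \<in> ?C" for x
      using set_pmf_metropolis[OF V q that] False by (auto simp: pmf_eq_0_set_pmf)
    then show ?thesis using eq fin ne False by (simp add: \<pi>_def)
  qed
qed

end

theory Submission
  imports Defs
begin

text \<open>For even \<open>n \<ge> 6\<close> the chain is reducible: walking once around the torus along a coordinate line
  gives a winding number of the colors that no single-site move changes. The colorings of positive
  winding number are closed under the dynamics and make up at most half of all colorings (reflect
  the colors), so the chain never mixes.

  For \<open>n = 4\<close> the torus is the hypercube of dimension \<open>2d\<close>. Identify a vertex with a pair
  \<open>(P, Q)\<close> of subsets of \<open>{..<d}\<close>, let \<open>E\<close> be the even vertices (\<open>|P| + |Q|\<close> even), and split the odd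
  ones into \<open>O\<^sub>1\<close> (\<open>|P|\<close> odd) and \<open>O\<^sub>2\<close> (\<open>|P|\<close> even); every \<open>v \<in> E\<close> has \<open>d\<close> neighbours in each part. Call
  \<open>v \<in> E\<close> free if its neighbours in \<open>O\<^sub>1\<close> have one color, and an edge between \<open>v \<in> E\<close> and \<open>u \<in> O\<^sub>2\<close> bad
  if \<open>v\<close> is free exactly when all neighbours of \<open>u\<close> have one color. Revealing a random coloring in the
  order \<open>O\<^sub>1\<close>, \<open>E\<close>, \<open>O\<^sub>2\<close> and applying Shearer's inequality to each stage shows that a family of
  colorings with at least \<open>|E| / 32\<close> bad edges each has size at most \<open>exp (|E| (ln 2 - 1 / (200 d)))\<close>,
  whereas there are at least \<open>2 ^ |E|\<close> colorings. The bottleneck consists of the colorings in which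
  about half of the \<open>u \<in> O\<^sub>2\<close> see only color \<open>0\<close>; the two phases which it separates must be joined by
  many bad edges, because of a Poincare inequality on the cube.\<close>


section \<open>Conditional entropy of a uniform variable\<close>

text \<open>Around a 4-cycle the color steps, each 1 or -1 mod 3, add up to an even multiple of 3
  between -4 and 4, hence to 0: for \<open>n = 4\<close> there is no winding number, whereas 6 is
  possible once \<open>n \<ge> 6\<close>. So side four needs the entropy argument, and to leading
  order that argument loses nothing: a free vertex of \<open>E\<close> contributes
  \<open>ln 2\<close> itself, and one that is not free contributes as much through its neighbours,
  half in \<open>O1\<close> and half in \<open>O2\<close>. A saving can only come from the interface
  between the two regimes, and since one edge carries a share \<open>1 / d\<close> of a vertex, the
  saving is of order \<open>1 / d\<close> per vertex. This is the obstacle that shapes the proof: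
  all auxiliary information, above all the set of colors around each vertex of \<open>E\<close>, has
  to cost a small fraction of \<open>1 / d\<close> per vertex. Large Shearer blocks, built from
  translates that mostly see the same set of colors, achieve this.\<close>

definition fibre :: "'w set \<Rightarrow> ('w \<Rightarrow> 'x) \<Rightarrow> 'w \<Rightarrow> 'w set" where
  "fibre \<Omega> X \<omega> = {\<omega>'\<in>\<Omega>. X \<omega>' = X \<omega>}"

text \<open>Entropies are not normalized: for \<open>\<omega>\<close> uniform on \<open>\<Omega>\<close>, this is \<open>|\<Omega>|\<close> times the conditional
  entropy of \<open>X\<close> given \<open>Y\<close>, in nats.\<close>

definition cond_ent :: "'w set \<Rightarrow> ('w \<Rightarrow> 'x) \<Rightarrow> ('w \<Rightarrow> 'y) \<Rightarrow> real" where
  "cond_ent \<Omega> X Y = (\<Sum>\<omega>\<in>\<Omega>. ln (card (fibre \<Omega> Y \<omega>) / card (fibre \<Omega> (\<lambda>\<omega>. (X \<omega>, Y \<omega>)) \<omega>)))"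

definition joint :: "('i \<Rightarrow> 'w \<Rightarrow> 'x) \<Rightarrow> 'i set \<Rightarrow> 'w \<Rightarrow> 'i \<Rightarrow> 'x" where
  "joint X I \<omega> = restrict (\<lambda>i. X i \<omega>) I"

lemma joint_eq_iff: "joint X I \<omega> = joint X I \<omega>' \<longleftrightarrow> (\<forall>i\<in>I. X i \<omega> = X i \<omega>')"
  by (auto simp: joint_def restrict_def fun_eq_iff)

lemma joint_apply: "i \<in> I \<Longrightarrow> joint X I \<omega> i = X i \<omega>"
  by (simp add: joint_def)

lemma fibre_self: "\<omega> \<in> \<Omega> \<Longrightarrow> \<omega> \<in> fibre \<Omega> X \<omega>"
  by (simp add: fibre_def)

lemma finite_fibre: "finite \<Omega> \<Longrightarrow> finite (fibre \<Omega> X \<omega>)"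
  by (simp add: fibre_def)

lemma card_fibre_pos: "finite \<Omega> \<Longrightarrow> \<omega> \<in> \<Omega> \<Longrightarrow> 0 < card (fibre \<Omega> X \<omega>)"
  using fibre_self[of \<omega> \<Omega> X] finite_fibre[of \<Omega> X \<omega>] by (auto simp: card_gt_0_iff)

lemma cond_ent_cong:
  assumes "\<And>\<omega> \<omega>'. \<omega> \<in> \<Omega> \<Longrightarrow> \<omega>' \<in> \<Omega> \<Longrightarrow> Y \<omega>' = Y \<omega> \<longleftrightarrow> Y' \<omega>' = Y' \<omega>"
    and "\<And>\<omega> \<omega>'. \<omega> \<in> \<Omega> \<Longrightarrow> \<omega>' \<in> \<Omega> \<Longrightarrow> Y \<omega>' = Y \<omega> \<Longrightarrow> X \<omega>' = X \<omega> \<longleftrightarrow> X' \<omega>' = X' \<omega>"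
  shows "cond_ent \<Omega> X Y = cond_ent \<Omega> X' Y'"
proof -
  have "fibre \<Omega> Y \<omega> = fibre \<Omega> Y' \<omega>" if "\<omega> \<in> \<Omega>" for \<omega>
    using assms(1) that by (auto simp: fibre_def)
  moreover have "fibre \<Omega> (\<lambda>\<omega>. (X \<omega>, Y \<omega>)) \<omega> = fibre \<Omega> (\<lambda>\<omega>. (X' \<omega>, Y' \<omega>)) \<omega>" if "\<omega> \<in> \<Omega>" for \<omega>
    using assms that by (auto simp: fibre_def)
  ultimately show ?thesis by (simp add: cond_ent_def)
qed

lemma sum_fibre_card:
  assumes "finite C"
  shows "(\<Sum>\<omega>\<in>C. g (X \<omega>) / real (card {\<omega>'\<in>C. X \<omega>' = X \<omega>})) = (\<Sum>x\<in>X ` C. g x)"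
proof -
  have "(\<Sum>\<omega>\<in>C. g (X \<omega>) / real (card {\<omega>'\<in>C. X \<omega>' = X \<omega>}))
      = (\<Sum>x\<in>X ` C. \<Sum>\<omega>\<in>{\<omega>\<in>C. X \<omega> = x}. g (X \<omega>) / real (card {\<omega>'\<in>C. X \<omega>' = X \<omega>}))"
    by (rule sum.image_gen[OF assms])
  also have "\<dots> = (\<Sum>x\<in>X ` C. g x)"
  proof (rule sum.cong[OF refl])
    fix x assume "x \<in> X ` C"
    then have "card {\<omega>\<in>C. X \<omega> = x} > 0" using assms by (auto simp: card_gt_0_iff)
    then show "(\<Sum>\<omega>\<in>{\<omega>\<in>C. X \<omega> = x}. g (X \<omega>) / real (card {\<omega>'\<in>C. X \<omega>' = X \<omega>})) = g x"
      by simp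
  qed
  finally show ?thesis .
qed

text \<open>Cross entropy dominates entropy. Here \<open>r\<close> is a code, a subprobability
  weight on the values of \<open>X\<close> for each value of \<open>Y\<close>; its ratio
  \<open>q\<close> to the true conditional probability has mean at most 1, and
  \<open>ln q \<le> q - 1\<close>. The conditioning, counting and coding bounds below all arise from
  a choice of \<open>r\<close>.\<close>

lemma gibbs:
  assumes fin: "finite \<Omega>"
    and pos: "\<And>\<omega>. \<omega> \<in> \<Omega> \<Longrightarrow> 0 < r (X \<omega>) (Y \<omega>)"
    and sub: "\<And>\<omega>. \<omega> \<in> \<Omega> \<Longrightarrow> (\<Sum>x\<in>X ` fibre \<Omega> Y \<omega>. r x (Y \<omega>)) \<le> 1"
  shows "cond_ent \<Omega> X Y \<le> (\<Sum>\<omega>\<in>\<Omega>. - ln (r (X \<omega>) (Y \<omega>)))"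
proof -
  let ?Z = "\<lambda>\<omega>. (X \<omega>, Y \<omega>)"
  define q where "q \<omega> = r (X \<omega>) (Y \<omega>) * card (fibre \<Omega> Y \<omega>) / card (fibre \<Omega> ?Z \<omega>)" for \<omega>
  have cpos: "real (card (fibre \<Omega> Y \<omega>)) > 0" "real (card (fibre \<Omega> ?Z \<omega>)) > 0" if "\<omega> \<in> \<Omega>" for \<omega>
    using card_fibre_pos[OF fin that] by auto
  have qpos: "q \<omega> > 0" if "\<omega> \<in> \<Omega>" for \<omega>
    using cpos[OF that] pos[OF that] by (simp add: q_def)
  have "(\<Sum>\<omega>\<in>\<Omega>. q \<omega>) = (\<Sum>y\<in>Y ` \<Omega>. \<Sum>\<omega>\<in>{\<omega>\<in>\<Omega>. Y \<omega> = y}. q \<omega>)"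
    by (rule sum.image_gen[OF fin])
  also have "\<dots> \<le> (\<Sum>y\<in>Y ` \<Omega>. real (card {\<omega>\<in>\<Omega>. Y \<omega> = y}))"
  proof (rule sum_mono)
    fix y assume "y \<in> Y ` \<Omega>"
    then obtain \<omega>0 where w0: "\<omega>0 \<in> \<Omega>" "y = Y \<omega>0" by auto
    let ?C = "fibre \<Omega> Y \<omega>0"
    have C: "{\<omega>\<in>\<Omega>. Y \<omega> = y} = ?C" using w0 by (auto simp: fibre_def)
    have "q \<omega> = card ?C * (r (X \<omega>) y / card {\<omega>'\<in>?C. X \<omega>' = X \<omega>})" if "\<omega> \<in> ?C" for \<omega>
    proof -
      have e: "fibre \<Omega> Y \<omega> = ?C" "fibre \<Omega> ?Z \<omega> = {\<omega>'\<in>?C. X \<omega>' = X \<omega>}" "Y \<omega> = y"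
        using that w0 by (auto simp: fibre_def)
      show ?thesis unfolding q_def e by simp
    qed
    then have "(\<Sum>\<omega>\<in>?C. q \<omega>) = card ?C * (\<Sum>\<omega>\<in>?C. r (X \<omega>) y / card {\<omega>'\<in>?C. X \<omega>' = X \<omega>})"
      by (simp add: sum_distrib_left)
    also have "\<dots> = card ?C * (\<Sum>x\<in>X ` ?C. r x y)"
      by (subst sum_fibre_card[OF finite_fibre[OF fin], where g="\<lambda>x. r x y" and X=X]) simp
    also have "\<dots> \<le> real (card ?C) * 1"
      by (rule mult_left_mono) (use sub[OF w0(1)] w0(2) in auto)
    finally show "(\<Sum>\<omega>\<in>{\<omega>\<in>\<Omega>. Y \<omega> = y}. q \<omega>) \<le> real (card {\<omega>\<in>\<Omega>. Y \<omega> = y})"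
      by (simp add: C)
  qed
  also have "\<dots> = card \<Omega>"
    using sum.image_gen[OF fin, of "\<lambda>_. 1::real" Y] by simp
  finally have q: "(\<Sum>\<omega>\<in>\<Omega>. q \<omega>) \<le> card \<Omega>" .
  have "cond_ent \<Omega> X Y - (\<Sum>\<omega>\<in>\<Omega>. - ln (r (X \<omega>) (Y \<omega>))) = (\<Sum>\<omega>\<in>\<Omega>. ln (q \<omega>))"
    unfolding cond_ent_def sum_subtractf[symmetric]
  proof (rule sum.cong[OF refl])
    fix \<omega> assume w: "\<omega> \<in> \<Omega>"
    show "ln (card (fibre \<Omega> Y \<omega>) / card (fibre \<Omega> ?Z \<omega>)) - - ln (r (X \<omega>) (Y \<omega>)) = ln (q \<omega>)"
      unfolding q_def using cpos[OF w] pos[OF w] by (simp add: ln_div ln_mult)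
  qed
  also have "\<dots> \<le> (\<Sum>\<omega>\<in>\<Omega>. q \<omega> - 1)"
    using qpos by (intro sum_mono ln_le_minus_one) auto
  also have "\<dots> \<le> 0" using q by (simp add: sum_subtractf)
  finally show ?thesis by simp
qed

lemma cond_ent_nonneg:
  assumes "finite \<Omega>" shows "0 \<le> cond_ent \<Omega> X Y"
  unfolding cond_ent_def
proof (rule sum_nonneg)
  fix \<omega> assume w: "\<omega> \<in> \<Omega>"
  have "card (fibre \<Omega> (\<lambda>\<omega>. (X \<omega>, Y \<omega>)) \<omega>) \<le> card (fibre \<Omega> Y \<omega>)"
    by (rule card_mono[OF finite_fibre[OF assms]]) (auto simp: fibre_def)
  then show "0 \<le> ln (card (fibre \<Omega> Y \<omega>) / card (fibre \<Omega> (\<lambda>\<omega>. (X \<omega>, Y \<omega>)) \<omega>))"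
    using card_fibre_pos[OF assms w, of "\<lambda>\<omega>. (X \<omega>, Y \<omega>)"] by (intro ln_ge_zero) auto
qed

lemma cond_ent_chain:
  assumes "finite \<Omega>"
  shows "cond_ent \<Omega> (\<lambda>\<omega>. (X \<omega>, Y \<omega>)) Z = cond_ent \<Omega> Y Z + cond_ent \<Omega> X (\<lambda>\<omega>. (Y \<omega>, Z \<omega>))"
proof -
  have e: "fibre \<Omega> (\<lambda>\<omega>. ((X \<omega>, Y \<omega>), Z \<omega>)) \<omega> = fibre \<Omega> (\<lambda>\<omega>. (X \<omega>, (Y \<omega>, Z \<omega>))) \<omega>" for \<omega>
    by (auto simp: fibre_def)
  show ?thesis
    unfolding cond_ent_def sum.distrib[symmetric] e
  proof (rule sum.cong[OF refl])
    fix \<omega> assume w: "\<omega> \<in> \<Omega>"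
    have p: "card (fibre \<Omega> Z \<omega>) > 0" "card (fibre \<Omega> (\<lambda>\<omega>. (Y \<omega>, Z \<omega>)) \<omega>) > 0"
      "card (fibre \<Omega> (\<lambda>\<omega>. (X \<omega>, (Y \<omega>, Z \<omega>))) \<omega>) > 0"
      by (intro card_fibre_pos[OF assms w])+
    show "ln (card (fibre \<Omega> Z \<omega>) / card (fibre \<Omega> (\<lambda>\<omega>. (X \<omega>, (Y \<omega>, Z \<omega>))) \<omega>)) =
       ln (card (fibre \<Omega> Z \<omega>) / card (fibre \<Omega> (\<lambda>\<omega>. (Y \<omega>, Z \<omega>)) \<omega>)) +
       ln (card (fibre \<Omega> (\<lambda>\<omega>. (Y \<omega>, Z \<omega>)) \<omega>) / card (fibre \<Omega> (\<lambda>\<omega>. (X \<omega>, (Y \<omega>, Z \<omega>))) \<omega>))"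
      using p by (simp add: ln_div)
  qed
qed

text \<open>The law of \<open>X\<close> given the coarser variable \<open>Z\<close> is also a code
  given \<open>Y\<close>, and its cost is exactly the entropy given \<open>Z\<close>.\<close>

lemma cond_ent_cond_mono:
  assumes fin: "finite \<Omega>"
    and dep: "\<And>\<omega> \<omega>'. \<omega> \<in> \<Omega> \<Longrightarrow> \<omega>' \<in> \<Omega> \<Longrightarrow> Y \<omega> = Y \<omega>' \<Longrightarrow> Z \<omega> = Z \<omega>'"
  shows "cond_ent \<Omega> X Y \<le> cond_ent \<Omega> X Z"
proof -
  have "cond_ent \<Omega> X Y = cond_ent \<Omega> X (\<lambda>\<omega>. (Y \<omega>, Z \<omega>))"
    by (rule cond_ent_cong) (auto dest: dep)
  also have "\<dots> \<le> (\<Sum>\<omega>\<in>\<Omega>. - ln ((\<lambda>x (y, z). card {\<omega>\<in>\<Omega>. X \<omega> = x \<and> Z \<omega> = z} / card {\<omega>\<in>\<Omega>. Z \<omega> = z}) (X \<omega>) (Y \<omega>, Z \<omega>)))"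
  proof (rule gibbs[OF fin])
    fix \<omega> assume w: "\<omega> \<in> \<Omega>"
    have "card {\<omega>'\<in>\<Omega>. X \<omega>' = X \<omega> \<and> Z \<omega>' = Z \<omega>} > 0" "card {\<omega>'\<in>\<Omega>. Z \<omega>' = Z \<omega>} > 0"
      using w fin by (auto simp: card_gt_0_iff)
    then show "0 < (\<lambda>x (y, z). card {\<omega>\<in>\<Omega>. X \<omega> = x \<and> Z \<omega> = z} / card {\<omega>\<in>\<Omega>. Z \<omega> = z}) (X \<omega>) (Y \<omega>, Z \<omega>)"
      by simp
    let ?D = "{\<omega>'\<in>\<Omega>. Z \<omega>' = Z \<omega>}"
    have D: "finite ?D" "card ?D > 0" using w fin by (auto simp: card_gt_0_iff)
    have "(\<Sum>x\<in>X ` fibre \<Omega> (\<lambda>\<omega>. (Y \<omega>, Z \<omega>)) \<omega>. real (card {\<omega>'\<in>\<Omega>. X \<omega>' = x \<and> Z \<omega>' = Z \<omega>}) / card ?D)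
      \<le> (\<Sum>x\<in>X ` ?D. real (card {\<omega>'\<in>\<Omega>. X \<omega>' = x \<and> Z \<omega>' = Z \<omega>}) / card ?D)"
      using D by (intro sum_mono2) (auto simp: fibre_def)
    also have "\<dots> = (\<Sum>x\<in>X ` ?D. \<Sum>\<omega>'\<in>{\<omega>'\<in>?D. X \<omega>' = x}. 1) / card ?D"
      by (simp add: sum_divide_distrib conj_commute conj_left_commute conj_assoc)
    also have "(\<Sum>x\<in>X ` ?D. \<Sum>\<omega>'\<in>{\<omega>'\<in>?D. X \<omega>' = x}. 1) = (\<Sum>\<omega>'\<in>?D. 1::real)"
      by (rule sum.image_gen[OF D(1), symmetric])
    also have "(\<Sum>\<omega>'\<in>?D. 1::real) / card ?D \<le> 1" using D by simp
    finally show "(\<Sum>x\<in>X ` fibre \<Omega> (\<lambda>\<omega>. (Y \<omega>, Z \<omega>)) \<omega>. (\<lambda>x (y, z). card {\<omega>\<in>\<Omega>. X \<omega> = x \<and> Z \<omega> = z} / card {\<omega>\<in>\<Omega>. Z \<omega> = z}) x (Y \<omega>, Z \<omega>)) \<le> 1"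
      by simp
  qed
  also have "\<dots> = cond_ent \<Omega> X Z"
    unfolding cond_ent_def
  proof (rule sum.cong[OF refl])
    fix \<omega> assume w: "\<omega> \<in> \<Omega>"
    have e: "{\<omega>'\<in>\<Omega>. X \<omega>' = X \<omega> \<and> Z \<omega>' = Z \<omega>} = fibre \<Omega> (\<lambda>\<omega>. (X \<omega>, Z \<omega>)) \<omega>"
      "{\<omega>'\<in>\<Omega>. Z \<omega>' = Z \<omega>} = fibre \<Omega> Z \<omega>"
      by (auto simp: fibre_def)
    show "- ln ((\<lambda>x (y, z). card {\<omega>\<in>\<Omega>. X \<omega> = x \<and> Z \<omega> = z} / card {\<omega>\<in>\<Omega>. Z \<omega> = z}) (X \<omega>) (Y \<omega>, Z \<omega>))
       = ln (card (fibre \<Omega> Z \<omega>) / card (fibre \<Omega> (\<lambda>\<omega>. (X \<omega>, Z \<omega>)) \<omega>))"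
      using card_fibre_pos[OF fin w, of "\<lambda>\<omega>. (X \<omega>, Z \<omega>)"] card_fibre_pos[OF fin w, of Z]
      by (simp add: e ln_div)
  qed
  finally show ?thesis .
qed

lemma cond_ent_mono:
  assumes fin: "finite \<Omega>"
    and dep: "\<And>\<omega> \<omega>'. \<omega> \<in> \<Omega> \<Longrightarrow> \<omega>' \<in> \<Omega> \<Longrightarrow> Y \<omega> = Y \<omega>' \<Longrightarrow> X \<omega> = X \<omega>'"
  shows "cond_ent \<Omega> X Z \<le> cond_ent \<Omega> Y Z"
proof -
  have "cond_ent \<Omega> Y Z = cond_ent \<Omega> (\<lambda>\<omega>. (Y \<omega>, X \<omega>)) Z"
    by (rule cond_ent_cong) (auto dest: dep)
  then show ?thesis
    using cond_ent_nonneg[OF fin, of Y "\<lambda>\<omega>. (X \<omega>, Z \<omega>)"] by (simp add: cond_ent_chain[OF fin])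
qed

lemma cond_ent_le_ln_card:
  assumes fin: "finite \<Omega>"
    and S: "\<And>\<omega>. \<omega> \<in> \<Omega> \<Longrightarrow> finite (S (Y \<omega>))" "\<And>\<omega>. \<omega> \<in> \<Omega> \<Longrightarrow> X \<omega> \<in> S (Y \<omega>)"
  shows "cond_ent \<Omega> X Y \<le> (\<Sum>\<omega>\<in>\<Omega>. ln (card (S (Y \<omega>))))"
proof -
  have p: "card (S (Y \<omega>)) > 0" if "\<omega> \<in> \<Omega>" for \<omega>
    using S that by (auto simp: card_gt_0_iff)
  have "cond_ent \<Omega> X Y \<le> (\<Sum>\<omega>\<in>\<Omega>. - ln ((\<lambda>x y. 1 / card (S y)) (X \<omega>) (Y \<omega>)))"
  proof (rule gibbs[OF fin])
    fix \<omega> assume w: "\<omega> \<in> \<Omega>"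
    show "0 < 1 / real (card (S (Y \<omega>)))" using p[OF w] by simp
    have "X ` fibre \<Omega> Y \<omega> \<subseteq> S (Y \<omega>)" using S(2) by (fastforce simp: fibre_def)
    then have "card (X ` fibre \<Omega> Y \<omega>) \<le> card (S (Y \<omega>))" by (rule card_mono[OF S(1)[OF w]])
    then show "(\<Sum>x\<in>X ` fibre \<Omega> Y \<omega>. 1 / real (card (S (Y \<omega>)))) \<le> 1"
      using p[OF w] by simp
  qed
  also have "\<dots> = (\<Sum>\<omega>\<in>\<Omega>. ln (card (S (Y \<omega>))))"
    by (rule sum.cong[OF refl]) (use p in \<open>simp add: ln_div\<close>)
  finally show ?thesis .
qed

lemma cond_ent_joint_insert:
  assumes "finite \<Omega>"
  shows "cond_ent \<Omega> (joint X (insert i I)) Z = cond_ent \<Omega> (joint X I) Z + cond_ent \<Omega> (X i) (\<lambda>\<omega>. (joint X I \<omega>, Z \<omega>))"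
proof -
  have "cond_ent \<Omega> (joint X (insert i I)) Z = cond_ent \<Omega> (\<lambda>\<omega>. (X i \<omega>, joint X I \<omega>)) Z"
    by (rule cond_ent_cong) (auto simp: joint_eq_iff)
  then show ?thesis by (simp add: cond_ent_chain[OF assms])
qed

lemma cond_ent_joint_empty:
  assumes "finite \<Omega>"
  shows "cond_ent \<Omega> (joint X {}) Z = 0"
proof -
  have "fibre \<Omega> (\<lambda>\<omega>. (joint X {} \<omega>, Z \<omega>)) = fibre \<Omega> Z"
    by (auto simp: fibre_def joint_def fun_eq_iff)
  then show ?thesis
    unfolding cond_ent_def using card_fibre_pos[OF assms, of _ Z] by (intro sum.neutral) auto
qed

text \<open>The coordinates of \<open>U\<close> are added one at a time. By the chain rule a set
  \<open>T j\<close> containing the new coordinate pays for it while conditioning on fewer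
  coordinates, so it pays at least as much as \<open>U\<close> does, and at least \<open>s\<close>
  of the sets pay.\<close>

lemma shearer:
  assumes fin: "finite \<Omega>" "finite U" "finite J"
    and cover: "\<And>u. u \<in> U \<Longrightarrow> s \<le> card {j\<in>J. u \<in> T j}"
    and sub: "\<And>j. j \<in> J \<Longrightarrow> T j \<subseteq> U"
  shows "real s * cond_ent \<Omega> (joint X U) Z \<le> (\<Sum>j\<in>J. cond_ent \<Omega> (joint X (T j)) Z)"
proof -
  have "W \<subseteq> U \<Longrightarrow> real s * cond_ent \<Omega> (joint X W) Z \<le> (\<Sum>j\<in>J. cond_ent \<Omega> (joint X (T j \<inter> W)) Z)" if "finite W" for W
    using that
  proof (induction W)
    case empty
    then show ?case by (simp add: cond_ent_joint_empty[OF fin(1)])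
  next
    case (insert u W)
    let ?c = "cond_ent \<Omega> (X u) (\<lambda>\<omega>. (joint X W \<omega>, Z \<omega>))"
    have step: "cond_ent \<Omega> (joint X (T j \<inter> W)) Z + (if u \<in> T j then ?c else 0) \<le> cond_ent \<Omega> (joint X (T j \<inter> insert u W)) Z" for j
    proof (cases "u \<in> T j")
      case True
      have "?c \<le> cond_ent \<Omega> (X u) (\<lambda>\<omega>. (joint X (T j \<inter> W) \<omega>, Z \<omega>))"
        by (rule cond_ent_cond_mono[OF fin(1)]) (auto simp: joint_eq_iff)
      then show ?thesis using True by (simp add: cond_ent_joint_insert[OF fin(1)])
    qed simp
    have "real s * cond_ent \<Omega> (joint X (insert u W)) Z = real s * cond_ent \<Omega> (joint X W) Z + real s * ?c"
      by (simp add: cond_ent_joint_insert[OF fin(1)] algebra_simps)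
    also have "\<dots> \<le> (\<Sum>j\<in>J. cond_ent \<Omega> (joint X (T j \<inter> W)) Z) + real (card {j\<in>J. u \<in> T j}) * ?c"
      using insert cover[of u] cond_ent_nonneg[OF fin(1)] by (intro add_mono mult_right_mono) auto
    also have "real (card {j\<in>J. u \<in> T j}) * ?c = (\<Sum>j\<in>J. if u \<in> T j then ?c else 0)"
      using fin(3) by (simp add: sum.If_cases Int_def)
    also have "(\<Sum>j\<in>J. cond_ent \<Omega> (joint X (T j \<inter> W)) Z) + \<dots> \<le> (\<Sum>j\<in>J. cond_ent \<Omega> (joint X (T j \<inter> insert u W)) Z)"
      unfolding sum.distrib[symmetric] by (rule sum_mono) (rule step)
    finally show ?case .
  qed
  from this[OF fin(2)] have "real s * cond_ent \<Omega> (joint X U) Z \<le> (\<Sum>j\<in>J. cond_ent \<Omega> (joint X (T j \<inter> U)) Z)" by simp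
  also have "\<dots> = (\<Sum>j\<in>J. cond_ent \<Omega> (joint X (T j)) Z)"
    using sub by (intro sum.cong refl) (simp add: Int_absorb2)
  finally show ?thesis .
qed

lemma cond_ent_joint_le_sum:
  assumes fin: "finite \<Omega>" "finite I"
  shows "cond_ent \<Omega> (joint X I) Z \<le> (\<Sum>i\<in>I. cond_ent \<Omega> (X i) Z)"
  using fin(2)
proof (induction I)
  case empty
  then show ?case by (simp add: cond_ent_joint_empty[OF fin(1)])
next
  case (insert i I)
  have "cond_ent \<Omega> (X i) (\<lambda>\<omega>. (joint X I \<omega>, Z \<omega>)) \<le> cond_ent \<Omega> (X i) Z"
    by (rule cond_ent_cond_mono[OF fin(1)]) auto
  then show ?case using insert by (simp add: cond_ent_joint_insert[OF fin(1)])
qed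

lemma cond_ent_inj:
  assumes "finite \<Omega>" "inj_on X \<Omega>"
  shows "cond_ent \<Omega> X (\<lambda>_. ()) = card \<Omega> * ln (card \<Omega>)"
proof -
  have e: "fibre \<Omega> (\<lambda>\<omega>. (X \<omega>, ())) \<omega> = {\<omega>}" "fibre \<Omega> (\<lambda>_. ()) \<omega> = \<Omega>" if "\<omega> \<in> \<Omega>" for \<omega>
    using that assms(2) by (auto simp: fibre_def inj_on_def)
  then show ?thesis unfolding cond_ent_def by simp
qed

section \<open>Bottlenecks and mixing times\<close>

lemma tv_ge_event:
  assumes fin: "finite \<Omega>" and SO: "S \<subseteq> \<Omega>" and p: "set_pmf p \<subseteq> \<Omega>" and q: "set_pmf q \<subseteq> \<Omega>"
  shows "measure_pmf.prob p S - measure_pmf.prob q S \<le> 1 / 2 * (\<Sum>y\<in>\<Omega>. \<bar>pmf p y - pmf q y\<bar>)"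
proof -
  have fS: "finite S" using SO fin finite_subset by blast
  have one: "(\<Sum>y\<in>\<Omega>. pmf p y) = 1" "(\<Sum>y\<in>\<Omega>. pmf q y) = 1"
    using sum_pmf_eq_1[OF fin] p q by auto
  have split: "(\<Sum>y\<in>\<Omega>. f y) = (\<Sum>y\<in>S. f y) + (\<Sum>y\<in>\<Omega> - S. f y)" for f :: "'a \<Rightarrow> real"
    using sum.subset_diff[OF SO fin, of f] by simp
  have "(\<Sum>y\<in>S. pmf p y - pmf q y) \<le> (\<Sum>y\<in>S. \<bar>pmf p y - pmf q y\<bar>)" by (rule sum_mono) auto
  moreover have "(\<Sum>y\<in>\<Omega> - S. pmf q y - pmf p y) \<le> (\<Sum>y\<in>\<Omega> - S. \<bar>pmf p y - pmf q y\<bar>)" by (rule sum_mono) auto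
  moreover have "measure_pmf.prob p S = (\<Sum>y\<in>S. pmf p y)" "measure_pmf.prob q S = (\<Sum>y\<in>S. pmf q y)"
    by (rule measure_measure_pmf_finite[OF fS])+
  ultimately show ?thesis
    using one split[of "pmf p"] split[of "pmf q"] split[of "\<lambda>y. \<bar>pmf p y - pmf q y\<bar>"]
    by (simp add: sum_subtractf)
qed

locale uniform_chain =
  fixes \<Omega> :: "'s set" and K :: "'s \<Rightarrow> 's pmf"
  assumes fin: "finite \<Omega>" and ne: "\<Omega> \<noteq> {}"
    and closed: "\<And>x. x \<in> \<Omega> \<Longrightarrow> set_pmf (K x) \<subseteq> \<Omega>"
    and stationary: "bind_pmf (pmf_of_set \<Omega>) K = pmf_of_set \<Omega>"
begin

lemma steps_closed: "x \<in> \<Omega> \<Longrightarrow> set_pmf (steps K t x) \<subseteq> \<Omega>"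
  by (induction t) (use closed in fastforce)+

lemma steps_stationary: "bind_pmf (pmf_of_set \<Omega>) (steps K t) = pmf_of_set \<Omega>"
proof (induction t)
  case (Suc t)
  have e: "steps K (Suc t) = (\<lambda>x. bind_pmf (steps K t x) K)" by (rule ext) simp
  have "bind_pmf (pmf_of_set \<Omega>) (steps K (Suc t)) = bind_pmf (bind_pmf (pmf_of_set \<Omega>) (steps K t)) K"
    by (simp only: e bind_assoc_pmf)
  also have "\<dots> = pmf_of_set \<Omega>" by (simp only: Suc stationary)
  finally show ?case .
qed (simp add: bind_return_pmf')

text \<open>Stationarity of the uniform law says that the columns of every power of the transition
  matrix sum to 1. Summing over all starts thus replaces a uniformly random start.\<close>

lemma sum_steps_prob:
  assumes "D \<subseteq> \<Omega>"
  shows "(\<Sum>x\<in>\<Omega>. measure_pmf.prob (steps K t x) D) = card D"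
proof -
  have fD: "finite D" using assms fin finite_subset by blast
  have "(\<Sum>x\<in>\<Omega>. pmf (steps K t x) y) = 1" if "y \<in> D" for y
  proof -
    have "pmf (pmf_of_set \<Omega>) y = (\<Sum>x\<in>\<Omega>. pmf (steps K t x) y) / card \<Omega>"
      by (subst steps_stationary[of t, symmetric]) (simp add: pmf_bind integral_pmf_of_set[OF ne fin])
    then show ?thesis using that assms fin ne by (auto simp: card_gt_0_iff field_simps)
  qed
  then have "(\<Sum>y\<in>D. \<Sum>x\<in>\<Omega>. pmf (steps K t x) y) = card D" by simp
  then show ?thesis by (subst (asm) sum.swap) (simp add: measure_measure_pmf_finite[OF fD])
qed

lemma escape_step:
  assumes leave: "\<And>y. y \<in> S - D \<Longrightarrow> set_pmf (K y) \<subseteq> S" and x: "x \<in> \<Omega>"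
  shows "measure_pmf.prob (steps K (Suc t) x) (- S)
    \<le> measure_pmf.prob (steps K t x) (- S) + measure_pmf.prob (steps K t x) D"
proof -
  have "measure_pmf.prob (steps K (Suc t) x) (- S) = (\<integral>y. measure_pmf.prob (K y) (- S) \<partial>measure_pmf (steps K t x))"
    unfolding steps.simps measure_pmf_bind
    by (subst measure_pmf.measure_bind[where N="count_space UNIV"]) (auto simp: measurable_def space_subprob_algebra measure_pmf.subprob_space_axioms)
  also have "\<dots> \<le> (\<integral>y. indicator (- S) y + indicator D y \<partial>measure_pmf (steps K t x))"
  proof (rule integral_mono_AE)
    show "integrable (measure_pmf (steps K t x)) (\<lambda>y. measure_pmf.prob (K y) (- S))"
      by (rule measure_pmf.integrable_const_bound[where B=1]) auto
    show "integrable (measure_pmf (steps K t x)) (\<lambda>y. indicator (- S) y + indicator D y :: real)"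
      by (rule measure_pmf.integrable_const_bound[where B=2]) (auto simp: indicator_def)
    show "AE y in measure_pmf (steps K t x). measure_pmf.prob (K y) (- S) \<le> indicator (- S) y + indicator D y"
    proof (rule AE_pmfI)
      fix y
      show "measure_pmf.prob (K y) (- S) \<le> indicator (- S) y + indicator D y"
      proof (cases "y \<in> S - D")
        case True
        then have "measure_pmf.prob (K y) (- S) = 0" using leave by (auto simp: measure_pmf_zero_iff)
        then show ?thesis by simp
      next
        case False
        then have "indicator (- S) y + indicator D y \<ge> (1::real)" by (auto simp: indicator_def)
        then show ?thesis by (rule order_trans[OF measure_pmf.prob_le_1])
      qed
    qed
  qed
  also have "\<dots> = measure_pmf.prob (steps K t x) (- S) + measure_pmf.prob (steps K t x) D"
    by (subst Bochner_Integration.integral_add)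
      (auto intro!: measure_pmf.integrable_const_bound[where B=1])
  finally show ?thesis .
qed

text \<open>The chain leaves \<open>S\<close> only through \<open>D\<close>, and at each time all
  starts together put mass \<open>card D\<close> on \<open>D\<close>; this is the union bound over
  \<open>t\<close> steps.\<close>

lemma sum_escape:
  assumes SO: "S \<subseteq> \<Omega>" and D: "D \<subseteq> S" and leave: "\<And>y. y \<in> S - D \<Longrightarrow> set_pmf (K y) \<subseteq> S"
  shows "(\<Sum>x\<in>S. measure_pmf.prob (steps K t x) (- S)) \<le> real t * card D"
proof (induction t)
  case 0
  then show ?case by (auto simp: indicator_def intro!: sum_nonpos)
next
  case (Suc t)
  have "(\<Sum>x\<in>S. measure_pmf.prob (steps K (Suc t) x) (- S))
    \<le> (\<Sum>x\<in>S. measure_pmf.prob (steps K t x) (- S)) + (\<Sum>x\<in>S. measure_pmf.prob (steps K t x) D)"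
    unfolding sum.distrib[symmetric] using SO by (intro sum_mono escape_step leave) auto
  also have "(\<Sum>x\<in>S. measure_pmf.prob (steps K t x) D) \<le> (\<Sum>x\<in>\<Omega>. measure_pmf.prob (steps K t x) D)"
    using SO fin by (intro sum_mono2) auto
  also have "\<dots> = card D" by (rule sum_steps_prob) (use SO D in auto)
  finally show ?case using Suc by (simp add: algebra_simps)
qed

text \<open>Up to time \<open>T + 1\<close> some start in \<open>S\<close> has escaped with
  probability at most 1/20. Its law gives \<open>S\<close> mass at least 19/20 against at most 1/2
  in equilibrium, and the difference 9/20 exceeds 1/e.\<close>

theorem mixing_time_ge:
  fixes T :: real
  assumes SO: "S \<subseteq> \<Omega>" and S: "S \<noteq> {}" and half: "2 * card S \<le> card \<Omega>"
    and D: "D \<subseteq> S" and leave: "\<And>y. y \<in> S - D \<Longrightarrow> set_pmf (K y) \<subseteq> S"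
    and T: "20 * (T + 1) * card D \<le> card S"
  shows "ereal T \<le> ereal_of_enat (mixing_time \<Omega> K (pmf_of_set \<Omega>))"
proof -
  have fS: "finite S" using SO fin finite_subset by blast
  have cS: "real (card S) > 0" using fS S by (simp add: card_gt_0_iff)
  have far: "(MAX x\<in>\<Omega>. 1 / 2 * (\<Sum>y\<in>\<Omega>. \<bar>pmf (steps K t x) y - pmf (pmf_of_set \<Omega>) y\<bar>)) > 1 / exp 1"
    if t: "real t \<le> T + 1" for t
  proof -
    have "\<exists>x\<in>S. measure_pmf.prob (steps K t x) (- S) \<le> 1 / 20"
    proof (rule ccontr)
      assume "\<not> ?thesis"
      then have "(\<Sum>x\<in>S. measure_pmf.prob (steps K t x) (- S)) > (\<Sum>x\<in>S. 1 / 20)"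
        using fS S by (intro sum_strict_mono) auto
      moreover have "real t * card D \<le> (T + 1) * card D" using t by (intro mult_right_mono) auto
      ultimately show False using sum_escape[OF SO D leave, of t] T by simp
    qed
    then obtain x where x: "x \<in> S" "measure_pmf.prob (steps K t x) (- S) \<le> 1 / 20" by auto
    have xO: "x \<in> \<Omega>" using x SO by auto
    have "measure_pmf.prob (steps K t x) (- S) = 1 - measure_pmf.prob (steps K t x) S"
      using measure_pmf.prob_compl[of S "steps K t x"] by (simp add: Compl_eq_Diff_UNIV)
    moreover have "measure_pmf.prob (pmf_of_set \<Omega>) S \<le> 1 / 2"
    proof -
      have "measure_pmf.prob (pmf_of_set \<Omega>) S = card S / card \<Omega>"
        using SO by (simp add: measure_pmf_of_set[OF ne fin] Int_absorb1)
      also have "\<dots> \<le> 1 / 2"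
        using of_nat_mono[OF half, where 'a=real] fin ne by (simp add: card_gt_0_iff field_simps)
      finally show ?thesis .
    qed
    moreover have "measure_pmf.prob (steps K t x) S - measure_pmf.prob (pmf_of_set \<Omega>) S
        \<le> 1 / 2 * (\<Sum>y\<in>\<Omega>. \<bar>pmf (steps K t x) y - pmf (pmf_of_set \<Omega>) y\<bar>)"
      by (rule tv_ge_event[OF fin SO steps_closed[OF xO]]) (use fin ne in auto)
    moreover have "1 / 2 * (\<Sum>y\<in>\<Omega>. \<bar>pmf (steps K t x) y - pmf (pmf_of_set \<Omega>) y\<bar>)
        \<le> (MAX x\<in>\<Omega>. 1 / 2 * (\<Sum>y\<in>\<Omega>. \<bar>pmf (steps K t x) y - pmf (pmf_of_set \<Omega>) y\<bar>))"
      using xO fin by (intro Max_ge) auto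
    moreover have "1 / exp 1 < (9 / 20 :: real)"
    proof -
      have "(5 / 2 :: real) \<le> exp 1" using exp_lower_Taylor_quadratic[of 1] by (simp add: power2_eq_square)
      then show ?thesis by (simp add: field_simps)
    qed
    ultimately show ?thesis using x(2) by linarith
  qed
  \<comment> \<open>The definition constrains only times after \<open>t0\<close>, so
    \<open>t0 < T\<close> is refuted at time \<open>Suc t0\<close>; hence \<open>T + 1\<close> in
    the hypothesis on \<open>D\<close>.\<close>
  have low: "T \<le> real t0"
    if "\<forall>t>t0. (MAX x\<in>\<Omega>. 1 / 2 * (\<Sum>y\<in>\<Omega>. \<bar>pmf (steps K t x) y - pmf (pmf_of_set \<Omega>) y\<bar>)) \<le> 1 / exp 1" for t0
  proof (rule ccontr)
    assume "\<not> T \<le> real t0"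
    then show False using far[of "Suc t0"] that by fastforce
  qed
  have inf: "ereal T \<le> ereal_of_enat (Inf (enat ` M))" if "\<forall>t0\<in>M. T \<le> real t0" for M
  proof (cases "M = {}")
    case True
    then show ?thesis by (simp add: top_enat_def)
  next
    case False
    then obtain m where "enat m \<in> enat ` M" by auto
    then have "Inf (enat ` M) \<in> enat ` M" by (rule wellorder_InfI)
    then show ?thesis using that by auto
  qed
  show ?thesis unfolding mixing_time_def by (rule inf) (use low in simp)
qed

end

section \<open>Colorings with many bad edges\<close>

text \<open>In the cube, \<open>n1 v a\<close> and \<open>n2 v a\<close> are the neighbours of \<open>v \<in> E\<close> in \<open>O1\<close> and \<open>O2\<close> in direction \<open>a\<close>, and
  \<open>sh v a b\<close> moves \<open>v\<close> in two directions leading to \<open>O1\<close>. The point \<open>xx v j a\<close> is the third vertex of a path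
  of four edges from \<open>v\<close> to \<open>sh v a b\<close> all of which join \<open>E\<close> to \<open>O2\<close>.\<close>

locale split_cube =
  fixes E O1 O2 :: "'v set" and d :: nat and n1 n2 :: "'v \<Rightarrow> nat \<Rightarrow> 'v"
    and sh xx :: "'v \<Rightarrow> nat \<Rightarrow> nat \<Rightarrow> 'v"
  assumes fin: "finite E" "finite O1" "finite O2"
    and d0: "0 < d"
    and n1_in: "\<And>v a. v \<in> E \<Longrightarrow> a < d \<Longrightarrow> n1 v a \<in> O1"
    and n2_in: "\<And>v a. v \<in> E \<Longrightarrow> a < d \<Longrightarrow> n2 v a \<in> O2"
    and n2_inj: "\<And>v. v \<in> E \<Longrightarrow> inj_on (n2 v) {..<d}"
    and card_nb': "\<And>u. u \<in> O2 \<Longrightarrow> card {v\<in>E. \<exists>a<d. n2 v a = u} = 2 * d"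
    and sh_bij: "\<And>a b. a < d \<Longrightarrow> b < d \<Longrightarrow> bij_betw (\<lambda>v. sh v a b) E E"
    and sh_n1: "\<And>v a b. v \<in> E \<Longrightarrow> a < d \<Longrightarrow> b < d \<Longrightarrow> n1 (sh v a b) a = n1 v b"
    and xx_n2: "\<And>v j a. v \<in> E \<Longrightarrow> j < d \<Longrightarrow> a < d \<Longrightarrow> n2 (xx v j a) a = n2 v j"
      "\<And>v j a b. v \<in> E \<Longrightarrow> j < d \<Longrightarrow> a < d \<Longrightarrow> b < d \<Longrightarrow> n2 (xx v j a) b = n2 (sh v a b) j"
    and xx_bij: "\<And>a j. a < d \<Longrightarrow> j < d \<Longrightarrow> bij_betw (\<lambda>v. xx v j a) E E"
    and cover: "\<And>u K a0. u \<in> O1 \<Longrightarrow> K \<subseteq> {..<d} \<Longrightarrow> a0 \<in> K \<Longrightarrow>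
      2 * card K * (d - card K) \<le> card {v\<in>E. u \<in> (\<lambda>(b, a). n1 (sh v a0 b) a) ` (K \<times> ({..<d} - K))}"
begin

definition coloring :: "('v \<Rightarrow> nat) \<Rightarrow> bool" where
  "coloring \<omega> \<longleftrightarrow> (\<forall>v\<in>E \<union> O1 \<union> O2. \<omega> v < 3) \<and> (\<forall>v\<in>E. \<forall>a<d. \<omega> v \<noteq> \<omega> (n1 v a) \<and> \<omega> v \<noteq> \<omega> (n2 v a))"

definition palette :: "('v \<Rightarrow> nat) \<Rightarrow> 'v \<Rightarrow> nat set" where
  "palette \<omega> v = (\<lambda>a. \<omega> (n1 v a)) ` {..<d}"

definition free :: "('v \<Rightarrow> nat) \<Rightarrow> 'v \<Rightarrow> bool" where
  "free \<omega> v \<longleftrightarrow> card (palette \<omega> v) = 1"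

definition nb :: "'v \<Rightarrow> 'v set" where
  "nb u = {v\<in>E. \<exists>a<d. n2 v a = u}"

definition mono_nb :: "('v \<Rightarrow> nat) \<Rightarrow> 'v \<Rightarrow> bool" where
  "mono_nb \<omega> u \<longleftrightarrow> (\<exists>c. \<forall>v\<in>nb u. \<omega> v = c)"

text \<open>In the two ordered regimes, \<open>E\<close> of one color with mixed odd vertices or the
  odd vertices of one color with mixed \<open>E\<close>, exactly one of the two conditions typically
  holds. Edges where they agree mark an interface.\<close>

definition bad :: "('v \<Rightarrow> nat) \<Rightarrow> 'v \<Rightarrow> nat \<Rightarrow> bool" where
  "bad \<omega> v a \<longleftrightarrow> (free \<omega> v \<longleftrightarrow> mono_nb \<omega> (n2 v a))"

definition free_nbs :: "('v \<Rightarrow> nat) \<Rightarrow> 'v \<Rightarrow> nat" where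
  "free_nbs \<omega> u = card {v\<in>nb u. free \<omega> v}"

definition bad_in_dir :: "('v \<Rightarrow> nat) \<Rightarrow> nat \<Rightarrow> real" where
  "bad_in_dir \<omega> a = (\<Sum>v\<in>E. of_bool (bad \<omega> v a))"

definition num_bad :: "('v \<Rightarrow> nat) \<Rightarrow> real" where
  "num_bad \<omega> = (\<Sum>a<d. bad_in_dir \<omega> a)"

definition num_free :: "('v \<Rightarrow> nat) \<Rightarrow> real" where
  "num_free \<omega> = (\<Sum>v\<in>E. of_bool (free \<omega> v))"

section \<open>Palettes and counting of bad edges\<close>

lemma finite_nb: "finite (nb u)"
  using fin by (simp add: nb_def)

lemma card_nb: "u \<in> O2 \<Longrightarrow> card (nb u) = 2 * d"
  using card_nb' by (simp add: nb_def)

lemma palette_sub: "coloring \<omega> \<Longrightarrow> v \<in> E \<Longrightarrow> palette \<omega> v \<subseteq> {..<3} - {\<omega> v}"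
  using n1_in by (fastforce simp: palette_def coloring_def)

lemma card_other_colors: "c < 3 \<Longrightarrow> card ({..<3} - {c::nat}) = 2"
  by (subst card_Diff_singleton) auto

lemma palette_card:
  assumes "coloring \<omega>" "v \<in> E" shows "card (palette \<omega> v) = 1 \<or> card (palette \<omega> v) = 2"
proof -
  have "\<omega> v < 3" using assms by (auto simp: coloring_def)
  then have "card (palette \<omega> v) \<le> 2"
    using card_mono[OF _ palette_sub[OF assms]] card_other_colors by auto
  moreover have "card (palette \<omega> v) > 0"
    using d0 by (auto simp: palette_def card_gt_0_iff)
  ultimately show ?thesis by linarith
qed

lemma palette_not_free:
  assumes "coloring \<omega>" "v \<in> E" "\<not> free \<omega> v" shows "palette \<omega> v = {..<3} - {\<omega> v}"
proof (rule card_subset_eq[OF _ palette_sub[OF assms(1,2)]])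
  have "\<omega> v < 3" using assms by (auto simp: coloring_def)
  then show "card (palette \<omega> v) = card ({..<3} - {\<omega> v})"
    using palette_card[OF assms(1,2)] assms(3) by (auto simp: free_def card_other_colors)
qed simp

lemma double_count:
  "(\<Sum>v\<in>E. \<Sum>a<d. f v (n2 v a)) = (\<Sum>u\<in>O2. \<Sum>v\<in>nb u. (f v u :: real))"
proof -
  have "(\<Sum>a<d. f v (n2 v a)) = (\<Sum>u\<in>O2. if v \<in> nb u then f v u else 0)" if v: "v \<in> E" for v
  proof -
    have "(\<Sum>a<d. f v (n2 v a)) = (\<Sum>u\<in>n2 v ` {..<d}. f v u)"
      by (simp add: sum.reindex[OF n2_inj[OF v]])
    also have "n2 v ` {..<d} = {u\<in>O2. v \<in> nb u}"
      using v n2_in[OF v] by (auto simp: nb_def)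
    also have "(\<Sum>u\<in>{u\<in>O2. v \<in> nb u}. f v u) = (\<Sum>u\<in>O2. if v \<in> nb u then f v u else 0)"
      using fin by (simp add: sum.inter_filter)
    finally show ?thesis .
  qed
  then have "(\<Sum>v\<in>E. \<Sum>a<d. f v (n2 v a)) = (\<Sum>v\<in>E. \<Sum>u\<in>O2. if v \<in> nb u then f v u else 0)"
    by simp
  also have "\<dots> = (\<Sum>u\<in>O2. \<Sum>v\<in>E. if v \<in> nb u then f v u else 0)" by (rule sum.swap)
  also have "\<dots> = (\<Sum>u\<in>O2. \<Sum>v\<in>nb u. f v u)"
  proof (rule sum.cong[OF refl])
    fix u
    have "nb u = {v\<in>E. v \<in> nb u}" by (auto simp: nb_def)
    then show "(\<Sum>v\<in>E. if v \<in> nb u then f v u else 0) = (\<Sum>v\<in>nb u. f v u)"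
      using sum.inter_filter[OF fin(1), of "\<lambda>v. f v u" "\<lambda>v. v \<in> nb u"] by simp
  qed
  finally show ?thesis .
qed

lemma card_E: "real (card E) = 2 * card O2"
proof -
  have "(\<Sum>v\<in>E. \<Sum>a<d. 1) = (\<Sum>u\<in>O2. \<Sum>v\<in>nb u. (1::real))" by (rule double_count)
  then have "real d * card E = (\<Sum>u\<in>O2. real (2 * d))" by (simp add: card_nb)
  then show ?thesis using d0 by simp
qed

lemma sum_free_nbs: "(\<Sum>u\<in>O2. real (free_nbs \<omega> u)) = d * num_free \<omega>"
proof -
  have "real (free_nbs \<omega> u) = (\<Sum>v\<in>nb u. of_bool (free \<omega> v))" for u
    unfolding free_nbs_def using finite_nb[of u] by (simp add: sum.inter_filter[symmetric] of_bool_def Int_def)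
  then have "(\<Sum>u\<in>O2. real (free_nbs \<omega> u)) = (\<Sum>v\<in>E. \<Sum>a<d. of_bool (free \<omega> v))"
    by (subst double_count) simp
  then show ?thesis by (simp add: num_free_def sum_distrib_left)
qed

lemma free_nbs_le: "u \<in> O2 \<Longrightarrow> free_nbs \<omega> u \<le> 2 * d"
  unfolding free_nbs_def using card_mono[OF finite_nb, of "{v\<in>nb u. free \<omega> v}" u] card_nb by auto

text \<open>The bad edges are sorted by their end in \<open>O2\<close>: at a \<open>u\<close> with
  one-colored neighbourhood they lead to the free neighbours, at any other \<open>u\<close> to those
  that are not free.\<close>

lemma num_bad_eq: "num_bad \<omega> = (\<Sum>u\<in>O2. if mono_nb \<omega> u then real (free_nbs \<omega> u) else 2 * real d - free_nbs \<omega> u)"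
proof -
  have "num_bad \<omega> = (\<Sum>v\<in>E. \<Sum>a<d. of_bool (free \<omega> v \<longleftrightarrow> mono_nb \<omega> (n2 v a)))"
    unfolding num_bad_def bad_in_dir_def bad_def by (rule sum.swap)
  also have "\<dots> = (\<Sum>u\<in>O2. \<Sum>v\<in>nb u. of_bool (free \<omega> v \<longleftrightarrow> mono_nb \<omega> u))"
    by (rule double_count)
  also have "\<dots> = (\<Sum>u\<in>O2. if mono_nb \<omega> u then real (free_nbs \<omega> u) else 2 * real d - free_nbs \<omega> u)"
  proof (rule sum.cong[OF refl])
    fix u assume u: "u \<in> O2"
    have w: "real (free_nbs \<omega> u) = (\<Sum>v\<in>nb u. of_bool (free \<omega> v))"
      unfolding free_nbs_def using finite_nb[of u] by (simp add: sum.inter_filter[symmetric] of_bool_def Int_def)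
    have "(\<Sum>v\<in>nb u. of_bool (\<not> free \<omega> v)) = (\<Sum>v\<in>nb u. 1 - (of_bool (free \<omega> v) :: real))"
      by (intro sum.cong) auto
    also have "\<dots> = 2 * real d - free_nbs \<omega> u"
      by (simp add: sum_subtractf w card_nb[OF u])
    finally show "(\<Sum>v\<in>nb u. of_bool (free \<omega> v \<longleftrightarrow> mono_nb \<omega> u)) =
        (if mono_nb \<omega> u then real (free_nbs \<omega> u) else 2 * real d - free_nbs \<omega> u)"
      by (simp add: w)
  qed
  finally show ?thesis .
qed

lemma mem_nb: "v \<in> E \<Longrightarrow> a < d \<Longrightarrow> v \<in> nb (n2 v a)"
  by (auto simp: nb_def)

text \<open>This makes the palettes of \<open>v\<close> and of its translates nearly determine each other. Coding a few of
  them jointly keeps their cost below the gain of order \<open>1 / d\<close> from the bad edges.\<close>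

lemma palette_change:
  assumes \<omega>: "coloring \<omega>" and v: "v \<in> E" and j: "j < d" "a < d" "b < d"
    and ne: "palette \<omega> (sh v a b) \<noteq> palette \<omega> v"
  shows "bad \<omega> v j \<or> bad \<omega> (xx v j a) a \<or> bad \<omega> (xx v j a) b \<or> bad \<omega> (sh v a b) j"
proof (rule ccontr)
  assume H: "\<not> ?thesis"
  define v2 where "v2 = xx v j a"
  define v3 where "v3 = sh v a b"
  have v2: "v2 \<in> E" using bij_betwE[OF xx_bij[OF j(2,1)]] v by (auto simp: v2_def)
  have v3: "v3 \<in> E" using bij_betwE[OF sh_bij[OF j(2,3)]] v by (auto simp: v3_def)
  have n: "n2 v2 a = n2 v j" "n2 v2 b = n2 v3 j" using xx_n2 v j by (auto simp: v2_def v3_def)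
  \<comment> \<open>On the path \<open>v\<close>, \<open>n2 v j\<close>, \<open>v2\<close>,
    \<open>n2 v3 j\<close>, \<open>v3\<close> no edge is bad, so each point of \<open>E\<close> is
    free exactly when its neighbours on the path are not surrounded by one color. Hence the three
    points of \<open>E\<close> are all free or all not free.\<close>
  have f: "free \<omega> v \<longleftrightarrow> \<not> mono_nb \<omega> (n2 v j)" "free \<omega> v2 \<longleftrightarrow> \<not> mono_nb \<omega> (n2 v j)"
    "free \<omega> v2 \<longleftrightarrow> \<not> mono_nb \<omega> (n2 v3 j)" "free \<omega> v3 \<longleftrightarrow> \<not> mono_nb \<omega> (n2 v3 j)"
    using H n by (auto simp: bad_def v2_def[symmetric] v3_def[symmetric])
  show False
  proof (cases "free \<omega> v")
    case True
    then have "free \<omega> v" "free \<omega> v3" using f by auto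
    \<comment> \<open>\<open>n1 v b\<close> is a common neighbour of \<open>v\<close> and
      \<open>v3\<close>, so two palettes of one color each must coincide.\<close>
    moreover have "\<omega> (n1 v b) \<in> palette \<omega> v" using j by (auto simp: palette_def)
    moreover have "\<omega> (n1 v b) \<in> palette \<omega> v3"
      using j sh_n1[OF v j(2,3)] by (auto simp: palette_def v3_def intro!: image_eqI[of _ _ a])
    ultimately have "palette \<omega> v = palette \<omega> v3" unfolding free_def
      by (metis card_1_singletonE singletonD)
    then show False using ne by (simp add: v3_def)
  next
    case False
    \<comment> \<open>A palette of two colors is the complement of the color of its vertex, and the
      one-colored neighbourhoods carry that color along the path.\<close>
    then have m: "mono_nb \<omega> (n2 v j)" "mono_nb \<omega> (n2 v3 j)" "\<not> free \<omega> v3" using f by auto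
    have "\<omega> v = \<omega> v2" using m(1) mem_nb[OF v j(1)] mem_nb[OF v2 j(2)] n(1) by (auto simp: mono_nb_def)
    moreover have "\<omega> v3 = \<omega> v2" using m(2) mem_nb[OF v3 j(1)] mem_nb[OF v2 j(3)] n(2) by (auto simp: mono_nb_def)
    ultimately show False
      using ne palette_not_free[OF \<omega> v False] palette_not_free[OF \<omega> v3 m(3)] by (simp add: v3_def)
  qed
qed

text \<open>The direction \<open>j\<close> of the connecting path is arbitrary. Averaging over it
  spreads the two edges in direction \<open>j\<close> over all directions, and only the edges in
  directions \<open>a\<close> and \<open>b\<close> are charged in full.\<close>

lemma sum_palette_change:
  assumes \<omega>: "coloring \<omega>" and ab: "a < d" "b < d"
  shows "(\<Sum>v\<in>E. of_bool (palette \<omega> (sh v a b) \<noteq> palette \<omega> v)) \<le> 2 / d * num_bad \<omega> + bad_in_dir \<omega> a + bad_in_dir \<omega> b"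
proof -
  have "(\<Sum>v\<in>E. of_bool (palette \<omega> (sh v a b) \<noteq> palette \<omega> v)) \<le> 2 * bad_in_dir \<omega> j + bad_in_dir \<omega> a + bad_in_dir \<omega> b" if j: "j < d" for j
  proof -
    have "(\<Sum>v\<in>E. of_bool (palette \<omega> (sh v a b) \<noteq> palette \<omega> v)) \<le>
      (\<Sum>v\<in>E. of_bool (bad \<omega> v j) + of_bool (bad \<omega> (xx v j a) a) + of_bool (bad \<omega> (xx v j a) b)
         + (of_bool (bad \<omega> (sh v a b) j) :: real))"
      by (rule sum_mono) (use palette_change[OF \<omega> _ j ab] in \<open>auto simp: of_bool_def\<close>)
    also have "\<dots> = bad_in_dir \<omega> j + bad_in_dir \<omega> a + bad_in_dir \<omega> b + bad_in_dir \<omega> j"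
      using sum.reindex_bij_betw[OF xx_bij[OF ab(1) j], of "\<lambda>v. of_bool (bad \<omega> v a) :: real"]
        sum.reindex_bij_betw[OF xx_bij[OF ab(1) j], of "\<lambda>v. of_bool (bad \<omega> v b) :: real"]
        sum.reindex_bij_betw[OF sh_bij[OF ab], of "\<lambda>v. of_bool (bad \<omega> v j) :: real"]
      by (simp add: sum.distrib bad_in_dir_def)
    finally show ?thesis by simp
  qed
  then have "(\<Sum>j<d. (\<Sum>v\<in>E. of_bool (palette \<omega> (sh v a b) \<noteq> palette \<omega> v))) \<le> (\<Sum>j<d. 2 * bad_in_dir \<omega> j + bad_in_dir \<omega> a + bad_in_dir \<omega> b)"
    by (intro sum_mono) auto
  then have "d * (\<Sum>v\<in>E. of_bool (palette \<omega> (sh v a b) \<noteq> palette \<omega> v)) \<le> 2 * num_bad \<omega> + d * bad_in_dir \<omega> a + d * bad_in_dir \<omega> b"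
    by (simp add: sum.distrib num_bad_def sum_distrib_left)
  then show ?thesis using d0 by (simp add: field_simps)
qed

lemma bad_in_dir_nonneg: "0 \<le> bad_in_dir \<omega> a" by (simp add: bad_in_dir_def sum_nonneg)
lemma num_bad_nonneg: "0 \<le> num_bad \<omega>" by (simp add: num_bad_def sum_nonneg bad_in_dir_nonneg)

text \<open>Markov's inequality: at most half of the directions carry more than twice the average
  number of bad edges. With \<open>a\<close> and \<open>b\<close> among the others, the cost of
  changing palettes is of order \<open>num_bad / d\<close>.\<close>

lemma good_dirs:
  assumes "finite \<Omega>" "2 * L \<le> d"
  obtains K where "K \<subseteq> {..<d}" "card K = L"
    "\<And>a. a \<in> K \<Longrightarrow> (\<Sum>\<omega>\<in>\<Omega>. bad_in_dir \<omega> a) \<le> 2 / d * (\<Sum>\<omega>\<in>\<Omega>. num_bad \<omega>)"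
proof -
  define BB where "BB = (\<Sum>\<omega>\<in>\<Omega>. num_bad \<omega>)"
  define G where "G = {a\<in>{..<d}. (\<Sum>\<omega>\<in>\<Omega>. bad_in_dir \<omega> a) \<le> 2 / d * BB}"
  have BB: "BB = (\<Sum>a<d. \<Sum>\<omega>\<in>\<Omega>. bad_in_dir \<omega> a)" unfolding BB_def num_bad_def by (rule sum.swap)
  have BB0: "BB \<ge> 0" by (simp add: BB_def sum_nonneg num_bad_nonneg)
  have "L \<le> card G"
  proof (rule ccontr)
    assume "\<not> L \<le> card G"
    moreover have "card ({..<d} - G) = d - card G"
      by (subst card_Diff_subset) (auto simp: G_def)
    ultimately have c: "real (card ({..<d} - G)) > d / 2" using assms(2) by linarith
    have ne: "{..<d} - G \<noteq> {}"
    proof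
      assume "{..<d} - G = {}"
      then have "card ({..<d} - G) = 0" by (simp only: card.empty)
      then show False using c by linarith
    qed
    have "BB \<ge> (\<Sum>a\<in>{..<d} - G. \<Sum>\<omega>\<in>\<Omega>. bad_in_dir \<omega> a)"
      unfolding BB by (intro sum_mono2) (auto intro: sum_nonneg bad_in_dir_nonneg)
    moreover have "(\<Sum>a\<in>{..<d} - G. \<Sum>\<omega>\<in>\<Omega>. bad_in_dir \<omega> a) > (\<Sum>a\<in>{..<d} - G. 2 / d * BB)"
      by (rule sum_strict_mono) (use ne in \<open>auto simp: G_def\<close>)
    moreover have "(\<Sum>a\<in>{..<d} - G. 2 / d * BB) \<ge> BB"
    proof -
      have "(\<Sum>a\<in>{..<d} - G. 2 / d * BB) = real (card ({..<d} - G)) * (2 / d * BB)" by simp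
      also have "\<dots> \<ge> (d / 2) * (2 / d * BB)" using c BB0 by (intro mult_right_mono) auto
      also have "(d / 2) * (2 / d * BB) = BB" using d0 by simp
      finally show ?thesis .
    qed
    ultimately show False by linarith
  qed
  then obtain K where "K \<subseteq> G" "card K = L" by (meson obtain_subset_with_card_n)
  then show ?thesis using that by (auto simp: G_def BB_def)
qed

end

lemma neg_ln_one_minus: "0 < s \<Longrightarrow> s \<le> 1 / 2 \<Longrightarrow> - ln (1 - s) \<le> 2 * (s::real)"
proof -
  assume s: "0 < s" "s \<le> 1 / 2"
  have "- ln (1 - s) = ln (1 / (1 - s))" using s by (simp add: ln_div)
  also have "\<dots> \<le> 1 / (1 - s) - 1" using s by (intro ln_le_minus_one) auto
  also have "\<dots> = s * (1 / (1 - s))" using s by (simp add: field_simps)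
  also have "\<dots> \<le> s * 2" using s by (intro mult_left_mono) (auto simp: field_simps)
  finally show ?thesis by simp
qed

section \<open>Entropy of the three stages \<open>O1\<close>, \<open>E\<close> and
  \<open>O2\<close>\<close>

context split_cube begin

definition coord :: "'v \<Rightarrow> ('v \<Rightarrow> nat) \<Rightarrow> nat" where "coord v \<omega> = \<omega> v"

lemma cond_ent_O2:
  assumes fO: "finite \<Omega>" and coloring: "\<And>\<omega>. \<omega> \<in> \<Omega> \<Longrightarrow> coloring \<omega>"
  shows "cond_ent \<Omega> (joint coord O2) (joint coord E) \<le> (\<Sum>\<omega>\<in>\<Omega>. \<Sum>u\<in>O2. of_bool (mono_nb \<omega> u) * ln 2)"
proof -
  have "cond_ent \<Omega> (coord u) (joint coord E) \<le> (\<Sum>\<omega>\<in>\<Omega>. of_bool (mono_nb \<omega> u) * ln 2)" if u: "u \<in> O2" for u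
  proof -
    let ?S = "\<lambda>y. {..<3} - y ` nb u"
    have sub: "nb u \<subseteq> E" by (auto simp: nb_def)
    have y: "joint coord E \<omega> ` nb u = \<omega> ` nb u" for \<omega>
      using sub by (intro image_cong refl) (auto simp: joint_apply coord_def)
    have "cond_ent \<Omega> (coord u) (joint coord E) \<le> (\<Sum>\<omega>\<in>\<Omega>. ln (card (?S (joint coord E \<omega>))))"
    proof (rule cond_ent_le_ln_card[OF fO])
      fix \<omega> assume "\<omega> \<in> \<Omega>"
      then have c: "coloring \<omega>" by (rule coloring)
      then have "\<omega> u < 3" using u by (auto simp: coloring_def)
      moreover have "\<omega> u \<notin> \<omega> ` nb u"
        using c unfolding nb_def coloring_def by force
      ultimately show "coord u \<omega> \<in> ?S (joint coord E \<omega>)" unfolding y by (simp add: coord_def)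
    qed simp
    also have "\<dots> \<le> (\<Sum>\<omega>\<in>\<Omega>. of_bool (mono_nb \<omega> u) * ln 2)"
    proof (rule sum_mono)
      fix \<omega> assume "\<omega> \<in> \<Omega>"
      then have c: "coloring \<omega>" by (rule coloring)
      have "card (nb u) > 0" using card_nb[OF u] d0 by simp
      then obtain v where v: "v \<in> nb u" by (metis card_gt_0_iff ex_in_conv)
      have v3: "\<omega> w < 3" if "w \<in> nb u" for w using c sub that by (auto simp: coloring_def)
      have k: "card (?S (joint coord E \<omega>)) \<le> (if mono_nb \<omega> u then 2 else 1)"
      proof (cases "mono_nb \<omega> u")
        case True
        have "?S (joint coord E \<omega>) \<subseteq> {..<3} - {\<omega> v}" using v unfolding y by auto
        then have "card (?S (joint coord E \<omega>)) \<le> 2"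
          using card_mono[of "{..<3} - {\<omega> v}"] card_other_colors[OF v3[OF v]] by auto
        then show ?thesis using True by simp
      next
        case False
        then obtain w where w: "w \<in> nb u" "\<omega> w \<noteq> \<omega> v" unfolding mono_nb_def by metis
        have "?S (joint coord E \<omega>) \<subseteq> {..<3} - {\<omega> v} - {\<omega> w}" using v w unfolding y by auto
        then have "card (?S (joint coord E \<omega>)) \<le> card ({..<3} - {\<omega> v} - {\<omega> w})"
          by (intro card_mono) auto
        also have "\<dots> = 1"
          using card_other_colors[OF v3[OF v]] w(2) v3[OF w(1)] by (subst card_Diff_singleton) auto
        finally show ?thesis using False by simp
      qed
      define k where "k = card (?S (joint coord E \<omega>))"
      \<comment> \<open>Only an upper bound on \<open>k\<close> is at hand; the value 0 does no harm
        because \<open>ln 0 = 0\<close>.\<close>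
      have "k = 0 \<or> k = 1 \<or> k = 2 \<and> mono_nb \<omega> u" using k by (auto simp: k_def[symmetric] split: if_splits)
      then have "ln (real k) \<le> of_bool (mono_nb \<omega> u) * ln 2" by auto
      then show "ln (card (?S (joint coord E \<omega>))) \<le> of_bool (mono_nb \<omega> u) * ln 2" by (simp only: k_def)
    qed
    finally show ?thesis .
  qed
  then have "(\<Sum>u\<in>O2. cond_ent \<Omega> (coord u) (joint coord E)) \<le> (\<Sum>u\<in>O2. \<Sum>\<omega>\<in>\<Omega>. of_bool (mono_nb \<omega> u) * ln 2)"
    by (rule sum_mono)
  moreover have "cond_ent \<Omega> (joint coord O2) (joint coord E) \<le> (\<Sum>u\<in>O2. cond_ent \<Omega> (coord u) (joint coord E))"
    by (rule cond_ent_joint_le_sum[OF fO fin(3)])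
  ultimately show ?thesis by (subst sum.swap) linarith
qed

text \<open>The Shearer block of \<open>v\<close> consists of the neighbours in \<open>O1\<close>,
  in directions outside \<open>K\<close>, of the \<open>card K\<close> translates of
  \<open>v\<close>. Coding a block takes the palette of \<open>v\<close>, one of 8 sets; the
  palettes of the translates relative to it; and then \<open>ln 2\<close> for each neighbour of a
  translate that is not free. The palette of \<open>v\<close> is paid for once in a block of order
  \<open>card K * d\<close>, which is why \<open>K\<close> is taken large. After division the
  leading term is \<open>ln 2 / 2\<close> for each point of \<open>E\<close> that is not
  free.\<close>

lemma cond_ent_O1:
  fixes s :: real
  assumes fO: "finite \<Omega>" and coloring: "\<And>\<omega>. \<omega> \<in> \<Omega> \<Longrightarrow> coloring \<omega>"
    and s: "0 < s" "s \<le> 1 / 2"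
    and K: "K \<subseteq> {..<d}" "a0 \<in> K"
    and good: "\<And>a. a \<in> K \<Longrightarrow> (\<Sum>\<omega>\<in>\<Omega>. bad_in_dir \<omega> a) \<le> 2 / d * (\<Sum>\<omega>\<in>\<Omega>. num_bad \<omega>)"
  shows "2 * card K * (d - card K) * cond_ent \<Omega> (joint coord O1) (\<lambda>_. ()) \<le>
      card \<Omega> * card E * (3 * ln 2) + card K * card \<Omega> * card E * (2 * s)
      + card K * ln (8 / s) * (6 / d) * (\<Sum>\<omega>\<in>\<Omega>. num_bad \<omega>)
      + (d - card K) * card K * ln 2 * (\<Sum>\<omega>\<in>\<Omega>. card E - num_free \<omega>)"
proof -
  let ?u = "\<lambda>_::'v \<Rightarrow> nat. ()"
  define D where "D = {..<d} - K"
  define T where "T v = (\<lambda>(b, a). n1 (sh v a0 b) a) ` (K \<times> D)" for v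
  have fK: "finite K" "finite D" using K by (auto simp: D_def intro: finite_subset)
  have cD: "card D = d - card K" using K fK by (simp add: D_def card_Diff_subset)
  have a0: "a0 < d" using K by auto
  have Kd: "b < d" if "b \<in> K" for b using K that by auto
  have shE: "sh v a0 b \<in> E" if "v \<in> E" "b \<in> K" for v b
    using bij_betwE[OF sh_bij[OF a0 Kd[OF that(2)]]] that(1) by auto
  define c where "c v \<omega> = 3 * ln 2 + (\<Sum>b\<in>K. 2 * s + of_bool (palette \<omega> (sh v a0 b) \<noteq> palette \<omega> v) * ln (8 / s))
     + (\<Sum>b\<in>K. of_bool (\<not> free \<omega> (sh v a0 b)) * (card D * ln 2))" for v \<omega>
  have ln8: "ln (8/s) \<ge> 0" using s by simp
  have T: "cond_ent \<Omega> (joint coord (T v)) ?u \<le> (\<Sum>\<omega>\<in>\<Omega>. c v \<omega>)" if v: "v \<in> E" for v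
  proof -
    define R0 where "R0 \<omega> = palette \<omega> v" for \<omega>
    define R where "R b \<omega> = palette \<omega> (sh v a0 b)" for b \<omega>
    define Y where "Y = (\<lambda>\<omega>. ((joint R K \<omega>, R0 \<omega>), ()))"
    define P where "P = (\<lambda>(b, a) \<omega>. \<omega> (n1 (sh v a0 b) a) :: nat)"
    have "cond_ent \<Omega> (joint coord (T v)) ?u \<le> cond_ent \<Omega> (\<lambda>\<omega>. (joint coord (T v) \<omega>, (joint R K \<omega>, R0 \<omega>))) ?u"
      by (rule cond_ent_mono[OF fO]) auto
    also have "\<dots> = cond_ent \<Omega> R0 ?u + cond_ent \<Omega> (joint R K) (\<lambda>\<omega>. (R0 \<omega>, ())) + cond_ent \<Omega> (joint coord (T v)) Y"
      by (simp add: cond_ent_chain[OF fO] Y_def)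
    finally have 0: "cond_ent \<Omega> (joint coord (T v)) ?u \<le> cond_ent \<Omega> R0 ?u + cond_ent \<Omega> (joint R K) (\<lambda>\<omega>. (R0 \<omega>, ())) + cond_ent \<Omega> (joint coord (T v)) Y" .
    have pow: "palette \<omega> w \<in> Pow {..<3}" if "\<omega> \<in> \<Omega>" "w \<in> E" for \<omega> w
      using palette_sub[OF coloring[OF that(1)] that(2)] by auto
    have cpow: "card (Pow {..<3::nat}) = 8" by (simp add: card_Pow)
    have 1: "cond_ent \<Omega> R0 ?u \<le> (\<Sum>\<omega>\<in>\<Omega>. 3 * ln 2)"
    proof -
      have "cond_ent \<Omega> R0 ?u \<le> (\<Sum>\<omega>\<in>\<Omega>. ln (card ((\<lambda>_. Pow {..<3::nat}) (?u \<omega>))))"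
        by (rule cond_ent_le_ln_card[OF fO]) (use pow v in \<open>auto simp: R0_def\<close>)
      also have "ln (real 8) = 3 * ln 2" using ln_realpow[of 2 3] by simp
      ultimately show ?thesis by (simp only: cpow)
    qed
    have 2: "cond_ent \<Omega> (joint R K) (\<lambda>\<omega>. (R0 \<omega>, ())) \<le> (\<Sum>\<omega>\<in>\<Omega>. \<Sum>b\<in>K. 2 * s + of_bool (palette \<omega> (sh v a0 b) \<noteq> palette \<omega> v) * ln (8 / s))"
    proof -
      have "cond_ent \<Omega> (R b) (\<lambda>\<omega>. (R0 \<omega>, ())) \<le> (\<Sum>\<omega>\<in>\<Omega>. 2 * s + of_bool (palette \<omega> (sh v a0 b) \<noteq> palette \<omega> v) * ln (8 / s))"
        if b: "b \<in> K" for b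
      proof -
        \<comment> \<open>The palette of the translate is guessed to be that of \<open>v\<close>,
          and the remaining weight \<open>s\<close> is spread over the 8 sets of colors. A right
          guess costs at most \<open>2 * s\<close>, a wrong one \<open>ln (8 / s)\<close>.\<close>
        let ?r = "\<lambda>x (y, _::unit). if x = y then 1 - s else s / 8"
        have "cond_ent \<Omega> (R b) (\<lambda>\<omega>. (R0 \<omega>, ())) \<le> (\<Sum>\<omega>\<in>\<Omega>. - ln (?r (R b \<omega>) (R0 \<omega>, ())))"
        proof (rule gibbs[OF fO])
          fix \<omega> assume w: "\<omega> \<in> \<Omega>"
          show "0 < ?r (R b \<omega>) (R0 \<omega>, ())" using s by auto
          have "(\<Sum>x\<in>R b ` fibre \<Omega> (\<lambda>\<omega>. (R0 \<omega>, ())) \<omega>. ?r x (R0 \<omega>, ())) \<le> (\<Sum>x\<in>Pow {..<3}. ?r x (R0 \<omega>, ()))"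
            using s pow shE[OF v b] by (intro sum_mono2) (auto simp: fibre_def R_def)
          also have "\<dots> \<le> (\<Sum>x\<in>Pow {..<3}. (if x = R0 \<omega> then 1 - s else 0) + s / 8)"
            using s by (intro sum_mono) auto
          also have "\<dots> = (if R0 \<omega> \<in> Pow {..<3} then 1 - s else 0) + 8 * (s / 8)"
            by (simp add: sum.distrib cpow)
          also have "\<dots> \<le> 1" using s by auto
          finally show "(\<Sum>x\<in>R b ` fibre \<Omega> (\<lambda>\<omega>. (R0 \<omega>, ())) \<omega>. ?r x (R0 \<omega>, ())) \<le> 1" .
        qed
        also have "\<dots> \<le> (\<Sum>\<omega>\<in>\<Omega>. 2 * s + of_bool (palette \<omega> (sh v a0 b) \<noteq> palette \<omega> v) * ln (8 / s))"
        proof (rule sum_mono)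
          fix \<omega>
          have "- ln (1 - s) \<le> 2 * s" by (rule neg_ln_one_minus[OF s])
          moreover have "- ln (s / 8) = ln (8 / s)" using s by (simp add: ln_div)
          ultimately show "- ln (?r (R b \<omega>) (R0 \<omega>, ())) \<le> 2 * s + of_bool (palette \<omega> (sh v a0 b) \<noteq> palette \<omega> v) * ln (8 / s)"
            using s by (auto simp: R_def R0_def)
        qed
        finally show ?thesis .
      qed
      then have "(\<Sum>b\<in>K. cond_ent \<Omega> (R b) (\<lambda>\<omega>. (R0 \<omega>, ()))) \<le> (\<Sum>b\<in>K. \<Sum>\<omega>\<in>\<Omega>. 2 * s + of_bool (palette \<omega> (sh v a0 b) \<noteq> palette \<omega> v) * ln (8 / s))"
        by (rule sum_mono)
      then show ?thesis using cond_ent_joint_le_sum[OF fO fK(1), of R "\<lambda>\<omega>. (R0 \<omega>, ())"]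
        by (subst sum.swap) linarith
    qed
    have 3: "cond_ent \<Omega> (joint coord (T v)) Y \<le> (\<Sum>\<omega>\<in>\<Omega>. \<Sum>b\<in>K. of_bool (\<not> free \<omega> (sh v a0 b)) * (card D * ln 2))"
    proof -
      have "cond_ent \<Omega> (joint coord (T v)) Y \<le> cond_ent \<Omega> (joint P (K \<times> D)) Y"
        by (rule cond_ent_mono[OF fO]) (auto simp: joint_eq_iff T_def P_def coord_def)
      also have "\<dots> \<le> (\<Sum>p\<in>K \<times> D. cond_ent \<Omega> (P p) Y)"
        by (rule cond_ent_joint_le_sum[OF fO]) (use fK in auto)
      also have "\<dots> \<le> (\<Sum>p\<in>K \<times> D. \<Sum>\<omega>\<in>\<Omega>. of_bool (\<not> free \<omega> (sh v a0 (fst p))) * ln 2)"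
      proof (rule sum_mono)
        fix p assume p: "p \<in> K \<times> D"
        obtain b a where ba: "p = (b, a)" "b \<in> K" "a \<in> D" using p by auto
        have "cond_ent \<Omega> (P p) Y \<le> cond_ent \<Omega> (P p) (R b)"
          by (rule cond_ent_cond_mono[OF fO]) (use ba in \<open>auto simp: Y_def joint_eq_iff\<close>)
        also have "\<dots> \<le> (\<Sum>\<omega>\<in>\<Omega>. ln (card (R b \<omega>)))"
          by (rule cond_ent_le_ln_card[OF fO, where S="\<lambda>x. x"])
            (use ba in \<open>auto simp: R_def P_def palette_def D_def\<close>)
        also have "\<dots> \<le> (\<Sum>\<omega>\<in>\<Omega>. of_bool (\<not> free \<omega> (sh v a0 (fst p))) * ln 2)"
        proof (rule sum_mono)
          fix \<omega> assume "\<omega> \<in> \<Omega>"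
          from palette_card[OF coloring[OF this] shE[OF v ba(2)]]
          show "ln (real (card (R b \<omega>))) \<le> of_bool (\<not> free \<omega> (sh v a0 (fst p))) * ln 2"
            by (auto simp: R_def free_def ba)
        qed
        finally show "cond_ent \<Omega> (P p) Y \<le> (\<Sum>\<omega>\<in>\<Omega>. of_bool (\<not> free \<omega> (sh v a0 (fst p))) * ln 2)" .
      qed
      also have "\<dots> = (\<Sum>\<omega>\<in>\<Omega>. \<Sum>p\<in>K \<times> D. of_bool (\<not> free \<omega> (sh v a0 (fst p))) * ln 2)"
        by (rule sum.swap)
      also have "\<dots> = (\<Sum>\<omega>\<in>\<Omega>. \<Sum>b\<in>K. of_bool (\<not> free \<omega> (sh v a0 b)) * (card D * ln 2))"
      proof (rule sum.cong[OF refl])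
        fix \<omega>
        have "(\<Sum>p\<in>K \<times> D. of_bool (\<not> free \<omega> (sh v a0 (fst p))) * ln 2)
            = (\<Sum>b\<in>K. \<Sum>a\<in>D. of_bool (\<not> free \<omega> (sh v a0 b)) * ln (2::real))"
          unfolding sum.cartesian_product by (rule sum.cong) auto
        then show "(\<Sum>p\<in>K \<times> D. of_bool (\<not> free \<omega> (sh v a0 (fst p))) * ln 2)
            = (\<Sum>b\<in>K. of_bool (\<not> free \<omega> (sh v a0 b)) * (card D * ln (2::real)))"
          by (simp add: mult_ac)
      qed
      finally show ?thesis .
    qed
    show ?thesis using 0 1 2 3 unfolding c_def sum.distrib by linarith
  qed
  have "real (2 * card K * (d - card K)) * cond_ent \<Omega> (joint coord O1) ?u \<le> (\<Sum>v\<in>E. cond_ent \<Omega> (joint coord (T v)) ?u)"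
  proof (rule shearer[OF fO fin(2,1)])
    show "2 * card K * (d - card K) \<le> card {v\<in>E. u \<in> T v}" if "u \<in> O1" for u
      using cover[OF that K] by (simp add: T_def D_def)
    show "T v \<subseteq> O1" if "v \<in> E" for v
      using n1_in shE[OF that] by (auto simp: T_def D_def)
  qed
  also have "\<dots> \<le> (\<Sum>v\<in>E. \<Sum>\<omega>\<in>\<Omega>. c v \<omega>)" by (rule sum_mono) (rule T)
  also have "\<dots> = (\<Sum>\<omega>\<in>\<Omega>. \<Sum>v\<in>E. c v \<omega>)" by (rule sum.swap)
  also have "\<dots> \<le> (\<Sum>\<omega>\<in>\<Omega>. card E * (3 * ln 2) + card K * card E * (2 * s)
      + (\<Sum>b\<in>K. 2 / d * num_bad \<omega> + bad_in_dir \<omega> a0 + bad_in_dir \<omega> b) * ln (8 / s) + card K * (card E - num_free \<omega>) * (card D * ln 2))"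
  proof (rule sum_mono)
    fix \<omega> assume w: "\<omega> \<in> \<Omega>"
    have e1: "(\<Sum>v\<in>E. c v \<omega>) = card E * (3 * ln 2) + card K * card E * (2 * s)
      + (\<Sum>b\<in>K. \<Sum>v\<in>E. of_bool (palette \<omega> (sh v a0 b) \<noteq> palette \<omega> v)) * ln (8 / s)
      + (\<Sum>b\<in>K. \<Sum>v\<in>E. of_bool (\<not> free \<omega> (sh v a0 b))) * (card D * ln 2)"
      unfolding c_def sum.distrib
      by (simp add: sum.swap[of _ E K] sum_distrib_right)
    have e2: "(\<Sum>b\<in>K. \<Sum>v\<in>E. of_bool (\<not> free \<omega> (sh v a0 b))) = (\<Sum>b\<in>K. card E - num_free \<omega>)"
    proof (rule sum.cong[OF refl])
      fix b assume b: "b \<in> K"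
      have "(\<Sum>v\<in>E. of_bool (\<not> free \<omega> (sh v a0 b))) = (\<Sum>v\<in>E. of_bool (\<not> free \<omega> v))"
        by (rule sum.reindex_bij_betw[OF sh_bij[OF a0 Kd[OF b]], of "\<lambda>v. of_bool (\<not> free \<omega> v)"])
      also have "\<dots> = (\<Sum>v\<in>E. 1 - (of_bool (free \<omega> v) :: real))" by (intro sum.cong) auto
      also have "\<dots> = card E - num_free \<omega>" by (simp add: sum_subtractf num_free_def)
      finally show "(\<Sum>v\<in>E. of_bool (\<not> free \<omega> (sh v a0 b))) = card E - num_free \<omega>" .
    qed
    have e3: "(\<Sum>b\<in>K. \<Sum>v\<in>E. of_bool (palette \<omega> (sh v a0 b) \<noteq> palette \<omega> v)) * ln (8 / s)
       \<le> (\<Sum>b\<in>K. 2 / d * num_bad \<omega> + bad_in_dir \<omega> a0 + bad_in_dir \<omega> b) * ln (8 / s)"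
      using ln8 by (intro mult_right_mono sum_mono sum_palette_change[OF coloring[OF w] a0 Kd])
    show "(\<Sum>v\<in>E. c v \<omega>) \<le> card E * (3 * ln 2) + card K * card E * (2 * s)
      + (\<Sum>b\<in>K. 2 / d * num_bad \<omega> + bad_in_dir \<omega> a0 + bad_in_dir \<omega> b) * ln (8 / s) + card K * (card E - num_free \<omega>) * (card D * ln 2)"
      unfolding e1 e2 using e3 by simp
  qed
  also have "\<dots> = card \<Omega> * card E * (3 * ln 2) + card K * card \<Omega> * card E * (2 * s)
      + (\<Sum>\<omega>\<in>\<Omega>. \<Sum>b\<in>K. 2 / d * num_bad \<omega> + bad_in_dir \<omega> a0 + bad_in_dir \<omega> b) * ln (8 / s)
      + (d - card K) * card K * ln 2 * (\<Sum>\<omega>\<in>\<Omega>. card E - num_free \<omega>)"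
  proof -
    have "(\<Sum>\<omega>\<in>\<Omega>. card E * (3 * ln 2) + card K * card E * (2 * s) + q \<omega> * ln (8 / s)
        + card K * (card E - num_free \<omega>) * (card D * ln 2))
      = card \<Omega> * card E * (3 * ln 2) + card K * card \<Omega> * card E * (2 * s)
      + (\<Sum>\<omega>\<in>\<Omega>. q \<omega>) * ln (8 / s)
      + (d - card K) * card K * ln 2 * (\<Sum>\<omega>\<in>\<Omega>. card E - num_free \<omega>)" for q
      by (simp add: sum.distrib cD sum_distrib_left sum_distrib_right distrib_left mult_ac)
    then show ?thesis .
  qed
  finally have m: "2 * card K * (d - card K) * cond_ent \<Omega> (joint coord O1) ?u \<le>
      card \<Omega> * card E * (3 * ln 2) + card K * card \<Omega> * card E * (2 * s)
      + (\<Sum>\<omega>\<in>\<Omega>. \<Sum>b\<in>K. 2 / d * num_bad \<omega> + bad_in_dir \<omega> a0 + bad_in_dir \<omega> b) * ln (8 / s)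
      + (d - card K) * card K * ln 2 * (\<Sum>\<omega>\<in>\<Omega>. card E - num_free \<omega>)" by simp
  have "(\<Sum>\<omega>\<in>\<Omega>. \<Sum>b\<in>K. 2 / d * num_bad \<omega> + bad_in_dir \<omega> a0 + bad_in_dir \<omega> b)
      = (\<Sum>b\<in>K. 2 / d * (\<Sum>\<omega>\<in>\<Omega>. num_bad \<omega>) + (\<Sum>\<omega>\<in>\<Omega>. bad_in_dir \<omega> a0) + (\<Sum>\<omega>\<in>\<Omega>. bad_in_dir \<omega> b))"
    by (subst sum.swap) (simp add: sum.distrib sum_distrib_left)
  also have "\<dots> \<le> (\<Sum>b\<in>K. 2 / d * (\<Sum>\<omega>\<in>\<Omega>. num_bad \<omega>) + 2 / d * (\<Sum>\<omega>\<in>\<Omega>. num_bad \<omega>) + 2 / d * (\<Sum>\<omega>\<in>\<Omega>. num_bad \<omega>))"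
    using good K(2) by (intro sum_mono add_mono order_refl) auto
  also have "\<dots> = card K * (6 / d) * (\<Sum>\<omega>\<in>\<Omega>. num_bad \<omega>)" by (simp add: field_simps)
  finally have "(\<Sum>\<omega>\<in>\<Omega>. \<Sum>b\<in>K. 2 / d * num_bad \<omega> + bad_in_dir \<omega> a0 + bad_in_dir \<omega> b) * ln (8 / s)
      \<le> card K * (6 / d) * (\<Sum>\<omega>\<in>\<Omega>. num_bad \<omega>) * ln (8 / s)"
    using ln8 by (rule mult_right_mono)
  moreover have "card K * (6 / d) * (\<Sum>\<omega>\<in>\<Omega>. num_bad \<omega>) * ln (8 / s) = card K * ln (8 / s) * (6 / d) * (\<Sum>\<omega>\<in>\<Omega>. num_bad \<omega>)"
    by (simp only: mult_ac)
  ultimately show ?thesis using m by linarith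
qed


text \<open>Code words for the colors around \<open>u \<in> O2\<close> when \<open>w\<close> of its neighbours are free: the \<open>2 ^ w\<close> patterns
  share the weight, except that the monochromatic ones (at most one if \<open>w \<le> d\<close>, at most three
  always) receive a large part of it. Where \<open>w \<le> d\<close>, the price of this for the other patterns is
  paid by the bad edges at \<open>u\<close>.\<close>

definition code_weight :: "nat \<Rightarrow> bool \<Rightarrow> real" where
  "code_weight w m = (if w = 0 then 1
     else if w \<le> d then (if m then 15 / 16 else (1 / 16) / 2 ^ w)
     else (if m then 1 / (3 * d) else (1 - 1 / d) / 2 ^ w))"

text \<open>A one-colored pattern costs at most a tenth of \<open>w * ln 2\<close>. The saved
  fraction 9/10 has to exceed 1/2, because a bad edge at a one-colored neighbourhood gives
  \<open>ln 2 / 2\<close> back when \<open>O2\<close> is revealed. For \<open>0 < w \<le> d\<close>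
  any other pattern costs \<open>ln 16 = 4 * ln 2\<close> extra, which is affordable since at least
  \<open>d\<close> edges at \<open>u\<close> are then bad. The term \<open>2 / d\<close> pays for
  the factor \<open>1 - 1 / d\<close>.\<close>

lemma code_weight_bound:
  assumes d: "2 \<le> d" "ln (3 * real d) \<le> d * (ln 2 / 10)"
  shows "- ln (code_weight w m) \<le> w * ln 2 - (if m then 9 / 10 * ln 2 * w else 0)
     + (if \<not> m then 4 * ln 2 * (2 * real d - w) / d else 0) * of_bool (w \<le> d) + 2 / d"
proof -
  have l2: "ln (2::real) > 0" by simp
  consider "w = 0" | "w > 0" "w \<le> d" m | "w > 0" "w \<le> d" "\<not> m" | "w > d" m | "w > d" "\<not> m" by force
  then show ?thesis
  proof cases
    case 1
    then show ?thesis using d by (auto simp: code_weight_def)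
  next
    case 2
    \<comment> \<open>The weight 15/16 is large enough for its cost to stay below
      \<open>ln 2 / 10\<close> already at \<open>w = 1\<close>, as the tenth power of 16/15 is less
      than 2.\<close>
    have "ln (16 / 15) * 10 = ln ((16 / 15) ^ 10 :: real)" by (simp add: ln_realpow)
    also have "\<dots> \<le> ln 2" by (subst ln_le_cancel_iff) (auto simp: power_divide)
    finally have "ln (16 / 15) \<le> ln (2::real) / 10" by simp
    moreover have "- ln (15 / 16) = ln (16 / 15 :: real)" by (simp add: ln_div)
    moreover have "1 / 10 * ln 2 * 1 \<le> 1 / 10 * ln 2 * real w" using 2 by (intro mult_left_mono) auto
    ultimately have "- ln (15 / 16) \<le> 1 / 10 * ln 2 * real w" by linarith
    moreover have "2 / real d \<ge> 0" by simp
    ultimately have "- ln (15 / 16) \<le> w * ln 2 - 9 / 10 * ln 2 * w + 2 / d" by argo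
    then show ?thesis using 2 by (simp add: code_weight_def)
  next
    case 3
    have "- ln ((1 / 16) / 2 ^ w :: real) = ln 16 + ln (2 ^ w)" by (simp add: ln_div ln_mult)
    also have "ln (16::real) = 4 * ln 2" using ln_realpow[of 2 4] by simp
    also have "ln (2 ^ w) = w * ln (2::real)" by (simp add: ln_realpow)
    finally have a: "- ln ((1 / 16) / 2 ^ w :: real) = 4 * ln 2 + w * ln 2" .
    have "4 * ln 2 * d \<le> 4 * ln 2 * (2 * real d - w)" using 3 by (intro mult_left_mono) auto
    then have "4 * ln 2 \<le> 4 * ln 2 * (2 * real d - w) / d" using d by (simp add: field_simps)
    moreover have "2 / real d \<ge> 0" by simp
    ultimately have "4 * ln 2 \<le> 4 * ln 2 * (2 * real d - w) / d + 2 / d" by argo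
    then show ?thesis using 3 a d by (simp add: code_weight_def)
  next
    case 4
    have "- ln (1 / (3 * real d)) = ln (3 * real d)" using d by (simp add: ln_div)
    also have "\<dots> \<le> d * (ln 2 / 10)" by fact
    also have "\<dots> \<le> w * (ln 2 / 10)" using 4 by (intro mult_right_mono) auto
    finally have "- ln (1 / (3 * real d)) \<le> w * (ln 2 / 10)" .
    moreover have "2 / real d \<ge> 0" by simp
    ultimately have "- ln (1 / (3 * real d)) \<le> w * ln 2 - 9 / 10 * ln 2 * w + 2 / d" by argo
    then show ?thesis using 4 by (simp add: code_weight_def)
  next
    case 5
    have p: "1 - 1 / real d > 0" using d by simp
    have "- ln ((1 - 1 / real d) / 2 ^ w) = - ln (1 - 1 / real d) + w * ln 2"
      using p d by (simp add: ln_div ln_realpow)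
    also have "\<dots> \<le> 2 * (1 / real d) + w * ln 2"
      using neg_ln_one_minus[of "1 / real d"] d by (simp add: field_simps)
    finally show ?thesis using 5 by (simp add: code_weight_def)
  qed
qed

text \<open>Given the colors on \<open>O1\<close>, a free neighbour of \<open>u\<close> has two
  possible colors and any other neighbour has one. The number \<open>w\<close> of free neighbours is
  known from \<open>O1\<close>, so a weight depending on \<open>w\<close> is a legal code.\<close>

lemma cond_ent_nb:
  assumes fO: "finite \<Omega>" and coloring: "\<And>\<omega>. \<omega> \<in> \<Omega> \<Longrightarrow> coloring \<omega>"
    and d: "2 \<le> d" and u: "u \<in> O2"
  shows "cond_ent \<Omega> (joint coord (nb u)) (joint coord O1) \<le> (\<Sum>\<omega>\<in>\<Omega>. - ln (code_weight (free_nbs \<omega> u) (mono_nb \<omega> u)))"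
proof -
  define Rp where "Rp y v = (\<lambda>a. y (n1 v a)) ` {..<d}" for y :: "'v \<Rightarrow> nat" and v
  define Wy where "Wy y = card {v\<in>nb u. card (Rp y v) = 1}" for y
  define mx where "mx x \<longleftrightarrow> (\<exists>c. \<forall>v\<in>nb u. x v = c)" for x :: "'v \<Rightarrow> nat"
  define r where "r x y = code_weight (Wy y) (mx x)" for x y
  have sub: "nb u \<subseteq> E" by (auto simp: nb_def)
  have Rp: "Rp (joint coord O1 \<omega>) v = palette \<omega> v" if "v \<in> E" for \<omega> v
    unfolding Rp_def palette_def using n1_in[OF that] by (intro image_cong refl) (auto simp: joint_apply coord_def)
  have "{v\<in>nb u. card (Rp (joint coord O1 \<omega>) v) = 1} = {v\<in>nb u. free \<omega> v}" for \<omega>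
    using Rp sub by (auto simp: free_def)
  then have Wy: "Wy (joint coord O1 \<omega>) = free_nbs \<omega> u" for \<omega> by (simp add: Wy_def free_nbs_def)
  have mx: "mx (joint coord (nb u) \<omega>) = mono_nb \<omega> u" for \<omega>
    unfolding mx_def mono_nb_def by (auto simp: joint_apply coord_def)
  have wpos: "code_weight w m > 0" for w m using d by (auto simp: code_weight_def)
  have "cond_ent \<Omega> (joint coord (nb u)) (joint coord O1) \<le> (\<Sum>\<omega>\<in>\<Omega>. - ln (r (joint coord (nb u) \<omega>) (joint coord O1 \<omega>)))"
  proof (rule gibbs[OF fO])
    show "0 < r (joint coord (nb u) \<omega>) (joint coord O1 \<omega>)" for \<omega> by (simp add: r_def wpos)
    fix \<omega> assume w: "\<omega> \<in> \<Omega>"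
    define XX where "XX = joint coord (nb u) ` fibre \<Omega> (joint coord O1) \<omega>"
    define opt where "opt v = {..<3} - palette \<omega> v" for v
    define w where "w = free_nbs \<omega> u"
    have colw: "coloring \<omega>" using coloring w by simp
    have fXX: "finite XX" by (simp add: XX_def finite_fibre fO)
    have XXopt: "x v \<in> opt v" if "x \<in> XX" "v \<in> nb u" for x v
    proof -
      have xX: "x \<in> XX" by fact
      obtain \<omega>' where o: "\<omega>' \<in> \<Omega>" "joint coord O1 \<omega>' = joint coord O1 \<omega>" "x = joint coord (nb u) \<omega>'"
        using xX unfolding XX_def fibre_def by blast
      have v: "v \<in> E" using that sub by auto
      have "palette \<omega>' v = palette \<omega> v" using Rp[OF v, of \<omega>] Rp[OF v, of \<omega>'] o(2) by simp
      moreover have "\<omega>' v < 3" "\<omega>' v \<notin> palette \<omega>' v"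
        using palette_sub[OF coloring[OF o(1)] v] coloring[OF o(1)] v by (auto simp: coloring_def)
      ultimately show ?thesis using that(2) by (simp add: o(3) joint_apply coord_def opt_def)
    qed
    have XXPi: "XX \<subseteq> PiE (nb u) opt"
    proof
      fix x assume x: "x \<in> XX"
      have "x \<in> extensional (nb u)" using x by (auto simp: XX_def joint_def)
      then show "x \<in> PiE (nb u) opt" using XXopt[OF x] by (auto simp: PiE_def)
    qed
    have copt: "card (opt v) = (if free \<omega> v then 2 else 1)" if "v \<in> nb u" for v
    proof -
      have v: "v \<in> E" using that sub by auto
      have "card (opt v) = 3 - card (palette \<omega> v)"
        using palette_sub[OF colw v] unfolding opt_def by (subst card_Diff_subset) (auto intro: finite_subset)
      then show ?thesis using palette_card[OF colw v] by (auto simp: free_def)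
    qed
    have "card (PiE (nb u) opt) = (\<Prod>v\<in>nb u. card (opt v))" by (rule card_PiE[OF finite_nb])
    also have "\<dots> = (\<Prod>v\<in>nb u. if free \<omega> v then 2 else 1)" by (intro prod.cong refl copt)
    also have "\<dots> = 2 ^ w"
      using finite_nb[of u] by (simp add: prod.inter_filter[symmetric] w_def free_nbs_def)
    finally have cPi: "card (PiE (nb u) opt) = 2 ^ w" .
    have fPi: "finite (PiE (nb u) opt)" by (intro finite_PiE finite_nb) (auto simp: opt_def)
    have cXX: "card XX \<le> 2 ^ w" using card_mono[OF fPi XXPi] cPi by simp
    obtain v0 where v0: "v0 \<in> nb u"
      using card_nb[OF u] d by (metis card.empty ex_in_conv mult_is_0 not_numeral_le_zero zero_neq_numeral)
    have ext: "x = y" if "x \<in> XX" "y \<in> XX" "mx x" "mx y" "v \<in> nb u" "x v = y v" for x y v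
    proof -
      have "x \<in> extensional (nb u)" "y \<in> extensional (nb u)" using that by (auto simp: XX_def joint_def)
      moreover have "x a = y a" if "a \<in> nb u" for a
        using that \<open>mx x\<close> \<open>mx y\<close> \<open>v \<in> nb u\<close> \<open>x v = y v\<close> unfolding mx_def by metis
      ultimately show ?thesis by (rule extensionalityI) 
    qed
    have cmono3: "card {x\<in>XX. mx x} \<le> 3"
    proof -
      have "inj_on (\<lambda>x. x v0) {x\<in>XX. mx x}" by (rule inj_onI) (use ext v0 in auto)
      moreover have "(\<lambda>x. x v0) ` {x\<in>XX. mx x} \<subseteq> {..<3}" using XXopt v0 by (fastforce simp: opt_def)
      ultimately have "card {x\<in>XX. mx x} \<le> card {..<3::nat}" by (intro card_inj_on_le) auto
      then show ?thesis by simp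
    qed
    \<comment> \<open>At most \<open>d\<close> of the \<open>2 * d\<close> neighbours are free, so
      some neighbour has a forced color, and this fixes the one-colored pattern.\<close>
    have cmono1: "card {x\<in>XX. mx x} \<le> 1" if "w \<le> d"
    proof -
      have "\<exists>v\<in>nb u. \<not> free \<omega> v"
      proof (rule ccontr)
        assume "\<not> ?thesis"
        then have "{v\<in>nb u. free \<omega> v} = nb u" by auto
        then show False using card_nb[OF u] that d by (simp add: w_def free_nbs_def)
      qed
      then obtain v where v: "v \<in> nb u" "\<not> free \<omega> v" by auto
      then have "card (opt v) = 1" using copt by simp
      then obtain c where "opt v = {c}" by (auto simp: card_1_singleton_iff)
      then have "inj_on (\<lambda>x. x v) {x\<in>XX. mx x}" "(\<lambda>x. x v) ` {x\<in>XX. mx x} \<subseteq> {c}"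
        using XXopt[OF _ v(1)] by (auto intro!: inj_onI ext[OF _ _ _ _ v(1)])
      then have "card {x\<in>XX. mx x} \<le> card {c}" by (intro card_inj_on_le) auto
      then show ?thesis by simp
    qed
    have "(\<Sum>x\<in>XX. code_weight w (mx x)) \<le> 1"
    proof (cases "w = 0")
      case True
      then show ?thesis using cXX by (simp add: code_weight_def)
    next
      case False
      have "(\<Sum>x\<in>XX. code_weight w (mx x)) \<le> (\<Sum>x\<in>XX. (if mx x then code_weight w True else 0) + code_weight w False)"
        using wpos[of w False] by (intro sum_mono) (auto simp: less_imp_le)
      also have "\<dots> = card {x\<in>XX. mx x} * code_weight w True + card XX * code_weight w False"
        using fXX by (simp add: sum.distrib sum.inter_filter[symmetric])
      also have "\<dots> \<le> card {x\<in>XX. mx x} * code_weight w True + 2 ^ w * code_weight w False"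
        using cXX wpos[of w False] of_nat_mono[OF cXX, where 'a=real] by (intro add_left_mono mult_right_mono) auto
      \<comment> \<open>The bounds are 15/16 + 1/16 for \<open>w \<le> d\<close> and 3 / (3 d) + (1
        - 1/d) for larger \<open>w\<close>.\<close>
      also have "\<dots> \<le> 1"
      proof (cases "w \<le> d")
        case True
        then have "real (card {x\<in>XX. mx x}) * (15 / 16) \<le> 1 * (15 / 16)" using cmono1 by (intro mult_right_mono) auto
        then show ?thesis using True False by (simp add: code_weight_def)
      next
        case False
        then have "real (card {x\<in>XX. mx x}) * (1 / (3 * d)) \<le> 3 * (1 / (3 * d))" using cmono3 by (intro mult_right_mono) auto
        then show ?thesis using False d by (simp add: code_weight_def)
      qed
      finally show ?thesis .
    qed
    then show "(\<Sum>x\<in>joint coord (nb u) ` fibre \<Omega> (joint coord O1) \<omega>. r x (joint coord O1 \<omega>)) \<le> 1"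
      by (simp add: r_def Wy XX_def w_def)
  qed
  then show ?thesis by (simp add: r_def Wy mx)
qed

text \<open>Shearer's inequality for the neighbourhoods \<open>nb u\<close>, which cover each point
  of \<open>E\<close> \<open>d\<close> times. The main terms \<open>w * ln 2\<close> add up by
  \<open>sum_free_nbs\<close>.\<close>

lemma cond_ent_E:
  assumes fO: "finite \<Omega>" and coloring: "\<And>\<omega>. \<omega> \<in> \<Omega> \<Longrightarrow> coloring \<omega>"
    and d: "2 \<le> d" "ln (3 * real d) \<le> d * (ln 2 / 10)"
  shows "d * cond_ent \<Omega> (joint coord E) (joint coord O1) \<le> (\<Sum>\<omega>\<in>\<Omega>. d * ln 2 * num_free \<omega>
     - 9 / 10 * ln 2 * (\<Sum>u\<in>O2. of_bool (mono_nb \<omega> u) * free_nbs \<omega> u)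
     + 4 * ln 2 / d * (\<Sum>u\<in>O2. of_bool (\<not> mono_nb \<omega> u) * (2 * real d - free_nbs \<omega> u)) + 2 / d * card O2)"
proof -
  have "real d * cond_ent \<Omega> (joint coord E) (joint coord O1) \<le> (\<Sum>u\<in>O2. cond_ent \<Omega> (joint coord (nb u)) (joint coord O1))"
  proof (rule shearer[OF fO fin(1,3)])
    show "nb u \<subseteq> E" for u by (auto simp: nb_def)
    fix v assume v: "v \<in> E"
    have "n2 v ` {..<d} \<subseteq> {u\<in>O2. v \<in> nb u}" using v n2_in[OF v] mem_nb[OF v] by auto
    then have "card (n2 v ` {..<d}) \<le> card {u\<in>O2. v \<in> nb u}" using fin by (intro card_mono) auto
    then show "d \<le> card {u\<in>O2. v \<in> nb u}" by (simp add: card_image[OF n2_inj[OF v]])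
  qed
  also have "\<dots> \<le> (\<Sum>u\<in>O2. \<Sum>\<omega>\<in>\<Omega>. - ln (code_weight (free_nbs \<omega> u) (mono_nb \<omega> u)))"
    by (rule sum_mono) (rule cond_ent_nb[OF fO coloring d(1)])
  also have "\<dots> = (\<Sum>\<omega>\<in>\<Omega>. \<Sum>u\<in>O2. - ln (code_weight (free_nbs \<omega> u) (mono_nb \<omega> u)))" by (rule sum.swap)
  also have "\<dots> \<le> (\<Sum>\<omega>\<in>\<Omega>. \<Sum>u\<in>O2. ln 2 * free_nbs \<omega> u - 9 / 10 * ln 2 * (of_bool (mono_nb \<omega> u) * free_nbs \<omega> u)
     + 4 * ln 2 / d * (of_bool (\<not> mono_nb \<omega> u) * (2 * real d - free_nbs \<omega> u)) + 2 / d)"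
  proof (intro sum_mono)
    fix \<omega> u assume u: "u \<in> O2"
    have "4 * ln 2 / d * (2 * real d - free_nbs \<omega> u) \<ge> 0"
      using free_nbs_le[OF u, of \<omega>] by (intro mult_nonneg_nonneg) auto
    then show "- ln (code_weight (free_nbs \<omega> u) (mono_nb \<omega> u)) \<le> ln 2 * free_nbs \<omega> u - 9 / 10 * ln 2 * (of_bool (mono_nb \<omega> u) * free_nbs \<omega> u)
     + 4 * ln 2 / d * (of_bool (\<not> mono_nb \<omega> u) * (2 * real d - free_nbs \<omega> u)) + 2 / d"
      using code_weight_bound[OF d, of "free_nbs \<omega> u" "mono_nb \<omega> u"]
      by (cases "free_nbs \<omega> u \<le> d"; cases "mono_nb \<omega> u") (auto simp: mult_ac)
  qed
  also have "\<dots> = (\<Sum>\<omega>\<in>\<Omega>. d * ln 2 * num_free \<omega>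
     - 9 / 10 * ln 2 * (\<Sum>u\<in>O2. of_bool (mono_nb \<omega> u) * free_nbs \<omega> u)
     + 4 * ln 2 / d * (\<Sum>u\<in>O2. of_bool (\<not> mono_nb \<omega> u) * (2 * real d - free_nbs \<omega> u)) + 2 / d * card O2)"
  proof (rule sum.cong[OF refl])
    fix \<omega>
    have "(\<Sum>u\<in>O2. ln 2 * real (free_nbs \<omega> u)) = d * ln 2 * num_free \<omega>"
      by (simp add: sum_distrib_left[symmetric] sum_free_nbs)
    then show "(\<Sum>u\<in>O2. ln 2 * free_nbs \<omega> u - 9 / 10 * ln 2 * (of_bool (mono_nb \<omega> u) * free_nbs \<omega> u)
     + 4 * ln 2 / d * (of_bool (\<not> mono_nb \<omega> u) * (2 * real d - free_nbs \<omega> u)) + 2 / d) = d * ln 2 * num_free \<omega>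
     - 9 / 10 * ln 2 * (\<Sum>u\<in>O2. of_bool (mono_nb \<omega> u) * free_nbs \<omega> u)
     + 4 * ln 2 / d * (\<Sum>u\<in>O2. of_bool (\<not> mono_nb \<omega> u) * (2 * real d - free_nbs \<omega> u)) + 2 / d * card O2"
      unfolding sum.distrib sum_subtractf sum_distrib_left[symmetric] by simp
  qed
  finally show ?thesis .
qed


text \<open>The leading terms add up to \<open>ln 2\<close> for each point of \<open>E\<close>,
  whatever the number of free points. What remains is counted in bad edges, each with a factor
  \<open>ln 2 / d\<close>: an edge in \<alpha> has coefficient 1/2 - 9/10 = -2/5, an edge in \<beta>
  has -1/2. With \<open>card E / 32\<close> bad edges and \<open>ln 2 \<ge> 2 / 3\<close> the saving
  is at least \<open>card E / (120 * d)\<close>, and the overheads leave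
  \<open>card E / (200 * d)\<close> of it.\<close>

lemma card_le_if_many_bad:
  assumes fO: "finite \<Omega>" and ne: "\<Omega> \<noteq> {}" and coloring: "\<And>\<omega>. \<omega> \<in> \<Omega> \<Longrightarrow> coloring \<omega>"
    and inj: "\<And>\<omega> \<omega>'. \<omega> \<in> \<Omega> \<Longrightarrow> \<omega>' \<in> \<Omega> \<Longrightarrow> (\<And>v. v \<in> E \<union> O1 \<union> O2 \<Longrightarrow> \<omega> v = \<omega>' v) \<Longrightarrow> \<omega> = \<omega>'"
    and bad: "\<And>\<omega>. \<omega> \<in> \<Omega> \<Longrightarrow> card E / 32 \<le> num_bad \<omega>"
    and d: "1000000 \<le> d"
  shows "ln (card \<Omega>) \<le> card E * ln 2 - card E / (200 * d)"
proof -
  let ?u = "\<lambda>_::'v \<Rightarrow> nat. ()"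
  define n where "n = real (card \<Omega>)"
  define G where "G = n * card E"
  define BB where "BB = (\<Sum>\<omega>\<in>\<Omega>. num_bad \<omega>)"
  define AA where "AA = (\<Sum>\<omega>\<in>\<Omega>. num_free \<omega>)"
  define C where "C = (\<Sum>\<omega>\<in>\<Omega>. \<Sum>u\<in>O2. (of_bool (mono_nb \<omega> u) :: real))"
  define \<alpha> where "\<alpha> = (\<Sum>\<omega>\<in>\<Omega>. \<Sum>u\<in>O2. of_bool (mono_nb \<omega> u) * real (free_nbs \<omega> u))"
  define \<beta> where "\<beta> = (\<Sum>\<omega>\<in>\<Omega>. \<Sum>u\<in>O2. of_bool (\<not> mono_nb \<omega> u) * (2 * real d - free_nbs \<omega> u))"
  define H1 where "H1 = cond_ent \<Omega> (joint coord O1) ?u"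
  define H2 where "H2 = cond_ent \<Omega> (joint coord E) (joint coord O1)"
  define H3 where "H3 = cond_ent \<Omega> (joint coord O2) (joint coord E)"
  have n: "n > 0" using fO ne by (simp add: n_def card_gt_0_iff)
  have dr: "real d \<ge> 1000000" using d by simp
  have l2: "2 / 3 \<le> ln (2::real)" "ln (2::real) \<le> 25 / 36"
    using ln2_ge_two_thirds ln2_le_25_over_36 by auto
  have \<alpha>0: "\<alpha> \<ge> 0" by (auto simp: \<alpha>_def intro!: sum_nonneg)
  have "real (free_nbs \<omega> u) \<le> 2 * real d" if "u \<in> O2" for \<omega> u
    using of_nat_mono[OF free_nbs_le[OF that, of \<omega>], where 'a=real] by simp
  then have \<beta>0: "\<beta> \<ge> 0" by (auto simp: \<beta>_def intro!: sum_nonneg)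
  have G0: "G \<ge> 0" using n by (simp add: G_def)
  have BB: "BB = \<alpha> + \<beta>"
    unfolding BB_def \<alpha>_def \<beta>_def sum.distrib[symmetric] num_bad_eq by (intro sum.cong refl) auto
  have BBge: "G / 32 \<le> BB"
    using sum_mono[of \<Omega> "\<lambda>_. card E / 32" num_bad] bad by (simp add: BB_def G_def n_def)
  \<comment> \<open>Each \<open>u\<close> contributes \<open>2 * d * of_bool (mono_nb \<omega> u) +
    free_nbs \<omega> u - 2 * d\<close> to \<alpha> - \<beta>. So, up to bad edges, the one-colored
    neighbourhoods are half as many as the points of \<open>E\<close> that are not free.\<close>
  have C: "2 * d * C = \<alpha> - \<beta> + d * G - d * AA"
  proof -
    have "\<alpha> - \<beta> = (\<Sum>\<omega>\<in>\<Omega>. \<Sum>u\<in>O2. 2 * real d * of_bool (mono_nb \<omega> u) + free_nbs \<omega> u - 2 * real d)"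
      unfolding \<alpha>_def \<beta>_def sum_subtractf[symmetric] by (intro sum.cong refl) auto
    also have "\<dots> = 2 * d * C + d * AA - n * (2 * real d * card O2)"
      by (simp add: sum.distrib sum_subtractf sum_free_nbs C_def AA_def n_def sum_distrib_left)
    also have "n * (2 * real d * card O2) = d * G" using card_E by (simp add: G_def)
    finally show ?thesis by simp
  qed
  \<comment> \<open>With 1024 directions and \<open>s = 1 / 2048\<close>, the palette of
    \<open>v\<close> and the right guesses cost \<open>3 * ln 2 + 1\<close> for each
    \<open>v\<close>, shared by 1024 translates; moreover \<open>8 / s\<close> is the power
    \<open>2 ^ 14\<close>.\<close>
  obtain K where K: "K \<subseteq> {..<d}" "card K = 1024"
    "\<And>a. a \<in> K \<Longrightarrow> (\<Sum>\<omega>\<in>\<Omega>. bad_in_dir \<omega> a) \<le> 2 / d * (\<Sum>\<omega>\<in>\<Omega>. num_bad \<omega>)"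
    using good_dirs[OF fO, of 1024] d by auto
  then obtain a0 where a0: "a0 \<in> K" by fastforce
  define k where "k = real (d - 1024)"
  have k: "real d \<le> 2 * k" using d by (simp add: k_def)
  define R where "R = G * (3 * ln 2 + 1) / 1024 + 6 * (14 * ln 2) / d * BB"
  have ln8: "ln (8 / (1 / 2048)) = 14 * ln (2::real)" using ln_realpow[of 2 14] by simp
  have SA: "(\<Sum>\<omega>\<in>\<Omega>. card E - num_free \<omega>) = G - AA"
    by (simp add: sum_subtractf G_def n_def AA_def)
  have "2 * card K * (d - card K) * H1 \<le>
      card \<Omega> * card E * (3 * ln 2) + card K * card \<Omega> * card E * (2 * (1 / 2048))
      + card K * ln (8 / (1 / 2048)) * (6 / d) * (\<Sum>\<omega>\<in>\<Omega>. num_bad \<omega>)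
      + (d - card K) * card K * ln 2 * (\<Sum>\<omega>\<in>\<Omega>. card E - num_free \<omega>)"
    unfolding H1_def by (rule cond_ent_O1[OF fO coloring _ _ K(1) a0 K(3)]) auto
  moreover have "1024 * R = G * (3 * ln 2) + G + 1024 * (14 * ln 2) * (6 / d) * BB"
    by (simp add: R_def algebra_simps)
  ultimately have "2048 * k * H1 \<le> 1024 * R + 1024 * k * ln 2 * (G - AA)"
    unfolding ln8 SA BB_def[symmetric] K(2) of_nat_mult k_def[symmetric]
    by (simp add: G_def n_def algebra_simps)
  then have H1: "2 * k * (H1 - 1 / 2 * ln 2 * (G - AA)) \<le> R" by (simp add: field_simps)
  have R0: "R \<ge> 0" using G0 BB \<alpha>0 \<beta>0 by (simp add: R_def)
  \<comment> \<open>Lowering the factor \<open>2 * k\<close> to \<open>d\<close> is only valid for a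
    positive bracket; for the other sign \<open>R \<ge> 0\<close> suffices.\<close>
  have H1': "d * (H1 - 1 / 2 * ln 2 * (G - AA)) \<le> R"
  proof (cases "H1 - 1 / 2 * ln 2 * (G - AA) \<le> 0")
    case True
    then have "d * (H1 - 1 / 2 * ln 2 * (G - AA)) \<le> 0" by (rule mult_nonneg_nonpos[rotated]) simp
    then show ?thesis using R0 by simp
  next
    case False
    then have "d * (H1 - 1 / 2 * ln 2 * (G - AA)) \<le> 2 * k * (H1 - 1 / 2 * ln 2 * (G - AA))"
      using k by (intro mult_right_mono) auto
    then show ?thesis using H1 by simp
  qed
  have l3: "ln (3 * real d) \<le> d * (ln 2 / 10)"
  proof -
    have s: "sqrt (real d) \<ge> 1000"
      using real_sqrt_le_mono[OF dr] real_sqrt_unique[of 1000 1000000] by simp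
    have "ln (3 * real d) = ln 3 + 2 * ln (sqrt d)"
      using d by (simp add: ln_mult ln_sqrt)
    also have "\<dots> \<le> 2 + 2 * sqrt d"
      using ln_le_minus_one[of "3::real"] ln_le_minus_one[of "sqrt d"] s d by simp
    also have "\<dots> \<le> sqrt d * 10" using s by simp
    also have "\<dots> \<le> sqrt d * (sqrt d / 100)" using s by (intro mult_left_mono) auto
    also have "\<dots> = d * (1 / 100)" by simp
    also have "\<dots> \<le> d * (ln 2 / 10)" using l2 by (intro mult_left_mono) auto
    finally show ?thesis .
  qed
  have H2: "d * H2 \<le> d * ln 2 * AA - 9 / 10 * ln 2 * \<alpha> + 4 * ln 2 / d * \<beta> + G / d"
  proof -
    have "d * H2 \<le> (\<Sum>\<omega>\<in>\<Omega>. d * ln 2 * num_free \<omega>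
     - 9 / 10 * ln 2 * (\<Sum>u\<in>O2. of_bool (mono_nb \<omega> u) * free_nbs \<omega> u)
     + 4 * ln 2 / d * (\<Sum>u\<in>O2. of_bool (\<not> mono_nb \<omega> u) * (2 * real d - free_nbs \<omega> u)) + 2 / d * card O2)"
      unfolding H2_def by (rule cond_ent_E[OF fO coloring _ l3]) (use d in auto)
    also have "\<dots> = d * ln 2 * AA - 9 / 10 * ln 2 * \<alpha> + 4 * ln 2 / d * \<beta> + n * (2 / d * card O2)"
      unfolding sum.distrib sum_subtractf \<alpha>_def \<beta>_def AA_def n_def sum_distrib_left[symmetric] by simp
    also have "n * (2 / d * card O2) = G / d" using card_E by (simp add: G_def)
    finally show ?thesis by simp
  qed
  have H3: "H3 \<le> ln 2 * C"
    using cond_ent_O2[OF fO coloring] by (simp add: H3_def C_def sum_distrib_left mult.commute)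
  have "n * ln n = cond_ent \<Omega> (joint coord (E \<union> O1 \<union> O2)) ?u"
    unfolding n_def
    by (rule cond_ent_inj[OF fO, symmetric]) (auto intro!: inj_onI inj simp: joint_eq_iff coord_def)
  also have "\<dots> \<le> cond_ent \<Omega> (\<lambda>\<omega>. (joint coord O2 \<omega>, (joint coord E \<omega>, joint coord O1 \<omega>))) ?u"
    by (rule cond_ent_mono[OF fO]) (auto simp: joint_eq_iff)
  also have "\<dots> = H1 + cond_ent \<Omega> (joint coord E) (\<lambda>\<omega>. (joint coord O1 \<omega>, ())) + cond_ent \<Omega> (joint coord O2) (\<lambda>\<omega>. ((joint coord E \<omega>, joint coord O1 \<omega>), ()))"
    by (simp add: cond_ent_chain[OF fO] H1_def)
  also have "cond_ent \<Omega> (joint coord E) (\<lambda>\<omega>. (joint coord O1 \<omega>, ())) = H2"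
    unfolding H2_def by (rule cond_ent_cong) auto
  also have "cond_ent \<Omega> (joint coord O2) (\<lambda>\<omega>. ((joint coord E \<omega>, joint coord O1 \<omega>), ())) \<le> H3"
    unfolding H3_def by (rule cond_ent_cond_mono[OF fO]) auto
  finally have tot: "n * ln n \<le> H1 + H2 + H3" by simp
  have "d * (n * ln n) \<le> d * H1 + d * H2 + d * H3"
    using mult_left_mono[OF tot, of "real d"] by (simp add: algebra_simps)
  also have "d * H3 \<le> ln 2 * (\<alpha> - \<beta> + d * G - d * AA) / 2"
  proof -
    have "d * H3 \<le> d * (ln 2 * C)" using H3 by (intro mult_left_mono) auto
    also have "\<dots> = ln 2 * (2 * d * C) / 2" by simp
    finally show ?thesis unfolding C .
  qed
  finally have t: "d * (n * ln n) \<le> R + d * (1 / 2 * ln 2 * (G - AA))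
     + (d * ln 2 * AA - 9 / 10 * ln 2 * \<alpha> + 4 * ln 2 / d * \<beta> + G / d)
     + ln 2 * (\<alpha> - \<beta> + d * G - d * AA) / 2"
    using H1'[unfolded right_diff_distrib[of "real d" H1]] H2 by linarith
  have e: "R + d * (1 / 2 * ln 2 * (G - AA))
     + (d * ln 2 * AA - 9 / 10 * ln 2 * \<alpha> + 4 * ln 2 / d * \<beta> + G / d)
     + ln 2 * (\<alpha> - \<beta> + d * G - d * AA) / 2
     = d * ln 2 * G + R - 2 / 5 * (ln 2 * \<alpha>) - 1 / 2 * (ln 2 * \<beta>) + 4 * ln 2 / d * \<beta> + G / d"
    by argo
  have "4 * ln 2 / d * \<beta> \<le> 1 / 100000 * \<beta>"
    using \<beta>0 l2 dr by (intro mult_right_mono) (auto simp: field_simps)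
  moreover have "G / d \<le> G / 1000000" using G0 dr by (intro divide_left_mono) auto
  moreover have "R \<le> G * (31 / 10000) + 1 / 10000 * BB"
  proof -
    have "G * (3 * ln 2 + 1) / 1024 \<le> G * (31 / 10000)"
      using mult_left_mono[of "(3 * ln 2 + 1) / 1024" "31 / 10000" G] G0 l2 by simp
    moreover have "6 * (14 * ln 2) / d * BB \<le> 1 / 10000 * BB"
      using BB \<alpha>0 \<beta>0 l2 dr by (intro mult_right_mono) (auto simp: field_simps)
    ultimately show ?thesis by (simp add: R_def)
  qed
  moreover have "2 / 3 * \<alpha> \<le> ln 2 * \<alpha>" "2 / 3 * \<beta> \<le> ln 2 * \<beta>"
    by (rule mult_right_mono; fact)+
  ultimately have "d * (n * ln n) \<le> d * ln 2 * G - G / 200"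
    using t e BB BBge \<alpha>0 \<beta>0 G0 by linarith
  then have "n * (d * ln n) \<le> n * (d * ln 2 * card E - card E / 200)"
    by (simp add: G_def algebra_simps)
  then have "d * ln n \<le> d * ln 2 * card E - card E / 200"
    using n by (simp add: mult_le_cancel_left)
  then show ?thesis using d by (simp add: n_def field_simps)
qed

end

section \<open>The hypercube\<close>

definition toggle :: "nat \<Rightarrow> nat set \<Rightarrow> nat set" where
  "toggle a P = (if a \<in> P then P - {a} else insert a P)"

lemma mem_toggle [simp]: "x \<in> toggle a P \<longleftrightarrow> (x \<in> P) \<noteq> (x = a)"
  by (auto simp: toggle_def)

lemma toggle_toggle [simp]: "toggle a (toggle a P) = P"
  by (auto simp: set_eq_iff)

lemma toggle_commute: "toggle a (toggle b P) = toggle b (toggle a P)"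
  by (auto simp: set_eq_iff)

lemma toggle_sub: "a < d \<Longrightarrow> P \<subseteq> {..<d} \<Longrightarrow> toggle a P \<subseteq> {..<d}"
  by (auto simp: toggle_def)

lemma toggle_inj: "toggle a P = toggle a Q \<longleftrightarrow> P = Q"
  by (metis toggle_toggle)

lemma finite_toggle [simp]: "finite (toggle a P) \<longleftrightarrow> finite P"
  by (simp add: toggle_def)

lemma even_toggle [simp]: "finite P \<Longrightarrow> even (card (toggle a P)) \<longleftrightarrow> odd (card P)"
  by (cases "a \<in> P") (auto simp: toggle_def card_Diff_singleton card_gt_0_iff)

definition subs :: "nat \<Rightarrow> bool \<Rightarrow> nat set set" where
  "subs d b = {P. P \<subseteq> {..<d} \<and> even (card P) = b}"

lemma finite_sub: "P \<subseteq> {..<d::nat} \<Longrightarrow> finite P"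
  by (rule finite_subset) auto

lemma finite_subs: "finite (subs d b)"
  by (rule finite_subset[of _ "Pow {..<d}"]) (auto simp: subs_def)

lemma toggle_subs: "a < d \<Longrightarrow> toggle a P \<in> subs d b \<longleftrightarrow> P \<in> subs d (\<not> b)"
proof -
  assume a: "a < d"
  have "toggle a P \<subseteq> {..<d} \<longleftrightarrow> P \<subseteq> {..<d}" using toggle_sub[OF a, of P] toggle_sub[OF a, of "toggle a P"] by auto
  then show ?thesis using finite_sub[of P d] by (auto simp: subs_def)
qed

lemma toggle_bij: "a < d \<Longrightarrow> bij_betw (toggle a) (subs d (\<not> b)) (subs d b)"
  by (rule bij_betw_byWitness[where f'="toggle a"]) (auto simp: toggle_subs)

lemma Pow_eq_subs: "Pow {..<d} = subs d b \<union> subs d (\<not> b)" "subs d b \<inter> subs d (\<not> b) = {}"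
  by (auto simp: subs_def)

lemma card_subs:
  assumes "0 < d" shows "2 * card (subs d b) = 2 ^ d"
proof -
  have "card (Pow {..<d}) = card (subs d b) + card (subs d (\<not> b))"
    unfolding Pow_eq_subs(1)[of d b] by (rule card_Un_disjoint) (auto simp: finite_subs Pow_eq_subs(2))
  then show ?thesis using bij_betw_same_card[OF toggle_bij[OF assms, of b]] by (simp add: card_Pow)
qed

lemma sum_Pow_toggle:
  fixes f :: "nat set \<Rightarrow> real"
  assumes "a < d" "\<And>X. X \<subseteq> {..<d} \<Longrightarrow> f (toggle a X) = f X"
  shows "(\<Sum>X\<in>Pow {..<d}. f X) = 2 * (\<Sum>X\<in>subs d b. f X)"
proof -
  have "(\<Sum>X\<in>subs d (\<not> b). f X) = (\<Sum>X\<in>subs d (\<not> b). f (toggle a X))"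
    using assms by (intro sum.cong) (auto simp: subs_def)
  also have "\<dots> = (\<Sum>X\<in>subs d b. f X)" by (rule sum.reindex_bij_betw[OF toggle_bij[OF assms(1)]])
  finally show ?thesis
    unfolding Pow_eq_subs(1)[of d b] by (subst sum.union_disjoint) (auto simp: finite_subs Pow_eq_subs(2))
qed

section \<open>Canonical paths in the cube\<close>

definition hyb :: "nat \<Rightarrow> nat set \<Rightarrow> nat set \<Rightarrow> nat set" where
  "hyb i P P' = (P' \<inter> {..<i}) \<union> (P - {..<i})"

lemma hyb_step: "hyb (Suc i) P P' = hyb i P P' \<or> hyb (Suc i) P P' = toggle i (hyb i P P')"
proof (cases "i \<in> P \<longleftrightarrow> i \<in> P'")
  case True
  then have "hyb (Suc i) P P' = hyb i P P'" by (auto simp: hyb_def less_Suc_eq)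
  then show ?thesis by simp
next
  case False
  then have "hyb (Suc i) P P' = toggle i (hyb i P P')" by (auto simp: hyb_def less_Suc_eq set_eq_iff)
  then show ?thesis by simp
qed

text \<open>\<open>hyb i P P'\<close> runs from \<open>P\<close> to \<open>P'\<close> changing one
  coordinate at a time, and if \<open>f\<close> differs at the ends it changes on the way. A point
  of the path together with the opposite hybrid \<open>hyb i P' P\<close> recovers
  \<open>(P, P')\<close>, so at most \<open>2 ^ d\<close> pairs pass through a given point at a
  given step.\<close>

lemma cube_poincare:
  fixes f :: "nat set \<Rightarrow> bool"
  assumes Z: "Z \<subseteq> Pow {..<d}"
  shows "(\<Sum>P\<in>Z. \<Sum>P'\<in>Z. of_bool (f P \<noteq> f P')) \<le>
    2 ^ d * (\<Sum>i<d. \<Sum>X\<in>Pow {..<d}. (of_bool (f X \<noteq> f (toggle i X)) :: real))"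
proof -
  let ?g = "\<lambda>i X. of_bool (f X \<noteq> f (toggle i X)) :: real"
  let ?A = "Pow {..<d}"
  have fZ: "finite Z" using Z by (rule finite_subset) simp
  have hs: "hyb i P P' \<in> ?A" if "P \<in> Z" "P' \<in> Z" for i P P' using that Z by (auto simp: hyb_def)
  have tele: "of_bool (f P \<noteq> f P') \<le> (\<Sum>i<d. ?g i (hyb i P P'))" if PP: "P \<in> Z" "P' \<in> Z" for P P'
  proof -
    have t: "of_bool (f (hyb 0 P P') \<noteq> f (hyb k P P')) \<le> (\<Sum>i<k. ?g i (hyb i P P'))" for k
    proof (induction k)
      case (Suc k)
      have "of_bool (f (hyb 0 P P') \<noteq> f (hyb (Suc k) P P')) \<le>
        of_bool (f (hyb 0 P P') \<noteq> f (hyb k P P')) + ?g k (hyb k P P')"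
        using hyb_step[of k P P'] by auto
      then show ?case using Suc by simp
    qed simp
    have e: "hyb 0 P P' = P" "hyb d P P' = P'" using PP Z by (auto simp: hyb_def)
    show ?thesis using t[of d] unfolding e .
  qed
  have "(\<Sum>P\<in>Z. \<Sum>P'\<in>Z. of_bool (f P \<noteq> f P')) \<le> (\<Sum>P\<in>Z. \<Sum>P'\<in>Z. \<Sum>i<d. ?g i (hyb i P P'))"
    by (intro sum_mono tele)
  also have "\<dots> = (\<Sum>i<d. \<Sum>(P, P')\<in>Z \<times> Z. ?g i (hyb i P P'))"
  proof -
    have "(\<Sum>P\<in>Z. \<Sum>P'\<in>Z. \<Sum>i<d. ?g i (hyb i P P')) = (\<Sum>P\<in>Z. \<Sum>i<d. \<Sum>P'\<in>Z. ?g i (hyb i P P'))"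
      by (intro sum.cong refl sum.swap)
    also have "\<dots> = (\<Sum>i<d. \<Sum>P\<in>Z. \<Sum>P'\<in>Z. ?g i (hyb i P P'))" by (rule sum.swap)
    finally show ?thesis by (simp only: sum.cartesian_product)
  qed
  also have "\<dots> \<le> (\<Sum>i<d. 2 ^ d * (\<Sum>X\<in>?A. ?g i X))"
  proof (rule sum_mono)
    fix i
    let ?h = "\<lambda>(P, P'). (hyb i P P', hyb i P' P)"
    have inj: "inj_on ?h (Z \<times> Z)"
    proof (rule inj_onI, clarify)
      fix P P' R R' assume "hyb i P P' = hyb i R R'" "hyb i P' P = hyb i R' R"
      then show "P = R \<and> P' = R'" unfolding hyb_def by blast
    qed
    have "(\<Sum>(P, P')\<in>Z \<times> Z. ?g i (hyb i P P')) = (\<Sum>p\<in>?h ` (Z \<times> Z). ?g i (fst p))"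
      by (subst sum.reindex[OF inj]) (auto intro!: sum.cong)
    also have "\<dots> \<le> (\<Sum>p\<in>?A \<times> ?A. ?g i (fst p))"
      using hs by (intro sum_mono2) auto
    also have "\<dots> = 2 ^ d * (\<Sum>X\<in>?A. ?g i X)"
    proof -
      have "(\<Sum>p\<in>?A \<times> ?A. ?g i (fst p)) = (\<Sum>X\<in>?A. \<Sum>Y\<in>?A. ?g i X)"
        unfolding sum.cartesian_product by (rule sum.cong) auto
      then show ?thesis by (simp add: card_Pow sum_distrib_left)
    qed
    finally show "(\<Sum>(P, P')\<in>Z \<times> Z. ?g i (hyb i P P')) \<le> 2 ^ d * (\<Sum>X\<in>?A. ?g i X)" .
  qed
  finally show ?thesis by (simp add: sum_distrib_left)
qed

section \<open>The cube of dimension \<open>2 * d\<close> as a \<open>split_cube\<close>\<close>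

type_synonym vtx = "nat set \<times> nat set"

definition cE :: "nat \<Rightarrow> vtx set" where
  "cE d = subs d True \<times> subs d True \<union> subs d False \<times> subs d False"
definition cO1 :: "nat \<Rightarrow> vtx set" where "cO1 d = subs d False \<times> subs d True"
definition cO2 :: "nat \<Rightarrow> vtx set" where "cO2 d = subs d True \<times> subs d False"

text \<open>In the two halves of \<open>E\<close>, both sets even or both odd, the components play
  opposite roles: \<open>O1\<close> is reached by toggling the first one in the even half and the
  second one in the odd half.\<close>

definition cn1 :: "vtx \<Rightarrow> nat \<Rightarrow> vtx" where
  "cn1 v a = (if even (card (fst v)) then (toggle a (fst v), snd v) else (fst v, toggle a (snd v)))"
definition cn2 :: "vtx \<Rightarrow> nat \<Rightarrow> vtx" where
  "cn2 v a = (if even (card (fst v)) then (fst v, toggle a (snd v)) else (toggle a (fst v), snd v))"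
definition csh :: "vtx \<Rightarrow> nat \<Rightarrow> nat \<Rightarrow> vtx" where
  "csh v a b = (if even (card (fst v)) then (toggle a (toggle b (fst v)), snd v) else (fst v, toggle a (toggle b (snd v))))"
definition cxx :: "vtx \<Rightarrow> nat \<Rightarrow> nat \<Rightarrow> vtx" where
  "cxx v j a = (if even (card (fst v)) then (toggle a (fst v), toggle j (snd v)) else (toggle j (fst v), toggle a (snd v)))"

lemma subs_even: "P \<in> subs d b \<Longrightarrow> even (card P) \<longleftrightarrow> b"
  by (simp add: subs_def)

lemma subs_finite: "P \<in> subs d b \<Longrightarrow> finite P"
  by (auto simp: subs_def intro: finite_sub)

lemma split_cube_cube:
  assumes d: "0 < d"
  shows "split_cube (cE d) (cO1 d) (cO2 d) d cn1 cn2 csh cxx"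
proof
  show "finite (cE d)" "finite (cO1 d)" "finite (cO2 d)"
    by (auto simp: cE_def cO1_def cO2_def finite_subs)
  show "0 < d" by fact
  show "cn1 v a \<in> cO1 d" if "v \<in> cE d" "a < d" for v a
    using that by (auto simp: cE_def cO1_def cn1_def subs_even toggle_subs)
  show "cn2 v a \<in> cO2 d" if "v \<in> cE d" "a < d" for v a
    using that by (auto simp: cE_def cO2_def cn2_def subs_even toggle_subs)
  have ti: "toggle a P = toggle b P \<Longrightarrow> a = b" for a b P
    by (metis mem_toggle)
  show "inj_on (cn2 v) {..<d}" if "v \<in> cE d" for v
    by (rule inj_onI) (auto simp: cn2_def dest: ti split: if_splits)
  show "card {v \<in> cE d. \<exists>a<d. cn2 v a = u} = 2 * d" if u: "u \<in> cO2 d" for u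
  proof -
    obtain P Q where PQ: "u = (P, Q)" "P \<in> subs d True" "Q \<in> subs d False" using u by (auto simp: cO2_def)
    have "{v \<in> cE d. \<exists>a<d. cn2 v a = u} = (\<lambda>a. (P, toggle a Q)) ` {..<d} \<union> (\<lambda>a. (toggle a P, Q)) ` {..<d}"
    proof (intro equalityI subsetI)
      fix v assume "v \<in> {v \<in> cE d. \<exists>a<d. cn2 v a = u}"
      then obtain a where a: "v \<in> cE d" "a < d" "cn2 v a = u" by auto
      then have "v = (P, toggle a Q) \<or> v = (toggle a P, Q)"
        by (cases v) (auto simp: cn2_def PQ split: if_splits)
      then show "v \<in> (\<lambda>a. (P, toggle a Q)) ` {..<d} \<union> (\<lambda>a. (toggle a P, Q)) ` {..<d}" using a by auto
    next
      fix v assume "v \<in> (\<lambda>a. (P, toggle a Q)) ` {..<d} \<union> (\<lambda>a. (toggle a P, Q)) ` {..<d}"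
      then obtain a where a: "a < d" "v = (P, toggle a Q) \<or> v = (toggle a P, Q)" by auto
      then have "v \<in> cE d" using PQ by (auto simp: cE_def toggle_subs)
      moreover have "cn2 v a = u"
        using a PQ subs_even[OF PQ(2)] subs_finite[OF PQ(2)] by (auto simp: cn2_def)
      ultimately show "v \<in> {v \<in> cE d. \<exists>a<d. cn2 v a = u}" using a by auto
    qed
    moreover have "card ((\<lambda>a. (P, toggle a Q)) ` {..<d}) = d"
      by (subst card_image) (auto intro!: inj_onI dest: ti)
    moreover have "card ((\<lambda>a. (toggle a P, Q)) ` {..<d}) = d"
      by (subst card_image) (auto intro!: inj_onI dest: ti)
    moreover have "(\<lambda>a. (P, toggle a Q)) ` {..<d} \<inter> (\<lambda>a. (toggle a P, Q)) ` {..<d} = {}"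
      by (auto simp: set_eq_iff)
    ultimately show ?thesis by (simp add: card_Un_disjoint)
  qed
  show "bij_betw (\<lambda>v. csh v a b) (cE d) (cE d)" if "a < d" "b < d" for a b
    by (rule bij_betw_byWitness[where f'="\<lambda>v. csh v a b"])
      (use that in \<open>auto simp: cE_def csh_def subs_even subs_finite toggle_subs toggle_commute[of b a]\<close>)
  show "cn1 (csh v a b) a = cn1 v b" if "v \<in> cE d" "a < d" "b < d" for v a b
    using that by (auto simp: cE_def csh_def cn1_def subs_even subs_finite)
  show "cn2 (cxx v j a) a = cn2 v j" if "v \<in> cE d" "j < d" "a < d" for v j a
    using that by (auto simp: cE_def cxx_def cn2_def subs_even subs_finite)
  show "cn2 (cxx v j a) b = cn2 (csh v a b) j" if "v \<in> cE d" "j < d" "a < d" "b < d" for v j a b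
    using that by (auto simp: cE_def cxx_def csh_def cn2_def subs_even subs_finite toggle_commute)
  \<comment> \<open>\<open>cxx\<close> leads into the other half of \<open>E\<close>, where the
    components exchange roles; this swaps \<open>a\<close> and \<open>j\<close> in the
    inverse.\<close>
  show "bij_betw (\<lambda>v. cxx v j a) (cE d) (cE d)" if "a < d" "j < d" for a j
    by (rule bij_betw_byWitness[where f'="\<lambda>v. cxx v a j"])
      (use that in \<open>auto simp: cE_def cxx_def subs_even subs_finite toggle_subs\<close>)
  show "2 * card K * (d - card K) \<le> card {v \<in> cE d. u \<in> (\<lambda>(b, a). cn1 (csh v a0 b) a) ` (K \<times> ({..<d} - K))}"
    if u: "u \<in> cO1 d" and K: "K \<subseteq> {..<d}" "a0 \<in> K" for u K a0
  proof -
    obtain P Q where PQ: "u = (P, Q)" "P \<in> subs d False" "Q \<in> subs d True" using u by (auto simp: cO1_def)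
    define D where "D = {..<d} - K"
    have fK: "finite K" "finite D" using K by (auto simp: D_def intro: finite_subset)
    have cD: "card D = d - card K" using K fK by (simp add: D_def card_Diff_subset)
    let ?t = "\<lambda>b a R. toggle a (toggle a0 (toggle b R))"
    \<comment> \<open>Undoing the three toggles on \<open>P\<close> or on \<open>Q\<close> gives
      base points in either half of \<open>E\<close>; the choice \<open>c\<close> accounts for the
      factor 2 in the multiplicity.\<close>
    let ?\<phi> = "\<lambda>(c, b, a). if c then (?t b a P, Q) else (P, ?t b a Q)"
    \<comment> \<open>Since \<open>a0\<close> and \<open>b\<close> lie in \<open>K\<close>,
      \<open>a\<close> is the only element outside \<open>K\<close> that is toggled. It can be read
      off first, and then \<open>b\<close>.\<close>
    have tinj: "b = b' \<and> a = a'" if "?t b a R = ?t b' a' R" "b \<in> K" "b' \<in> K" "a \<in> D" "a' \<in> D" for a b a' b' R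
    proof -
      have "a \<in> ?t b a R \<longleftrightarrow> a \<in> ?t b' a' R" using that by simp
      moreover have "a \<noteq> a0" "a \<noteq> b" "a \<noteq> b'" using that K by (auto simp: D_def)
      ultimately have "a = a'" by auto
      then show ?thesis using that by (auto simp: toggle_inj dest: ti)
    qed
    have PQe: "odd (card P)" "even (card Q)" "finite P" "finite Q"
      using PQ by (auto simp: subs_even subs_finite)
    have "inj_on ?\<phi> (UNIV \<times> K \<times> D)"
    proof (rule inj_onI)
      fix p p' assume "p \<in> (UNIV :: bool set) \<times> K \<times> D" "p' \<in> (UNIV :: bool set) \<times> K \<times> D"
        and e: "?\<phi> p = ?\<phi> p'"
      then obtain c b a c' b' a' where p: "p = (c, b, a)" "p' = (c', b', a')"
        and H: "b \<in> K" "a \<in> D" "b' \<in> K" "a' \<in> D" by auto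
      have ev: "even (card (?t b a P))" "even (card (?t b' a' P))" using PQe by auto
      have ne: "?t b a P \<noteq> P" "?t b' a' P \<noteq> P" using ev PQe(1) by metis+
      have cc: "c = c'" using e ne by (cases c; cases c') (auto simp: p)
      have "?t b a P = ?t b' a' P \<or> ?t b a Q = ?t b' a' Q"
        using e by (cases c) (auto simp: p cc)
      then show "p = p'" using tinj H by (auto simp: p cc)
    qed
    then have card_im: "card (?\<phi> ` (UNIV \<times> K \<times> D)) = 2 * card K * card D"
      by (simp add: card_image card_cartesian_product)
    have im: "?\<phi> ` (UNIV \<times> K \<times> D) \<subseteq> {v \<in> cE d. u \<in> (\<lambda>(b, a). cn1 (csh v a0 b) a) ` (K \<times> D)}"
    proof (rule image_subsetI)
      fix p assume "p \<in> (UNIV :: bool set) \<times> K \<times> D"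
      then obtain c b a where p: "p = (c, b, a)" and H: "b \<in> K" "a \<in> D" by auto
      have l: "b < d" "a < d" "a0 < d" using H K by (auto simp: D_def)
      let ?v = "if c then (?t b a P, Q) else (P, ?t b a Q)"
      have v: "?v \<in> cE d" using PQ l by (cases c) (auto simp: cE_def toggle_subs)
      have cc: "toggle a0 (toggle b (?t b a R)) = toggle a R" for R by (auto simp: set_eq_iff)
      have "cn1 (csh ?v a0 b) a = u"
      proof (cases c)
        case True
        then show ?thesis using PQ PQe cc[of P] by (simp add: csh_def cn1_def)
      next
        case False
        then show ?thesis using PQ PQe cc[of Q] by (simp add: csh_def cn1_def)
      qed
      then have "?v \<in> {v \<in> cE d. u \<in> (\<lambda>(b, a). cn1 (csh v a0 b) a) ` (K \<times> D)}"
        using v H by (auto intro!: image_eqI[of _ _ "(b, a)"])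
      then show "?\<phi> p \<in> {v \<in> cE d. u \<in> (\<lambda>(b, a). cn1 (csh v a0 b) a) ` (K \<times> D)}"
        by (simp add: p)
    qed
    have fin_im: "finite {v \<in> cE d. u \<in> (\<lambda>(b, a). cn1 (csh v a0 b) a) ` (K \<times> D)}"
      by (simp add: cE_def finite_subs)
    show ?thesis using card_mono[OF fin_im im, unfolded card_im cD] unfolding D_def .
  qed
qed

text \<open>The left side counts the ordered pairs in \<open>O2\<close> separated by
  \<open>F\<close>. A pair \<open>(P, Q)\<close>, \<open>(P', Q')\<close> is joined through
  \<open>(P', Q)\<close>, again in \<open>O2\<close>. While one component moves, the other keeps its
  parity, so all edges used join \<open>E\<close> to \<open>O2\<close>, and each can be counted at
  its end in \<open>E\<close>.\<close>

lemma split_poincare: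
  fixes F :: "vtx \<Rightarrow> bool" and w :: real
  assumes d: "0 < d"
  defines "w \<equiv> real (card {u\<in>cO2 d. F u})"
  shows "2 * w * (card (cO2 d) - w) \<le> 2 ^ (2 * d) * (\<Sum>v\<in>cE d. \<Sum>a<d. of_bool (F v \<noteq> F (cn2 v a)))"
proof -
  define X where "X = subs d True"
  define Y where "Y = subs d False"
  have fin: "finite X" "finite Y" by (auto simp: X_def Y_def finite_subs)
  have sub: "X \<subseteq> Pow {..<d}" "Y \<subseteq> Pow {..<d}" by (auto simp: X_def Y_def subs_def)
  have c: "2 * real (card X) = 2 ^ d" "2 * real (card Y) = 2 ^ d"
    using of_nat_eq_iff[where 'a=real, THEN iffD2, OF card_subs[OF d, of True]]
      of_nat_eq_iff[where 'a=real, THEN iffD2, OF card_subs[OF d, of False]] by (auto simp: X_def Y_def)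
  have O2: "cO2 d = X \<times> Y" by (simp add: cO2_def X_def Y_def)
  define f where "f u = (of_bool (F u) :: real)" for u
  have sf: "(\<Sum>u\<in>cO2 d. f u) = w"
    using fin by (simp add: f_def w_def O2 of_bool_def sum.inter_filter[symmetric])
  have sfn: "(\<Sum>u\<in>cO2 d. f u * real (card (cO2 d))) = w * card (cO2 d)"
    by (simp add: sum_distrib_right[symmetric] sf)
  have "2 * w * (card (cO2 d) - w) = (\<Sum>u\<in>cO2 d. \<Sum>u'\<in>cO2 d. f u + f u' - 2 * f u * f u')"
    unfolding sum_subtractf sum.distrib sum_distrib_left[symmetric] sum_distrib_right[symmetric] sf
    by (simp add: sf sfn algebra_simps sum_distrib_left[symmetric])
  also have "\<dots> = (\<Sum>u\<in>cO2 d. \<Sum>u'\<in>cO2 d. of_bool (F u \<noteq> F u'))"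
    by (intro sum.cong refl) (auto simp: f_def)
  also have "\<dots> = (\<Sum>P\<in>X. \<Sum>Q\<in>Y. \<Sum>P'\<in>X. \<Sum>Q'\<in>Y. of_bool (F (P, Q) \<noteq> F (P', Q')))"
    unfolding O2 by (simp only: sum.cartesian_product')
  also have "\<dots> \<le> (\<Sum>P\<in>X. \<Sum>Q\<in>Y. \<Sum>P'\<in>X. \<Sum>Q'\<in>Y. of_bool (F (P, Q) \<noteq> F (P', Q)) + of_bool (F (P', Q) \<noteq> F (P', Q')))"
    by (intro sum_mono) auto
  also have "\<dots> = real (card Y) * (\<Sum>Q\<in>Y. \<Sum>P\<in>X. \<Sum>P'\<in>X. of_bool (F (P, Q) \<noteq> F (P', Q)))
      + real (card X) * (\<Sum>P'\<in>X. \<Sum>Q\<in>Y. \<Sum>Q'\<in>Y. of_bool (F (P', Q) \<noteq> F (P', Q')))"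
  proof -
    have "(\<Sum>P\<in>X. \<Sum>Q\<in>Y. \<Sum>P'\<in>X. \<Sum>Q'\<in>Y. q P Q P') = real (card Y) * (\<Sum>Q\<in>Y. \<Sum>P\<in>X. \<Sum>P'\<in>X. q P Q P')"
      for q :: "nat set \<Rightarrow> nat set \<Rightarrow> nat set \<Rightarrow> real"
      by (subst sum.swap) (simp add: sum_distrib_left)
    moreover have "(\<Sum>P\<in>X. \<Sum>Q\<in>Y. \<Sum>P'\<in>X. \<Sum>Q'\<in>Y. q P' Q Q') = real (card X) * (\<Sum>P'\<in>X. \<Sum>Q\<in>Y. \<Sum>Q'\<in>Y. q P' Q Q')"
      for q :: "nat set \<Rightarrow> nat set \<Rightarrow> nat set \<Rightarrow> real"
      by (subst sum.swap[of _ X Y]) simp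
    ultimately show ?thesis by (simp only: sum.distrib)
  qed
  also have "\<dots> \<le> real (card Y) * (\<Sum>Q\<in>Y. 2 ^ d * (\<Sum>i<d. \<Sum>P\<in>Pow {..<d}. of_bool (F (P, Q) \<noteq> F (toggle i P, Q))))
      + real (card X) * (\<Sum>P\<in>X. 2 ^ d * (\<Sum>i<d. \<Sum>Q\<in>Pow {..<d}. of_bool (F (P, Q) \<noteq> F (P, toggle i Q))))"
    using cube_poincare[OF sub(1), of "\<lambda>P. F (P, _)"] cube_poincare[OF sub(2), of "\<lambda>Q. F (_, Q)"]
    by (intro add_mono mult_left_mono sum_mono) auto
  also have "\<dots> = real (card Y) * (\<Sum>Q\<in>Y. 2 ^ d * (\<Sum>i<d. 2 * (\<Sum>P\<in>Y. of_bool (F (P, Q) \<noteq> F (toggle i P, Q)))))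
      + real (card X) * (\<Sum>P\<in>X. 2 ^ d * (\<Sum>i<d. 2 * (\<Sum>Q\<in>X. of_bool (F (P, Q) \<noteq> F (P, toggle i Q)))))"
    unfolding X_def Y_def
    by (intro arg_cong2[where f="(+)"] arg_cong2[where f="(*)"] refl sum.cong sum_Pow_toggle) auto
  also have "\<dots> = 2 ^ d * ((2 * real (card Y)) * (\<Sum>Q\<in>Y. \<Sum>i<d. \<Sum>P\<in>Y. of_bool (F (P, Q) \<noteq> F (toggle i P, Q)))
      + (2 * real (card X)) * (\<Sum>P\<in>X. \<Sum>i<d. \<Sum>Q\<in>X. of_bool (F (P, Q) \<noteq> F (P, toggle i Q))))"
    by (simp add: sum_distrib_left[symmetric] algebra_simps)
  also have "\<dots> = 2 ^ (2 * d) * ((\<Sum>Q\<in>Y. \<Sum>i<d. \<Sum>P\<in>Y. of_bool (F (P, Q) \<noteq> F (toggle i P, Q)))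
      + (\<Sum>P\<in>X. \<Sum>i<d. \<Sum>Q\<in>X. of_bool (F (P, Q) \<noteq> F (P, toggle i Q))))"
  proof -
    have p: "(2::real) ^ (2 * d) = 2 ^ d * 2 ^ d" by (simp add: mult_2 power_add)
    show ?thesis unfolding c p by (simp add: algebra_simps)
  qed
  also have "(\<Sum>Q\<in>Y. \<Sum>i<d. \<Sum>P\<in>Y. of_bool (F (P, Q) \<noteq> F (toggle i P, Q)))
      = (\<Sum>v\<in>Y \<times> Y. \<Sum>i<d. of_bool (F v \<noteq> F (cn2 v i)) :: real)"
  proof -
    have "(\<Sum>Q\<in>Y. \<Sum>i<d. \<Sum>P\<in>Y. of_bool (F (P, Q) \<noteq> F (toggle i P, Q))) = (\<Sum>Q\<in>Y. \<Sum>P\<in>Y. \<Sum>i<d. (of_bool (F (P, Q) \<noteq> F (toggle i P, Q)) :: real))"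
      by (intro sum.cong refl sum.swap)
    also have "\<dots> = (\<Sum>P\<in>Y. \<Sum>Q\<in>Y. \<Sum>i<d. of_bool (F (P, Q) \<noteq> F (toggle i P, Q)))" by (rule sum.swap)
    also have "\<dots> = (\<Sum>v\<in>Y \<times> Y. \<Sum>i<d. of_bool (F v \<noteq> F (cn2 v i)))"
      unfolding sum.cartesian_product' by (intro sum.cong refl) (auto simp: cn2_def Y_def subs_even)
    finally show ?thesis .
  qed
  also have "(\<Sum>P\<in>X. \<Sum>i<d. \<Sum>Q\<in>X. of_bool (F (P, Q) \<noteq> F (P, toggle i Q)))
      = (\<Sum>v\<in>X \<times> X. \<Sum>i<d. of_bool (F v \<noteq> F (cn2 v i)) :: real)"
  proof -
    have "(\<Sum>P\<in>X. \<Sum>i<d. \<Sum>Q\<in>X. of_bool (F (P, Q) \<noteq> F (P, toggle i Q))) = (\<Sum>P\<in>X. \<Sum>Q\<in>X. \<Sum>i<d. (of_bool (F (P, Q) \<noteq> F (P, toggle i Q)) :: real))"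
      by (intro sum.cong refl sum.swap)
    also have "\<dots> = (\<Sum>v\<in>X \<times> X. \<Sum>i<d. of_bool (F v \<noteq> F (cn2 v i)))"
      unfolding sum.cartesian_product' by (intro sum.cong refl) (auto simp: cn2_def X_def subs_even)
    finally show ?thesis .
  qed
  also have "(\<Sum>v\<in>Y \<times> Y. \<Sum>i<d. of_bool (F v \<noteq> F (cn2 v i))) + (\<Sum>v\<in>X \<times> X. \<Sum>i<d. of_bool (F v \<noteq> F (cn2 v i)))
      = (\<Sum>v\<in>cE d. \<Sum>i<d. of_bool (F v \<noteq> F (cn2 v i)) :: real)"
    unfolding cE_def X_def Y_def
    by (subst sum.union_disjoint) (auto simp: finite_subs subs_def)
  finally show ?thesis by simp
qed

lemma card_cO2: "0 < d \<Longrightarrow> 4 * real (card (cO2 d)) = 2 ^ (2 * d)"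
proof -
  assume d: "0 < d"
  have "4 * card (cO2 d) = (2 * card (subs d True)) * (2 * card (subs d False))"
    by (simp add: cO2_def card_cartesian_product)
  also have "\<dots> = 2 ^ (2 * d)" unfolding card_subs[OF d] by (simp add: power_add mult_2)
  finally have "real (4 * card (cO2 d)) = real (2 ^ (2 * d))" by (simp only:)
  then show ?thesis by simp
qed

section \<open>Bad edges at the boundary of a phase\<close>

context split_cube begin

definition cnt :: "nat \<Rightarrow> ('v \<Rightarrow> nat) \<Rightarrow> nat" where
  "cnt c \<omega> = card {u\<in>O2. \<forall>v\<in>nb u. \<omega> v = c}"

text \<open>\<open>F\<close> marks the region locked into color \<open>c\<close>. If it holds at
  exactly one end of the edge, then \<open>v\<close> has color \<open>c\<close> in either case; so
  at \<open>u\<close> it amounts to \<open>mono_nb\<close> and at \<open>v\<close> to not being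
  free.\<close>

lemma boundary_bad:
  fixes c :: nat
  assumes "coloring \<omega>" "v \<in> E" "a < d"
  defines "F \<equiv> \<lambda>x. if x \<in> O2 then \<forall>v\<in>nb x. \<omega> v = c else \<not> free \<omega> x \<and> \<omega> x = c"
  assumes "E \<inter> O2 = {}" "F v \<noteq> F (n2 v a)"
  shows "bad \<omega> v a"
proof -
  define u where "u = n2 v a"
  have u: "u \<in> O2" "v \<in> nb u" using assms n2_in mem_nb by (auto simp: u_def)
  have v: "v \<notin> O2" using assms by auto
  have "\<omega> v = c" using assms u v by (auto simp: F_def u_def[symmetric])
  moreover have "F u \<longleftrightarrow> (\<forall>v\<in>nb u. \<omega> v = c)" "F v \<longleftrightarrow> \<not> free \<omega> v \<and> \<omega> v = c"
    using u v by (auto simp: F_def)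
  moreover have "mono_nb \<omega> u \<longleftrightarrow> (\<forall>v\<in>nb u. \<omega> v = c)"
    using u \<open>\<omega> v = c\<close> by (auto simp: mono_nb_def)
  ultimately show ?thesis using assms(6) by (auto simp: bad_def u_def[symmetric])
qed

end

text \<open>For a count \<open>k\<close> between \<open>N / 4\<close> and \<open>3 / 4 * N\<close>
  the product \<open>k * (N - k)\<close> is at least 3/16 of the square of \<open>N\<close>. As
  \<open>2 ^ (2 * d) = 4 * N\<close>, there are at least \<open>3 / 32 * N\<close> bad edges, and
  \<open>card (cE d) = 2 * N\<close>.\<close>

lemma cube_bad:
  fixes N :: real
  assumes d: "0 < d"
  defines "N \<equiv> real (card (cO2 d))"
  assumes coloring: "split_cube.coloring (cE d) (cO1 d) (cO2 d) d cn1 cn2 \<omega>"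
    and w: "N / 4 \<le> real (split_cube.cnt (cE d) (cO2 d) d cn2 c \<omega>)" "real (split_cube.cnt (cE d) (cO2 d) d cn2 c \<omega>) \<le> 3 / 4 * N"
  shows "card (cE d) / 32 \<le> split_cube.num_bad (cE d) d cn1 cn2 \<omega>"
proof -
  interpret split_cube "cE d" "cO1 d" "cO2 d" d cn1 cn2 csh cxx by (rule split_cube_cube[OF d])
  define F where "F = (\<lambda>x. if x \<in> cO2 d then \<forall>v\<in>nb x. \<omega> v = c else \<not> free \<omega> x \<and> \<omega> x = c)"
  define k where "k = real (cnt c \<omega>)"
  have k: "N / 4 \<le> k" "k \<le> 3 / 4 * N" using w by (auto simp: k_def)
  have N: "4 * N = 2 ^ (2 * d)" using card_cO2[OF d] by (simp add: N_def)
  have N0: "N > 0" using N by (metis mult_pos_pos zero_less_mult_pos zero_less_numeral zero_less_power)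
  have "{u\<in>cO2 d. F u} = {u\<in>cO2 d. \<forall>v\<in>nb u. \<omega> v = c}" by (auto simp: F_def)
  then have "2 * k * (N - k) \<le> 2 ^ (2 * d) * (\<Sum>v\<in>cE d. \<Sum>a<d. of_bool (F v \<noteq> F (cn2 v a)))"
    using split_poincare[OF d, of F] by (simp add: k_def cnt_def N_def)
  also have "(\<Sum>v\<in>cE d. \<Sum>a<d. of_bool (F v \<noteq> F (cn2 v a))) \<le> num_bad \<omega>"
  proof -
    have disj: "cE d \<inter> cO2 d = {}" by (auto simp: cE_def cO2_def subs_def)
    have "(\<Sum>v\<in>cE d. \<Sum>a<d. of_bool (F v \<noteq> F (cn2 v a))) \<le> (\<Sum>v\<in>cE d. \<Sum>a<d. of_bool (bad \<omega> v a) :: real)"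
      using boundary_bad[OF coloring _ _ disj, of _ _ c] by (intro sum_mono) (auto simp: F_def)
    also have "\<dots> = num_bad \<omega>" unfolding num_bad_def bad_in_dir_def by (rule sum.swap)
    finally show ?thesis .
  qed
  finally have 1: "2 * k * (N - k) \<le> 4 * N * num_bad \<omega>" by (simp add: N)
  have "(k - N / 4) * (3 / 4 * N - k) \<ge> 0" using k by (intro mult_nonneg_nonneg) auto
  moreover have "k * (N - k) - 3 / 16 * N * N = (k - N / 4) * (3 / 4 * N - k)" by (simp add: field_simps)
  ultimately have "3 / 16 * N * N \<le> k * (N - k)" by linarith
  then have "N * (3 / 8 * N) \<le> N * (4 * num_bad \<omega>)" using 1 by (simp add: algebra_simps)
  then have "3 / 8 * N \<le> 4 * num_bad \<omega>" using N0 by simp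
  then show ?thesis using card_E N0 by (simp add: N_def)
qed

section \<open>The torus of side four\<close>

context split_cube begin

lemma cnt_upd: "cnt c \<sigma> \<le> cnt c (\<sigma>(v0 := j)) + d"
proof -
  have "{u\<in>O2. \<forall>v\<in>nb u. \<sigma> v = c} \<subseteq> {u\<in>O2. \<forall>v\<in>nb u. (\<sigma>(v0 := j)) v = c} \<union> n2 v0 ` {..<d}"
    by (auto simp: nb_def)
  then have "cnt c \<sigma> \<le> card ({u\<in>O2. \<forall>v\<in>nb u. (\<sigma>(v0 := j)) v = c} \<union> n2 v0 ` {..<d})"
    unfolding cnt_def using fin by (intro card_mono) auto
  also have "\<dots> \<le> cnt c (\<sigma>(v0 := j)) + card (n2 v0 ` {..<d})"
    unfolding cnt_def by (rule card_Un_le)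
  also have "card (n2 v0 ` {..<d}) \<le> d" using card_image_le[of "{..<d}" "n2 v0"] by simp
  finally show ?thesis by linarith
qed

lemma cnt_disjoint: "c \<noteq> c' \<Longrightarrow> cnt c \<omega> + cnt c' \<omega> \<le> card O2"
proof -
  assume c: "c \<noteq> c'"
  have ne: "nb u \<noteq> {}" if "u \<in> O2" for u using card_nb[OF that] d0 by auto
  have "cnt c \<omega> + cnt c' \<omega> = card ({u\<in>O2. \<forall>v\<in>nb u. \<omega> v = c} \<union> {u\<in>O2. \<forall>v\<in>nb u. \<omega> v = c'})"
    unfolding cnt_def using fin c ne by (intro card_Un_disjoint[symmetric]) fastforce+
  also have "\<dots> \<le> card O2" using fin by (intro card_mono) auto
  finally show ?thesis .
qed

end

text \<open>The Gray code that turns the 4-cycle into a square: neighbours mod 4 differ in exactly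
  one of the bits \<open>p\<close> and \<open>q\<close>.\<close>

definition gray :: "bool \<Rightarrow> bool \<Rightarrow> nat" where
  "gray p q = (if p then (if q then 2 else 1) else (if q then 3 else 0))"

definition enc :: "nat \<Rightarrow> vtx \<Rightarrow> nat \<Rightarrow> nat" where
  "enc d v = (\<lambda>i\<in>{..<d}. gray (i \<in> fst v) (i \<in> snd v))"

definition dec :: "nat \<Rightarrow> (nat \<Rightarrow> nat) \<Rightarrow> vtx" where
  "dec d x = ({i. i < d \<and> (x i = 1 \<or> x i = 2)}, {i. i < d \<and> (x i = 2 \<or> x i = 3)})"

definition cV :: "nat \<Rightarrow> vtx set" where "cV d = Pow {..<d} \<times> Pow {..<d}"

lemma cV_eq: "cV d = cE d \<union> cO1 d \<union> cO2 d"
  by (auto simp: cV_def cE_def cO1_def cO2_def subs_def)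

lemma enc_torus: "enc d v \<in> torus 4 d"
  by (auto simp: enc_def torus_def gray_def)

lemma dec_cV: "dec d x \<in> cV d"
  by (auto simp: dec_def cV_def)

lemma dec_enc: "v \<in> cV d \<Longrightarrow> dec d (enc d v) = v"
  by (cases v) (auto simp: dec_def enc_def gray_def cV_def split: if_splits)

lemma enc_dec: "x \<in> torus 4 d \<Longrightarrow> enc d (dec d x) = x"
proof
  fix i assume x: "x \<in> torus 4 d"
  show "enc d (dec d x) i = x i"
  proof (cases "i < d")
    case True
    then have "x i < 4" using x by (auto simp: torus_def)
    then have "x i = 0 \<or> x i = 1 \<or> x i = 2 \<or> x i = 3" by linarith
    then show ?thesis using True by (auto simp: enc_def dec_def gray_def)
  next
    case False
    then show ?thesis using x by (auto simp: enc_def torus_def PiE_def extensional_def)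
  qed
qed

lemma enc_adj:
  assumes "i < d"
  shows "torus_adj 4 d (enc d (P, Q)) (enc d (toggle i P, Q))" "torus_adj 4 d (enc d (P, Q)) (enc d (P, toggle i Q))"
proof -
  show "torus_adj 4 d (enc d (P, Q)) (enc d (toggle i P, Q))"
    unfolding torus_adj_def using assms
    by (intro exI[of _ i]) (auto simp: enc_def gray_def)
  show "torus_adj 4 d (enc d (P, Q)) (enc d (P, toggle i Q))"
    unfolding torus_adj_def using assms
    by (intro exI[of _ i]) (auto simp: enc_def gray_def)
qed

text \<open>An edge of the torus flips one bit of the Gray code, so the even vertices are one side
  of a bipartition. This makes the colorings built in \<open>card_phase_ge\<close> proper.\<close>

lemma adj_dec:
  assumes "x \<in> torus 4 d" "y \<in> torus 4 d" "torus_adj 4 d x y"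
  shows "dec d x \<in> cE d \<longleftrightarrow> dec d y \<notin> cE d"
proof -
  obtain i where i: "i < d" "\<forall>j<d. j \<noteq> i \<longrightarrow> x j = y j"
    and a: "y i mod 4 = (x i + 1) mod 4 \<or> x i mod 4 = (y i + 1) mod 4"
    using assms(3) by (auto simp: torus_adj_def)
  have "x i < 4" "y i < 4" using assms(1,2) i by (auto simp: torus_def)
  then have "x i = 0 \<or> x i = 1 \<or> x i = 2 \<or> x i = 3" "y i = 0 \<or> y i = 1 \<or> y i = 2 \<or> y i = 3"
    by linarith+
  then have c: "(x i, y i) \<in> {(0,1),(1,2),(2,3),(3,0),(1,0),(2,1),(3,2),(0,3)}"
    using a by (elim disjE) simp_all
  have o: "j < d \<Longrightarrow> j \<noteq> i \<Longrightarrow> x j = y j" for j using i by auto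
  have "(fst (dec d y) = toggle i (fst (dec d x)) \<and> snd (dec d y) = snd (dec d x)) \<or>
        (fst (dec d y) = fst (dec d x) \<and> snd (dec d y) = toggle i (snd (dec d x)))"
  proof -
    have "((i \<in> fst (dec d y)) \<noteq> (i \<in> fst (dec d x)) \<and> (i \<in> snd (dec d y) \<longleftrightarrow> i \<in> snd (dec d x))) \<or>
      ((i \<in> fst (dec d y)) = (i \<in> fst (dec d x)) \<and> (i \<in> snd (dec d y)) \<noteq> (i \<in> snd (dec d x)))"
      using c i(1) by (auto simp: dec_def)
    moreover have "j \<in> fst (dec d y) \<longleftrightarrow> j \<in> fst (dec d x)" "j \<in> snd (dec d y) \<longleftrightarrow> j \<in> snd (dec d x)" if "j \<noteq> i" for j
      using o[of j] that by (auto simp: dec_def)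
    ultimately show ?thesis by (simp only: set_eq_iff mem_toggle) metis
  qed
  moreover have "finite (fst (dec d x))" "finite (snd (dec d x))" by (auto simp: dec_def)
  moreover have "z \<in> cE d \<longleftrightarrow> (even (card (fst z)) \<longleftrightarrow> even (card (snd z)))" if "z \<in> cV d" for z
    using that by (cases z) (auto simp: cE_def cV_def subs_def)
  ultimately show ?thesis using dec_cV[of d x] dec_cV[of d y] by auto
qed

text \<open>The fixed value 0 off the vertex set makes two pulled colorings equal as soon as they
  agree on \<open>cV d\<close>.\<close>

definition pull :: "nat \<Rightarrow> ((nat \<Rightarrow> nat) \<Rightarrow> nat) \<Rightarrow> vtx \<Rightarrow> nat" where
  "pull d \<sigma> v = (if v \<in> cV d then \<sigma> (enc d v) else 0)"

abbreviation three_colorings :: "nat \<Rightarrow> nat \<Rightarrow> ((nat \<Rightarrow> nat) \<Rightarrow> nat) set" where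
  "three_colorings n d \<equiv> proper_colorings (torus n d) (torus_adj n d) 3"

lemma pull_inj: "inj_on (pull d) (three_colorings 4 d)"
proof (rule inj_onI)
  fix \<sigma> \<sigma>' assume c: "\<sigma> \<in> three_colorings 4 d" "\<sigma>' \<in> three_colorings 4 d" and e: "pull d \<sigma> = pull d \<sigma>'"
  have "\<sigma> x = \<sigma>' x" if "x \<in> torus 4 d" for x
    using fun_cong[OF e, of "dec d x"] dec_cV[of d x] enc_dec[OF that] by (simp add: pull_def)
  then show "\<sigma> = \<sigma>'" using c by (intro PiE_ext[of \<sigma> "torus 4 d" "\<lambda>_. {..<3}"]) (auto simp: proper_colorings_def)
qed

lemma pull_upd: "x \<in> torus 4 d \<Longrightarrow> pull d (\<sigma>(x := j)) = (pull d \<sigma>)(dec d x := j)"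
proof
  fix v assume x: "x \<in> torus 4 d"
  show "pull d (\<sigma>(x := j)) v = ((pull d \<sigma>)(dec d x := j)) v"
  proof (cases "v \<in> cV d")
    case True
    have "enc d v = x \<longleftrightarrow> v = dec d x" using dec_enc[OF True] enc_dec[OF x] by metis
    then show ?thesis using True by (simp add: pull_def)
  next
    case False
    then show ?thesis using dec_cV[of d x] by (auto simp: pull_def)
  qed
qed

lemma pull_coloring:
  assumes d: "0 < d" and \<sigma>: "\<sigma> \<in> three_colorings 4 d"
  shows "split_cube.coloring (cE d) (cO1 d) (cO2 d) d cn1 cn2 (pull d \<sigma>)"
proof -
  interpret split_cube "cE d" "cO1 d" "cO2 d" d cn1 cn2 csh cxx by (rule split_cube_cube[OF d])
  have p: "pull d \<sigma> (P, Q) \<noteq> pull d \<sigma> (P', Q')"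
    if "(P, Q) \<in> cV d" "(P', Q') \<in> cV d" "torus_adj 4 d (enc d (P, Q)) (enc d (P', Q'))" for P Q P' Q'
    using that \<sigma> enc_torus by (auto simp: pull_def proper_colorings_def)
  show ?thesis unfolding coloring_def
  proof (intro conjI ballI allI impI)
    fix v assume "v \<in> cE d \<union> cO1 d \<union> cO2 d"
    then show "pull d \<sigma> v < 3" using \<sigma> enc_torus[of d v] by (auto simp: pull_def proper_colorings_def)
  next
    fix v a assume v: "v \<in> cE d" and a: "a < d"
    have V: "v \<in> cV d" "cn1 v a \<in> cV d" "cn2 v a \<in> cV d" using n1_in[OF v a] n2_in[OF v a] v cV_eq by auto
    obtain P Q where PQ: "v = (P, Q)" by (cases v)
    show "pull d \<sigma> v \<noteq> pull d \<sigma> (cn1 v a)" "pull d \<sigma> v \<noteq> pull d \<sigma> (cn2 v a)"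
      using V enc_adj[OF a, of P Q] p unfolding PQ by (auto simp: cn1_def cn2_def split: if_splits)
  qed
qed

text \<open>More than half of \<open>O2\<close> sees only color \<open>c\<close>; strictness keeps
  the phases of different colors disjoint.\<close>

definition phase :: "nat \<Rightarrow> nat \<Rightarrow> ((nat \<Rightarrow> nat) \<Rightarrow> nat) set" where
  "phase d c = {\<sigma> \<in> three_colorings 4 d. card (cO2 d) < 2 * split_cube.cnt (cE d) (cO2 d) d cn2 c (pull d \<sigma>)}"

lemma finite_three_colorings: "finite (three_colorings n d)"
  by (intro finite_proper_colorings finite_torus)

text \<open>Exchanging colors 0 and 1 maps this phase injectively into the disjoint phase of color
  1.\<close>

lemma card_phase_half:
  assumes d: "0 < d" shows "2 * card (phase d 0) \<le> card (three_colorings 4 d)"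
proof -
  interpret split_cube "cE d" "cO1 d" "cO2 d" d cn1 cn2 csh cxx by (rule split_cube_cube[OF d])
  define \<tau> where "\<tau> c = (if c = 0 then 1 else if c = 1 then 0 else c)" for c :: nat
  define r where "r \<sigma> = restrict (\<tau> \<circ> \<sigma>) (torus 4 d)" for \<sigma>
  have \<tau>: "\<tau> (\<tau> c) = c" "\<tau> c = \<tau> c' \<longleftrightarrow> c = c'" "c < 3 \<Longrightarrow> \<tau> c < 3" for c c'
    by (auto simp: \<tau>_def)
  have fin1: "finite (phase d c)" for c
    by (rule finite_subset[OF _ finite_three_colorings[of 4 d]]) (auto simp: phase_def)
  have inj: "inj_on r (phase d 0)"
  proof (rule inj_onI)
    fix \<sigma> \<sigma>' assume c: "\<sigma> \<in> phase d 0" "\<sigma>' \<in> phase d 0" and e: "r \<sigma> = r \<sigma>'"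
    have "\<sigma> x = \<sigma>' x" if "x \<in> torus 4 d" for x
      using fun_cong[OF e, of x] that by (simp add: r_def \<tau>(2))
    then show "\<sigma> = \<sigma>'" using c
      by (intro PiE_ext[of \<sigma> "torus 4 d" "\<lambda>_. {..<3}"]) (auto simp: proper_colorings_def phase_def)
  qed
  have img: "r ` phase d 0 \<subseteq> phase d 1"
  proof (rule image_subsetI)
    fix \<sigma> assume \<sigma>: "\<sigma> \<in> phase d 0"
    have "\<sigma> \<in> torus 4 d \<rightarrow>\<^sub>E {..<3}" using \<sigma> by (simp add: phase_def proper_colorings_def)
    then have "\<tau> (\<sigma> x) < 3" if "x \<in> torus 4 d" for x using PiE_mem[of \<sigma>, OF _ that] \<tau>(3) by blast
    then have rC: "r \<sigma> \<in> three_colorings 4 d" using \<sigma> \<tau>(2) by (auto simp: phase_def proper_colorings_def r_def)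
    have "pull d (r \<sigma>) v = \<tau> (pull d \<sigma> v)" if "v \<in> cV d" for v
      using that enc_torus by (simp add: pull_def r_def)
    then have "pull d (r \<sigma>) v = 1 \<longleftrightarrow> pull d \<sigma> v = 0" if "v \<in> cV d" for v
      using that by (auto simp: \<tau>_def)
    then have "cnt 1 (pull d (r \<sigma>)) = cnt 0 (pull d \<sigma>)"
      unfolding cnt_def using cV_eq by (intro arg_cong[where f=card]) (auto simp: nb_def)
    then show "r \<sigma> \<in> phase d 1" using rC \<sigma> by (simp add: phase_def)
  qed
  have disj: "phase d 0 \<inter> phase d 1 = {}"
  proof -
    have False if "\<sigma> \<in> phase d 0" "\<sigma> \<in> phase d 1" for \<sigma>
      using that cnt_disjoint[of 0 1 "pull d \<sigma>"] by (simp add: phase_def)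
    then show ?thesis by blast
  qed
  have "2 * card (phase d 0) = card (phase d 0) + card (r ` phase d 0)" by (simp add: card_image[OF inj])
  also have "\<dots> \<le> card (phase d 0) + card (phase d 1)" by (intro add_left_mono card_mono fin1 img)
  also have "\<dots> = card (phase d 0 \<union> phase d 1)" by (rule card_Un_disjoint[symmetric, OF fin1 fin1 disj])
  also have "\<dots> \<le> card (three_colorings 4 d)" by (rule card_mono[OF finite_three_colorings]) (auto simp: phase_def)
  finally show ?thesis .
qed

text \<open>\<open>E\<close> gets color 0 and each odd vertex 1 or 2 at will. There are as many odd
  vertices as even ones, and all of \<open>O2\<close> sees only color 0.\<close>

lemma card_phase_ge:
  assumes d: "0 < d" shows "2 ^ card (cE d) \<le> card (phase d 0)"
proof -
  interpret split_cube "cE d" "cO1 d" "cO2 d" d cn1 cn2 csh cxx by (rule split_cube_cube[OF d])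
  define g where "g B = (\<lambda>x\<in>torus 4 d. if dec d x \<in> cE d then 0 else if dec d x \<in> B then 1 else (2::nat))" for B
  let ?O = "cO1 d \<union> cO2 d"
  have disj: "cE d \<inter> ?O = {}" "cO1 d \<inter> cO2 d = {}" by (auto simp: cE_def cO1_def cO2_def subs_def)
  have gv: "pull d (g B) v = (if v \<in> cE d then 0 else if v \<in> B then 1 else 2)" if "v \<in> cV d" for B v
    using that enc_torus[of d v] by (simp add: pull_def g_def dec_enc)
  have inj: "inj_on g (Pow ?O)"
  proof (rule inj_onI)
    fix B B' assume B: "B \<in> Pow ?O" "B' \<in> Pow ?O" and e: "g B = g B'"
    have "v \<in> B \<longleftrightarrow> v \<in> B'" if v: "v \<in> ?O" for v
    proof -
      have nE: "v \<notin> cE d" and V: "v \<in> cV d" using v disj(1) cV_eq by blast+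
      have "pull d (g B) v = pull d (g B') v" by (simp only: e)
      then show ?thesis using nE by (simp add: gv[OF V] split: if_splits)
    qed
    then show "B = B'" using B by auto
  qed
  have "(2::real) ^ (2 * d) > 0" by simp
  then have N: "card (cO2 d) > 0" unfolding card_cO2[OF d, symmetric] by simp
  have img: "g ` Pow ?O \<subseteq> phase d 0"
  proof (rule image_subsetI)
    fix B assume "B \<in> Pow ?O"
    have gC: "g B \<in> three_colorings 4 d"
      unfolding proper_colorings_def using adj_dec[of _ d] by (auto simp: g_def)
    have "cnt 0 (pull d (g B)) = card (cO2 d)"
      unfolding cnt_def using gv cV_eq by (intro arg_cong[where f=card]) (auto simp: nb_def)
    then show "g B \<in> phase d 0" using gC N by (simp add: phase_def)
  qed
  have "card (cO1 d) = card (cO2 d)" by (simp add: cO1_def cO2_def card_cartesian_product)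
  then have "real (card (cE d)) = real (card ?O)" using card_E fin disj by (simp add: card_Un_disjoint)
  then have "2 ^ card (cE d) = card (g ` Pow ?O)" using fin by (simp add: card_image[OF inj] card_Pow)
  also have "\<dots> \<le> card (phase d 0)"
    by (rule card_mono[OF _ img]) (rule finite_subset[OF _ finite_three_colorings[of 4 d]], auto simp: phase_def)
  finally show ?thesis .
qed

lemma set_metropolis:
  assumes "finite V" "V \<noteq> {}" "0 < q" "\<sigma>' \<in> set_pmf (metropolis V adj q \<sigma>)"
  shows "\<sigma>' = \<sigma> \<or> (\<exists>v\<in>V. \<exists>j<q. \<sigma>' = \<sigma>(v := j) \<and> \<sigma>' \<in> proper_colorings V adj q)"
proof -
  have ne: "{..<q} \<noteq> {}" using assms(3) by auto
  then show ?thesis using assms by (auto simp: metropolis_def split: if_splits)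
qed

lemma uniform_chain_metropolis:
  assumes "finite V" "V \<noteq> {}" "0 < q" "proper_colorings V adj q \<noteq> {}"
  shows "uniform_chain (proper_colorings V adj q) (metropolis V adj q)"
  by standard (use assms in \<open>auto intro: finite_proper_colorings uniform_stationary_metropolis dest: set_pmf_metropolis[THEN subsetD]\<close>)

lemma torus_nonempty: "0 < n \<Longrightarrow> torus n d \<noteq> {}"
  by (auto simp: torus_def PiE_eq_empty_iff)

text \<open>The bottleneck \<open>D\<close> consists of the colorings in the phase whose count is at
  most 3/4 of \<open>O2\<close>. A single move lowers the count by at most \<open>d\<close>, less
  than the remaining quarter of \<open>O2\<close>, so the phase can only be left from
  \<open>D\<close>. There \<open>cube_bad\<close> supplies the bad edges, and \<open>D\<close> is
  smaller than the phase by the factor \<open>exp (- card (cE d) / (200 * d))\<close>.\<close>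

lemma mixing_time_torus4:
  assumes d: "1000000 \<le> d"
  shows "ereal (exp (card (cE d) / (200 * real d)) / 20 - 1) \<le> ereal_of_enat
    (mixing_time (three_colorings 4 d) (metropolis (torus 4 d) (torus_adj 4 d) 3) (pmf_of_set (three_colorings 4 d)))"
proof -
  have d0: "0 < d" using d by simp
  interpret split_cube "cE d" "cO1 d" "cO2 d" d cn1 cn2 csh cxx by (rule split_cube_cube[OF d0])
  let ?S = "phase d 0"
  define D where "D = {\<sigma>\<in>?S. real (cnt 0 (pull d \<sigma>)) \<le> 3 / 4 * card (cO2 d)}"
  have S: "?S \<subseteq> three_colorings 4 d" by (auto simp: phase_def)
  have "(0::nat) < 2 ^ card (cE d)" by simp
  also have "\<dots> \<le> card ?S" by (rule card_phase_ge[OF d0])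
  finally have Sne: "?S \<noteq> {}" by auto
  interpret uniform_chain "three_colorings 4 d" "metropolis (torus 4 d) (torus_adj 4 d) 3"
    by (rule uniform_chain_metropolis) (use S Sne torus_nonempty finite_torus in auto)
  have big: "4 * real d \<le> card (cO2 d)"
  proof -
    have "4 * card (cO2 d) = (2 ^ d * 2 ^ d :: real)"
      using card_cO2[OF d0] by (simp add: mult_2 power_add)
    moreover have "real d < 2 ^ d" by (rule of_nat_less_two_power)
    then have "real d * real d \<le> 2 ^ d * 2 ^ d" by (intro mult_mono) auto
    moreover have "16 * real d \<le> real d * real d" using d by (intro mult_right_mono) auto
    ultimately show ?thesis by linarith
  qed
  have leave: "set_pmf (metropolis (torus 4 d) (torus_adj 4 d) 3 \<sigma>) \<subseteq> ?S" if \<sigma>: "\<sigma> \<in> ?S - D" for \<sigma>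
  proof
    fix \<sigma>' assume "\<sigma>' \<in> set_pmf (metropolis (torus 4 d) (torus_adj 4 d) 3 \<sigma>)"
    from set_metropolis[OF finite_torus torus_nonempty _ this]
    consider "\<sigma>' = \<sigma>" | x j where "x \<in> torus 4 d" "\<sigma>' = \<sigma>(x := j)" "\<sigma>' \<in> three_colorings 4 d" by auto
    then show "\<sigma>' \<in> ?S"
    proof cases
      case 1
      then show ?thesis using \<sigma> by simp
    next
      case 2
      have "3 / 4 * card (cO2 d) < real (cnt 0 (pull d \<sigma>))" using \<sigma> by (auto simp: D_def)
      also have "\<dots> \<le> real (cnt 0 (pull d \<sigma>') + d)"
        unfolding 2(2) pull_upd[OF 2(1)] by (intro of_nat_mono cnt_upd)
      finally have "card (cO2 d) < 2 * real (cnt 0 (pull d \<sigma>'))" using big by simp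
      then have "card (cO2 d) < 2 * cnt 0 (pull d \<sigma>')" by linarith
      then show ?thesis using 2 by (simp add: phase_def)
    qed
  qed
  have D: "real (card D) \<le> exp (card (cE d) * ln 2 - card (cE d) / (200 * d))"
  proof (cases "D = {}")
    case False
    have DC: "D \<subseteq> three_colorings 4 d" using S by (auto simp: D_def)
    have "ln (card (pull d ` D)) \<le> card (cE d) * ln 2 - card (cE d) / (200 * d)"
    proof (rule card_le_if_many_bad[OF _ _ _ _ _ d])
      show "finite (pull d ` D)" using DC finite_subset[OF _ finite_three_colorings] by blast
      show "pull d ` D \<noteq> {}" using False by simp
      show cl: "coloring \<omega>" if "\<omega> \<in> pull d ` D" for \<omega> using that pull_coloring[OF d0] DC by auto
      show "\<omega> = \<omega>'" if "\<omega> \<in> pull d ` D" "\<omega>' \<in> pull d ` D" "\<And>v. v \<in> cE d \<union> cO1 d \<union> cO2 d \<Longrightarrow> \<omega> v = \<omega>' v" for \<omega> \<omega>'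
        using that unfolding cV_eq[symmetric] by (force simp: pull_def)
      show "card (cE d) / 32 \<le> num_bad \<omega>" if "\<omega> \<in> pull d ` D" for \<omega>
        by (rule cube_bad[OF d0 cl[OF that], of 0]) (use that in \<open>auto simp: D_def phase_def\<close>)
    qed
    moreover have "card (pull d ` D) = card D" using inj_on_subset[OF pull_inj DC] by (rule card_image)
    moreover have "card D > 0" using False DC finite_subset[OF DC finite_three_colorings] by (simp add: card_gt_0_iff)
    ultimately show ?thesis by (metis exp_le_cancel_iff exp_ln of_nat_0_less_iff)
  qed simp
  define x where "x = card (cE d) / (200 * d)"
  have Dsub: "D \<subseteq> ?S" by (auto simp: D_def)
  have "exp x * card D \<le> exp x * exp (card (cE d) * ln 2 - x)"
    using D by (intro mult_left_mono) (auto simp: x_def)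
  also have "\<dots> = exp (card (cE d) * ln 2)" by (simp flip: exp_add)
  also have "\<dots> = 2 ^ card (cE d)" by (simp add: exp_of_nat_mult)
  also have "\<dots> \<le> card ?S" using of_nat_mono[OF card_phase_ge[OF d0], where 'a=real] by simp
  finally have "20 * ((exp x / 20 - 1) + 1) * card D \<le> card ?S" by simp
  from mixing_time_ge[OF S Sne card_phase_half[OF d0] Dsub leave this]
  show ?thesis by (simp add: x_def)
qed

text \<open>Since \<open>card (cE d) = 2 * 4 ^ (d - 1)\<close>, the exponent \<open>x\<close> is at
  least twice the target \<open>y\<close>. With \<open>x \<ge> 10\<close> this leaves room for a
  factor \<open>exp 5 \<ge> 97\<close>, which absorbs both the division by 20 and the subtraction of
  1.\<close>

lemma exp_le_torus4:
  assumes d: "1000000 \<le> d"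
  shows "exp (4 ^ (d - 1) / (real d ^ 4 * (ln 4)\<^sup>2)) \<le> exp (card (cE d) / (200 * real d)) / 20 - 1"
proof -
  have d0: "0 < d" using d by simp
  interpret split_cube "cE d" "cO1 d" "cO2 d" d cn1 cn2 csh cxx by (rule split_cube_cube[OF d0])
  define p where "p = (4 ^ (d - 1) :: real)"
  define x where "x = p / (100 * d)"
  define y where "y = p / (real d ^ 4 * (ln 4)\<^sup>2)"
  have dr: "real d \<ge> 1000000" using d by simp
  have p4: "4 * p = 2 ^ (2 * d)" using d0 by (cases d) (auto simp: p_def power_mult)
  then have "card (cE d) = 2 * p" using card_E card_cO2[OF d0] by simp
  then have x: "card (cE d) / (200 * d) = x" by (simp add: x_def)
  have pd: "real d * real d \<le> 4 * p"
  proof -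
    have "real d < 2 ^ d" by (rule of_nat_less_two_power)
    then have "real d * real d \<le> 2 ^ d * 2 ^ d" by (intro mult_mono) auto
    then show ?thesis unfolding p4 by (simp add: mult_2 power_add)
  qed
  have p0: "p \<ge> 0" by (simp add: p_def)
  have x8: "x \<ge> 10"
  proof -
    have "1000000 * real d \<le> real d * real d" using dr by (intro mult_right_mono) auto
    then have "1000 * real d \<le> p" using pd dr by linarith
    then show ?thesis using d0 by (simp add: x_def field_simps)
  qed
  have l4: "(ln (4::real))\<^sup>2 \<ge> 1"
  proof -
    have "ln (4::real) = 2 * ln 2" using ln_realpow[of 2 2] by simp
    then have "ln (4::real) \<ge> 1" using ln2_ge_two_thirds by simp
    then show ?thesis by (rule one_le_power)
  qed
  have "y \<le> x / 2"
  proof -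
    have "200 * real d \<le> real d * real d" using dr by (intro mult_right_mono) auto
    also have "real d * real d = real d ^ 2" by (simp add: power2_eq_square)
    also have "\<dots> \<le> real d ^ 4" using dr by (intro power_increasing) auto
    also have "\<dots> \<le> real d ^ 4 * (ln 4)\<^sup>2" using l4 by (simp add: mult_le_cancel_left1)
    finally have "p / (real d ^ 4 * (ln 4)\<^sup>2) \<le> p / (200 * d)" using p0 d0 by (intro divide_left_mono) auto
    then show ?thesis by (simp add: x_def y_def)
  qed
  then have "y + 5 \<le> x" using x8 by linarith
  then have "exp (y + 5) \<le> exp x" by simp
  moreover have "exp (y + 5) = exp y * exp 5" by (rule exp_add)
  moreover have "exp (5::real) \<ge> 97"
  proof -
    have "(5 / 2 :: real) \<le> exp 1" using exp_lower_Taylor_quadratic[of 1] by (simp add: power2_eq_square)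
    then have "(5 / 2) ^ 5 \<le> exp (1::real) ^ 5" by (intro power_mono) auto
    also have "\<dots> = exp 5" by (simp flip: exp_of_nat_mult)
    finally show ?thesis by (rule order_trans[rotated]) (simp add: power_divide)
  qed
  then have "exp y * 97 \<le> exp y * exp 5" by (intro mult_left_mono) auto
  moreover have "y \<ge> 0" using p0 by (simp add: y_def)
  then have "exp y \<ge> 1" by simp
  ultimately have "exp y \<le> exp x / 20 - 1" by linarith
  then show ?thesis using x by (simp add: y_def p_def)
qed

section \<open>Winding numbers\<close>

text \<open>The difference of two colors mod 3, lifted to -1, 0 or 1. Its sum \<open>turn\<close>
  around a cycle is three times the winding number.\<close>

definition inc :: "nat \<Rightarrow> nat \<Rightarrow> int" where
  "inc a b = (if b = (a + 1) mod 3 then 1 else if a = (b + 1) mod 3 then - 1 else 0)"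

lemma inc_self: "inc a a = 0"
proof -
  have "a \<noteq> (a + 1) mod 3" by presburger
  then show ?thesis by (simp add: inc_def)
qed

definition turn :: "nat \<Rightarrow> (nat \<Rightarrow> nat) \<Rightarrow> int" where
  "turn n f = (\<Sum>i<n. inc (f i) (f (Suc i mod n)))"

lemma less3: "(a::nat) < 3 \<longleftrightarrow> a = 0 \<or> a = 1 \<or> a = 2"
  by linarith

text \<open>If \<open>c\<close> and \<open>j\<close> differ, then \<open>a\<close> and
  \<open>b\<close> both equal the third color, and each side is a step followed by its
  reverse.\<close>

lemma inc_cancel:
  "a < 3 \<Longrightarrow> b < 3 \<Longrightarrow> c < 3 \<Longrightarrow> j < 3 \<Longrightarrow> a \<noteq> c \<Longrightarrow> a \<noteq> j \<Longrightarrow> b \<noteq> c \<Longrightarrow> b \<noteq> j \<Longrightarrow>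
    inc a c + inc c b = inc a j + inc j b"
  unfolding less3 by (elim disjE) (simp_all add: inc_def)

lemma turn_upd:
  assumes n: "2 \<le> n" and m: "m < n" and f: "\<And>i. i < n \<Longrightarrow> f i < 3" "j < 3"
    and ne: "\<And>i. i < n \<Longrightarrow> f i \<noteq> f (Suc i mod n)"
    and ne': "\<And>i. i < n \<Longrightarrow> (f(m := j)) i \<noteq> (f(m := j)) (Suc i mod n)"
  shows "turn n (f(m := j)) = turn n f"
proof -
  let ?g = "f(m := j)"
  define p where "p = (if m = 0 then n - 1 else m - 1)"
  define q where "q = Suc m mod n"
  have p: "p < n" "Suc p mod n = m" "p \<noteq> m" using n m by (auto simp: p_def)
  have q: "q < n" "q \<noteq> m" using n m unfolding q_def by (cases "Suc m = n"; simp)+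
  have pu: "i = p" if "i < n" "Suc i mod n = m" for i
    using that m unfolding p_def by (cases "Suc i = n") auto
  let ?D = "\<lambda>i. inc (?g i) (?g (Suc i mod n)) - inc (f i) (f (Suc i mod n))"
  have "turn n ?g - turn n f = (\<Sum>i<n. ?D i)" by (simp add: turn_def sum_subtractf)
  also have "\<dots> = (\<Sum>i\<in>{m, p}. ?D i)"
  proof (rule sum.mono_neutral_right)
    show "\<forall>i\<in>{..<n} - {m, p}. ?D i = 0"
    proof
      fix i assume i: "i \<in> {..<n} - {m, p}"
      then have "Suc i mod n \<noteq> m" using pu[of i] by blast
      then show "?D i = 0" using i by simp
    qed
  qed (use m p(1) in simp_all)
  also have "\<dots> = ?D m + ?D p" using p by simp
  also have "\<dots> = (inc (f p) j + inc j (f q)) - (inc (f p) (f m) + inc (f m) (f q))"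
    using p q by (simp add: q_def[symmetric])
  also have "\<dots> = 0"
  proof -
    have "f p \<noteq> f m" "f m \<noteq> f q" "f p \<noteq> j" "j \<noteq> f q"
      using ne[OF p(1)] ne[OF m] ne'[OF p(1)] ne'[OF m] p q by (auto simp: q_def[symmetric])
    then show ?thesis using inc_cancel[of "f p" "f q" "f m" j] f p q m by auto
  qed
  finally show ?thesis by simp
qed

definition pt :: "nat \<Rightarrow> nat \<Rightarrow> nat \<Rightarrow> nat" where
  "pt d i = (\<lambda>k\<in>{..<d}. if k = 0 then i else 0)"

lemma pt_torus: "i < n \<Longrightarrow> pt d i \<in> torus n d"
  by (auto simp: pt_def torus_def)

lemma pt_inj: "0 < d \<Longrightarrow> pt d i = pt d i' \<longleftrightarrow> i = i'"
  by (auto simp: pt_def fun_eq_iff restrict_def)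

lemma pt_adj:
  assumes "0 < d" "2 \<le> n" "i < n"
  shows "torus_adj n d (pt d i) (pt d (Suc i mod n))"
  unfolding torus_adj_def
  by (rule exI[of _ 0]) (use assms in \<open>auto simp: pt_def mod_Suc\<close>)

definition wind :: "nat \<Rightarrow> nat \<Rightarrow> ((nat \<Rightarrow> nat) \<Rightarrow> nat) \<Rightarrow> int" where
  "wind n d \<sigma> = turn n (\<lambda>i. \<sigma> (pt d i))"

lemma three_colorings_less: "\<sigma> \<in> three_colorings n d \<Longrightarrow> x \<in> torus n d \<Longrightarrow> \<sigma> x < 3"
  by (auto simp: proper_colorings_def)

lemma three_colorings_line:
  assumes "0 < d" "2 \<le> n" "\<sigma> \<in> three_colorings n d" "i < n"
  shows "\<sigma> (pt d i) \<noteq> \<sigma> (pt d (Suc i mod n))"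
  using assms pt_adj[OF assms(1,2,4)] pt_torus[of i n d] pt_torus[of "Suc i mod n" n d]
  by (auto simp: proper_colorings_def)

lemma wind_upd:
  assumes "0 < d" "2 \<le> n" "\<sigma> \<in> three_colorings n d" "\<sigma>(x := j) \<in> three_colorings n d"
  shows "wind n d (\<sigma>(x := j)) = wind n d \<sigma>"
proof (cases "\<exists>m<n. x = pt d m")
  case True
  then obtain m where m: "m < n" "x = pt d m" by auto
  have e: "(\<lambda>i. (\<sigma>(x := j)) (pt d i)) = (\<lambda>i. \<sigma> (pt d i))(m := j)"
    using pt_inj[OF assms(1)] by (auto simp: m(2))
  have j: "j < 3" using three_colorings_less[OF assms(4) pt_torus[OF m(1)]] m(2) by simp
  show ?thesis unfolding wind_def e
  proof (rule turn_upd[OF assms(2) m(1) _ j])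
    show "\<sigma> (pt d i) < 3" if "i < n" for i using three_colorings_less[OF assms(3) pt_torus[OF that]] .
    show "\<sigma> (pt d i) \<noteq> \<sigma> (pt d (Suc i mod n))" if "i < n" for i using three_colorings_line[OF assms(1-3) that] .
    show "((\<lambda>i. \<sigma> (pt d i))(m := j)) i \<noteq> ((\<lambda>i. \<sigma> (pt d i))(m := j)) (Suc i mod n)" if "i < n" for i
      using three_colorings_line[OF assms(1,2,4) that] unfolding e[symmetric] .
  qed
next
  case False
  then have "(\<sigma>(x := j)) (pt d i) = \<sigma> (pt d i)" if "i < n" for i using that by auto
  then show ?thesis unfolding wind_def turn_def using assms(2) by (intro sum.cong refl) auto
qed

text \<open>Two rounds through 0, 1, 2, then 0 and 1 in alternation. One round would leave an odd
  number of steps, which cannot cancel; after two rounds the remaining steps cancel in pairs,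
  including the one that closes the cycle.\<close>

definition zig :: "nat \<Rightarrow> nat" where
  "zig k = (if k < 6 then k mod 3 else k mod 2)"

lemma inc_zig:
  assumes n: "6 \<le> n" "even n" and i: "i < n"
  shows "inc (zig i) (zig (Suc i mod n)) = (if i < 6 then 1 else (- 1) ^ i)"
proof (cases "i < 6")
  case True
  then have "i = 0 \<or> i = 1 \<or> i = 2 \<or> i = 3 \<or> i = 4 \<or> i = 5" by linarith
  moreover have "n = 6 \<or> 6 < n" using n by linarith
  ultimately show ?thesis by (elim disjE) (simp_all add: zig_def inc_def)
next
  case False
  show ?thesis
  proof (cases "Suc i = n")
    case True
    then have "odd i" using n by auto
    then have "i mod 2 = 1" by (simp add: odd_iff_mod_2_eq_one)
    then show ?thesis using False True \<open>odd i\<close> by (simp add: zig_def inc_def)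
  next
    case nw: False
    then have "Suc i < n" using i by simp
    then show ?thesis using False
      by (cases "even i") (auto simp: zig_def inc_def even_iff_mod_2_eq_zero odd_iff_mod_2_eq_one mod_Suc)
  qed
qed

lemma turn_zig:
  assumes n: "6 \<le> n" "even n"
  shows "turn n zig = 6"
proof -
  obtain m where m: "n = 2 * m" using n(2) by (rule evenE)
  define k where "k = m - 3"
  have k: "n = 6 + 2 * k" using m n(1) by (simp add: k_def)
  have "(\<Sum>i<6 + 2 * k. if i < 6 then 1 else (- 1) ^ i) = (6::int)"
  proof (induction k)
    case 0
    have "(\<Sum>i<6. if i < 6 then 1 else (- 1) ^ i) = (\<Sum>i<6::nat. 1::int)" by (intro sum.cong) auto
    then show ?case by simp
  next
    case (Suc k)
    have e: "6 + 2 * Suc k = Suc (Suc (6 + 2 * k))" by simp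
    show ?case unfolding e sum.lessThan_Suc Suc by simp
  qed
  then show ?thesis unfolding turn_def using inc_zig[OF n] by (simp add: k)
qed

lemma mixing_time_infinite:
  assumes d: "0 < d" and n: "6 \<le> n" "even n"
  shows "ereal T \<le> ereal_of_enat
    (mixing_time (three_colorings n d) (metropolis (torus n d) (torus_adj n d) 3) (pmf_of_set (three_colorings n d)))"
proof -
  have n2: "2 \<le> n" using n by simp
  define S where "S = {\<sigma>\<in>three_colorings n d. 0 < wind n d \<sigma>}"
  have S: "S \<subseteq> three_colorings n d" by (auto simp: S_def)
  \<comment> \<open>The coordinate sum moves by one mod \<open>n\<close> along every edge, so a
    proper coloring of the cycle extends to the torus and restricts to itself on the line
    \<open>pt\<close>.\<close>
  define z where "z = (\<lambda>x\<in>torus n d. zig ((\<Sum>k<d. x k) mod n))"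
  have zig_ne: "zig (s mod n) \<noteq> zig (Suc s mod n)" for s
  proof -
    have "inc (zig (s mod n)) (zig (Suc (s mod n) mod n)) \<noteq> 0" using inc_zig[OF n, of "s mod n"] n by simp
    then have "inc (zig (s mod n)) (zig (Suc s mod n)) \<noteq> 0" unfolding mod_Suc_eq .
    then show ?thesis by (metis inc_self)
  qed
  have adj_sum: "zig ((\<Sum>k<d. x k) mod n) \<noteq> zig ((\<Sum>k<d. y k) mod n)"
    if i: "i < d" "\<forall>j<d. j \<noteq> i \<longrightarrow> x j = y j" "y i mod n = (x i + 1) mod n" for x y i
  proof -
    have r: "(\<Sum>k<d. f k) = f i + (\<Sum>k\<in>{..<d} - {i}. f k)" for f :: "nat \<Rightarrow> nat"
      using i by (subst sum.remove[of _ i]) auto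
    have "(\<Sum>k\<in>{..<d} - {i}. y k) = (\<Sum>k\<in>{..<d} - {i}. x k)" using i by (intro sum.cong) auto
    then have "(\<Sum>k<d. y k) mod n = ((x i + 1) + (\<Sum>k\<in>{..<d} - {i}. x k)) mod n"
      unfolding r[of y] using i(3) by (metis mod_add_left_eq)
    also have "\<dots> = Suc (\<Sum>k<d. x k) mod n" unfolding r[of x] by simp
    finally show ?thesis using zig_ne by metis
  qed
  have zC: "z \<in> three_colorings n d"
  proof -
    have "z x \<noteq> z y" if "x \<in> torus n d" "y \<in> torus n d" "torus_adj n d x y" for x y
    proof -
      obtain i where i: "i < d" "\<forall>j<d. j \<noteq> i \<longrightarrow> x j = y j"
        "y i mod n = (x i + 1) mod n \<or> x i mod n = (y i + 1) mod n"
        using \<open>torus_adj n d x y\<close> by (auto simp: torus_adj_def)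
      have "zig ((\<Sum>k<d. x k) mod n) \<noteq> zig ((\<Sum>k<d. y k) mod n)"
        using i(3) adj_sum[OF i(1,2)] adj_sum[of i y x] i(1,2) by metis
      then show ?thesis using that by (simp add: z_def)
    qed
    moreover have "zig s < 3" for s using mod_less_divisor[of 3 s] mod_less_divisor[of 2 s]
      unfolding zig_def by (auto intro: less_trans)
    ultimately show ?thesis by (auto simp: proper_colorings_def z_def)
  qed
  have zpt: "z (pt d i) = zig i" if "i < n" for i
  proof -
    have "(\<Sum>k<d. pt d i k) = (\<Sum>k<d. if k = 0 then i else 0)" by (simp add: pt_def)
    also have "\<dots> = i" using d by simp
    finally show ?thesis using that pt_torus[OF that] by (simp add: z_def)
  qed
  have "wind n d z = turn n zig"
    unfolding wind_def turn_def using zpt n by (intro sum.cong refl) auto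
  then have zS: "z \<in> S" using zC turn_zig[OF n] by (simp add: S_def)
  interpret uniform_chain "three_colorings n d" "metropolis (torus n d) (torus_adj n d) 3"
    by (rule uniform_chain_metropolis) (use zC torus_nonempty[of n d] finite_torus n in auto)
  \<comment> \<open>Negating the colors mod 3 reverses the winding, which makes \<open>S\<close>
    disjoint from its mirror image.\<close>
  define \<nu> where "\<nu> c = (3 - c) mod 3" for c :: nat
  have \<nu>: "\<nu> a < 3" "a < 3 \<Longrightarrow> b < 3 \<Longrightarrow> \<nu> a = \<nu> b \<longleftrightarrow> a = b" "a < 3 \<Longrightarrow> b < 3 \<Longrightarrow> inc (\<nu> a) (\<nu> b) = - inc a b" for a b
  proof -
    show "\<nu> a < 3" by (simp add: \<nu>_def)
    show "\<nu> a = \<nu> b \<longleftrightarrow> a = b" if "a < 3" "b < 3"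
      using that unfolding less3 by (elim disjE) (simp_all add: \<nu>_def)
    show "inc (\<nu> a) (\<nu> b) = - inc a b" if "a < 3" "b < 3"
      using that unfolding less3 by (elim disjE) (simp_all add: \<nu>_def inc_def)
  qed
  define r where "r \<sigma> = restrict (\<nu> \<circ> \<sigma>) (torus n d)" for \<sigma>
  have rC: "r \<sigma> \<in> three_colorings n d" if \<sigma>: "\<sigma> \<in> three_colorings n d" for \<sigma>
    using three_colorings_less[OF \<sigma>] \<nu>(1,2) \<sigma> by (auto simp: proper_colorings_def r_def)
  have rw: "wind n d (r \<sigma>) = - wind n d \<sigma>" if \<sigma>: "\<sigma> \<in> three_colorings n d" for \<sigma>
    unfolding wind_def turn_def sum_negf[symmetric]
    using three_colorings_less[OF \<sigma> pt_torus] \<nu>(3) pt_torus[of _ n d] n by (intro sum.cong refl) (auto simp: r_def)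
  have inj: "inj_on r S"
  proof (rule inj_onI)
    fix \<sigma> \<sigma>' assume c: "\<sigma> \<in> S" "\<sigma>' \<in> S" and e: "r \<sigma> = r \<sigma>'"
    have "\<sigma> x = \<sigma>' x" if x: "x \<in> torus n d" for x
      using fun_cong[OF e, of x] x \<nu>(2)[of "\<sigma> x" "\<sigma>' x"] three_colorings_less[OF _ x] c S by (auto simp: r_def)
    then show "\<sigma> = \<sigma>'" using c
      by (intro PiE_ext[of \<sigma> "torus n d" "\<lambda>_. {..<3}"]) (auto simp: proper_colorings_def S_def)
  qed
  have fS: "finite S" using S finite_three_colorings by (rule finite_subset)
  have "2 * card S = card S + card (r ` S)" by (simp add: card_image[OF inj])
  also have "\<dots> = card (S \<union> r ` S)"
    using fS rw by (intro card_Un_disjoint[symmetric]) (auto simp: S_def)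
  also have "\<dots> \<le> card (three_colorings n d)" using rC S by (intro card_mono[OF finite_three_colorings]) auto
  finally have half: "2 * card S \<le> card (three_colorings n d)" .
  have leave: "set_pmf (metropolis (torus n d) (torus_adj n d) 3 \<sigma>) \<subseteq> S" if \<sigma>: "\<sigma> \<in> S - {}" for \<sigma>
  proof
    fix \<sigma>' assume "\<sigma>' \<in> set_pmf (metropolis (torus n d) (torus_adj n d) 3 \<sigma>)"
    from set_metropolis[OF finite_torus torus_nonempty _ this] n
    have "\<sigma>' = \<sigma> \<or> (\<exists>x j. \<sigma>' = \<sigma>(x := j) \<and> \<sigma>' \<in> three_colorings n d)" by auto
    then show "\<sigma>' \<in> S" using wind_upd[OF d n2] \<sigma> by (auto simp: S_def)
  qed
  show ?thesis by (rule mixing_time_ge[where D="{}", OF S _ half _ leave]) (use zS in auto)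
qed

theorem theorem1p4:
  shows "\<exists>d\<^sub>0>0. \<forall>d\<ge>d\<^sub>0. \<forall>n\<ge>4. even n \<longrightarrow>
    ereal (exp (real n ^ (d - 1) / (real d ^ 4 * (ln (real n))\<^sup>2)))
      \<le> ereal_of_enat
          (mixing_time
            (proper_colorings (torus n d) (torus_adj n d) 3)
            (metropolis (torus n d) (torus_adj n d) 3)
            (pmf_of_set (proper_colorings (torus n d) (torus_adj n d) 3)))"
\<comment> \<open>The threshold comes from \<open>n = 4\<close>, where it keeps terms such as
  \<open>6 * (14 * ln 2) / d\<close> below 1/10000.\<close>
proof (intro exI[of _ 1000000] conjI allI impI)
  fix d n :: nat assume d: "1000000 \<le> d" and n: "4 \<le> n" "even n"
  have "n \<noteq> 5" using n by auto
  then consider "n = 4" | "6 \<le> n" using n by linarith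
  then show "ereal (exp (real n ^ (d - 1) / (real d ^ 4 * (ln (real n))\<^sup>2)))
      \<le> ereal_of_enat (mixing_time (three_colorings n d) (metropolis (torus n d) (torus_adj n d) 3) (pmf_of_set (three_colorings n d)))"
  proof cases
    case 1
    have "ereal (exp (4 ^ (d - 1) / (real d ^ 4 * (ln 4)\<^sup>2))) \<le> ereal (exp (card (cE d) / (200 * real d)) / 20 - 1)"
      using exp_le_torus4[OF d] by simp
    from order_trans[OF this mixing_time_torus4[OF d]] show ?thesis unfolding 1 by simp
  next
    case 2
    then show ?thesis using d n by (intro mixing_time_infinite) auto
  qed
qed simp

end
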